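(* Let $S$ be a local set theory in a local language $\mathcal L$, and let $f:X\to Y$ be an $S$-function with $X$ of type $\mathbf{PA}$ and $Y$ of type $\mathbf{PB}$. Let $i_X=(x\mapsto x):X\to U_{\mathbf A}$ and $i_Y=(y\mapsto y):Y\to U_{\mathbf B}$. Then, with $u$ a variable of type $\mathbf X$, $$\vdash_{\mathrm{Th}(\mathscr T(S))}\langle\mathbf{i_X}(u),\mathbf{i_Y}(\mathbf f(u))\rangle\in|f|.$$
   Context: Local languages and local set theories are in the sense of J. L. Bell (Toposes and Local Set Theories); $\vdash_S$ denotes derivability in $S$. An $S$-set is a closed term of power type; $U_{\mathbf A}=\{x_{\mathbf A}:true\}$. An $S$-function $f:X\to Y$ is a triple $(|f|,X,Y)$ with $\vdash_S|f|\in Y^X$; these form the linguistic topos $\mathscr T(S)$. $(x\mapsto\tau)$ is the $S$-function with graph $\{\langle x,\tau\rangle:x\in X\}$. For a topos $\mathscr E$, its internal language $\mathcal L(\mathscr E)$ has a type symbol $\mathbf Z$ for each object $Z$ and a function symbol $\mathbf g$ of signature $\mathbf{dom\,g}\to\mathbf{cod\,g}$ for each arrow $g$; $\mathrm{Th}(\mathscr E)$ is the local set theory in $\mathcal L(\mathscr E)$ consisting of the sequents valid in the natural interpretation of $\mathcal L(\mathscr E)$ in $\mathscr E$ (sending $\mathbf Z\mapsto Z$, $\mathbf g\mapsto g$). The canonical translation $\eta_S:\mathcal L\to\mathcal L(\mathscr T(S))$ sends each type $\mathbf A$ to the type symbol of $U_{\mathbf A}$ and each function symbol $\mathbf h$ to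 the function symbol of $(x\mapsto\mathbf h(x))$; it is conservative, and via it $S$-sets, $S$-functions and formulae of $S$ are regarded as those of $\mathrm{Th}(\mathscr T(S))$ (so $X,Y,|f|$ appear in the displayed formula). Here $\mathbf X$, $\mathbf f$, $\mathbf{i_X}$, $\mathbf{i_Y}$ are the type and function symbols of $\mathcal L(\mathscr T(S))$ corresponding to the object $X$ and the arrows $f,i_X,i_Y$ of $\mathscr T(S)$. *)

theory Defs
  imports Main
begin

section \<open>Local languages\<close>

text \<open>
  The unit type is the empty product. Products of length one are excluded by \<open>wf_ty\<close>:
  in Bell's convention such a product is the type itself.
\<close>

datatype 'g ty = Gr 'g | Om | Prod "'g ty list" | Pw "'g ty"

abbreviation One :: "'g ty" where "One \<equiv> Prod []"

type_synonym 'g var = "nat \<times> 'g ty"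

record ('g, 'f) lang =
  gnds :: "'g set"
  fns :: "'f set"
  fdom :: "'f \<Rightarrow> 'g ty"
  fcod :: "'f \<Rightarrow> 'g ty"

text \<open>The types over a set \<open>G\<close> of ground types.\<close>

fun wf_ty :: "'g set \<Rightarrow> 'g ty \<Rightarrow> bool" where
  "wf_ty G (Gr g) \<longleftrightarrow> g \<in> G"
| "wf_ty G Om \<longleftrightarrow> True"
| "wf_ty G (Prod As) \<longleftrightarrow> length As \<noteq> 1 \<and> (\<forall>A\<in>set As. wf_ty G A)"
| "wf_ty G (Pw A) \<longleftrightarrow> wf_ty G A"

definition local_language :: "('g, 'f) lang \<Rightarrow> bool" where
  "local_language L \<longleftrightarrow> (\<forall>h\<in>fns L. wf_ty (gnds L) (fdom L h) \<and> wf_ty (gnds L) (fcod L h))"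

text \<open>
  Locally nameless terms: free variables are Bell's typed variables, the variable bound by a
  comprehension \<open>Cm A t\<close> is a de Bruijn index (so terms are taken up to renaming of bound
  variables). \<open>Tup []\<close> is the term \<open>\<star>\<close> of unit type. \<open>Pr As i t\<close> is the \<open>i\<close>-th component of
  \<open>t\<close>, counted from 0; the list \<open>As\<close> records that \<open>t\<close> is of type \<open>Prod As\<close>, which is
  determined by \<open>t\<close> anyway.
\<close>

datatype ('g, 'f) tm =
    Fv "'g var"
  | Bv nat
  | Fn 'f "('g, 'f) tm"
  | Tup "('g, 'f) tm list"
  | Pr "'g ty list" nat "('g, 'f) tm"
  | Cm "'g ty" "('g, 'f) tm"
  | Eq "('g, 'f) tm" "('g, 'f) tm"
  | Mem "('g, 'f) tm" "('g, 'f) tm"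

text \<open>In \<open>has_ty L Bs t A\<close> the list \<open>Bs\<close> gives the types of the dangling indices; proper terms
  of the language are those typed with \<open>Bs = []\<close>.\<close>

inductive has_ty :: "('g, 'f) lang \<Rightarrow> 'g ty list \<Rightarrow> ('g, 'f) tm \<Rightarrow> 'g ty \<Rightarrow> bool"
  for L :: "('g, 'f) lang" where
  "wf_ty (gnds L) (snd x) \<Longrightarrow> has_ty L Bs (Fv x) (snd x)"
| "i < length Bs \<Longrightarrow> has_ty L Bs (Bv i) (Bs ! i)"
| "h \<in> fns L \<Longrightarrow> has_ty L Bs t (fdom L h) \<Longrightarrow> has_ty L Bs (Fn h t) (fcod L h)"
| "length ts \<noteq> 1 \<Longrightarrow> list_all2 (has_ty L Bs) ts As \<Longrightarrow> has_ty L Bs (Tup ts) (Prod As)"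
| "has_ty L Bs t (Prod As) \<Longrightarrow> i < length As \<Longrightarrow> has_ty L Bs (Pr As i t) (As ! i)"
| "wf_ty (gnds L) A \<Longrightarrow> has_ty L (A # Bs) t Om \<Longrightarrow> has_ty L Bs (Cm A t) (Pw A)"
| "has_ty L Bs s A \<Longrightarrow> has_ty L Bs t A \<Longrightarrow> has_ty L Bs (Eq s t) Om"
| "has_ty L Bs s A \<Longrightarrow> has_ty L Bs t (Pw A) \<Longrightarrow> has_ty L Bs (Mem s t) Om"

abbreviation formula :: "('g, 'f) lang \<Rightarrow> ('g, 'f) tm \<Rightarrow> bool" where
  "formula L \<alpha> \<equiv> has_ty L [] \<alpha> Om"

primrec fv :: "('g, 'f) tm \<Rightarrow> 'g var set" where
  "fv (Fv x) = {x}"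
| "fv (Bv i) = {}"
| "fv (Fn h t) = fv t"
| "fv (Tup ts) = \<Union> (set (map fv ts))"
| "fv (Pr As i t) = fv t"
| "fv (Cm A t) = fv t"
| "fv (Eq s t) = fv s \<union> fv t"
| "fv (Mem s t) = fv s \<union> fv t"

text \<open>\<open>subst x s t\<close> is used for \<open>s\<close> without dangling indices only, so no capture can occur.\<close>

primrec subst :: "'g var \<Rightarrow> ('g, 'f) tm \<Rightarrow> ('g, 'f) tm \<Rightarrow> ('g, 'f) tm" where
  "subst x s (Fv y) = (if y = x then s else Fv y)"
| "subst x s (Bv i) = Bv i"
| "subst x s (Fn h t) = Fn h (subst x s t)"
| "subst x s (Tup ts) = Tup (map (subst x s) ts)"
| "subst x s (Pr As i t) = Pr As i (subst x s t)"
| "subst x s (Cm A t) = Cm A (subst x s t)"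
| "subst x s (Eq t u) = Eq (subst x s t) (subst x s u)"
| "subst x s (Mem t u) = Mem (subst x s t) (subst x s u)"

primrec bind :: "'g var \<Rightarrow> ('g, 'f) tm \<Rightarrow> nat \<Rightarrow> ('g, 'f) tm" where
  "bind x (Fv y) k = (if y = x then Bv k else Fv y)"
| "bind x (Bv i) k = Bv i"
| "bind x (Fn h t) k = Fn h (bind x t k)"
| "bind x (Tup ts) k = Tup (map (\<lambda>t. bind x t k) ts)"
| "bind x (Pr As i t) k = Pr As i (bind x t k)"
| "bind x (Cm A t) k = Cm A (bind x t (Suc k))"
| "bind x (Eq t u) k = Eq (bind x t k) (bind x u k)"
| "bind x (Mem t u) k = Mem (bind x t k) (bind x u k)"

text \<open>The term \<open>{x : \<alpha>}\<close>.\<close>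

definition compr :: "'g var \<Rightarrow> ('g, 'f) tm \<Rightarrow> ('g, 'f) tm" where
  "compr x \<alpha> = Cm (snd x) (bind x \<alpha> 0)"

text \<open>A variable name making \<open>(fresh A V, A)\<close> a variable outside the finite set \<open>V\<close>. It is used
  for variables that are bound at once, hence the choice is immaterial.\<close>

definition fresh :: "'g ty \<Rightarrow> 'g var set \<Rightarrow> nat" where
  "fresh A V = (LEAST n. (n, A) \<notin> V)"

subsection \<open>Bell's defined logical operations and set constructions\<close>

definition tt :: "('g, 'f) tm" where
  "tt = Eq (Tup []) (Tup [])"

definition conj :: "('g, 'f) tm \<Rightarrow> ('g, 'f) tm \<Rightarrow> ('g, 'f) tm" where
  "conj \<alpha> \<beta> = Eq (Tup [\<alpha>, \<beta>]) (Tup [tt, tt])"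

fun conjs :: "('g, 'f) tm list \<Rightarrow> ('g, 'f) tm" where
  "conjs [] = tt"
| "conjs [\<alpha>] = \<alpha>"
| "conjs (\<alpha> # \<beta> # \<gamma>s) = conj \<alpha> (conjs (\<beta> # \<gamma>s))"

definition imp :: "('g, 'f) tm \<Rightarrow> ('g, 'f) tm \<Rightarrow> ('g, 'f) tm" where
  "imp \<alpha> \<beta> = Eq (conj \<alpha> \<beta>) \<alpha>"

definition all :: "'g var \<Rightarrow> ('g, 'f) tm \<Rightarrow> ('g, 'f) tm" where
  "all x \<alpha> = Eq (compr x \<alpha>) (compr x tt)"

definition ex :: "'g var \<Rightarrow> ('g, 'f) tm \<Rightarrow> ('g, 'f) tm" where
  "ex x \<alpha> = (let w = (fresh Om (insert x (fv \<alpha>)), Om)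
             in all w (imp (all x (imp \<alpha> (Fv w))) (Fv w)))"

definition ex1 :: "'g var \<Rightarrow> ('g, 'f) tm \<Rightarrow> ('g, 'f) tm" where
  "ex1 x \<alpha> = (let y = (fresh (snd x) (insert x (fv \<alpha>)), snd x)
              in ex x (conj \<alpha> (all y (imp (subst x (Fv y) \<alpha>) (Eq (Fv x) (Fv y))))))"

text \<open>\<open>sabs [x\<^sub>1,\<dots>,x\<^sub>n] C \<sigma> \<alpha>\<close> is the term \<open>{\<sigma> : \<alpha>} = {w : \<exists>x\<^sub>1\<dots>\<exists>x\<^sub>n. w = \<sigma> \<and> \<alpha>}\<close>, where \<open>C\<close> is the
  type of \<open>\<sigma>\<close>.\<close>

definition sabs :: "'g var list \<Rightarrow> 'g ty \<Rightarrow> ('g, 'f) tm \<Rightarrow> ('g, 'f) tm \<Rightarrow> ('g, 'f) tm" where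
  "sabs xs C \<sigma> \<alpha> = (let w = (fresh C (set xs \<union> fv \<sigma> \<union> fv \<alpha>), C)
                    in compr w (foldr ex xs (conj (Eq (Fv w) \<sigma>) \<alpha>)))"

definition univ :: "'g ty \<Rightarrow> ('g, 'f) tm" where
  "univ A = compr (0, A) tt"

text \<open>\<open>s \<subseteq> t\<close>, for \<open>s\<close> and \<open>t\<close> of type \<open>Pw A\<close>.\<close>

definition subs :: "'g ty \<Rightarrow> ('g, 'f) tm \<Rightarrow> ('g, 'f) tm \<Rightarrow> ('g, 'f) tm" where
  "subs A s t = (let x = (fresh A (fv s \<union> fv t), A) in all x (imp (Mem (Fv x) s) (Mem (Fv x) t)))"

text \<open>In the following constructions the arguments \<open>X\<close>, \<open>Y\<close>, \<open>Xs\<close>, \<open>F\<close>, \<open>G\<close> are closed terms.\<close>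

definition powset :: "'g ty \<Rightarrow> ('g, 'f) tm \<Rightarrow> ('g, 'f) tm" where
  "powset A X = compr (0, Pw A) (subs A (Fv (0, Pw A)) X)"

definition vars :: "'g ty list \<Rightarrow> 'g var list" where
  "vars As = zip [0..<length As] As"

definition mems :: "'g ty list \<Rightarrow> ('g, 'f) tm list \<Rightarrow> ('g, 'f) tm" where
  "mems As Xs = conjs (map2 (\<lambda>x X. Mem (Fv x) X) (vars As) Xs)"

text \<open>\<open>X\<^sub>1 \<times> \<dots> \<times> X\<^sub>n = {\<langle>x\<^sub>1,\<dots>,x\<^sub>n\<rangle> : x\<^sub>1 \<in> X\<^sub>1 \<and> \<dots> \<and> x\<^sub>n \<in> X\<^sub>n}\<close>, where \<open>n \<noteq> 1\<close>.\<close>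

definition prodset :: "'g ty list \<Rightarrow> ('g, 'f) tm list \<Rightarrow> ('g, 'f) tm" where
  "prodset As Xs = sabs (vars As) (Prod As) (Tup (map Fv (vars As))) (mems As Xs)"

text \<open>\<open>Y\<^sup>X = {u : u \<subseteq> X \<times> Y \<and> (\<forall>x\<in>X. \<exists>!y\<in>Y. \<langle>x,y\<rangle> \<in> u)}\<close>, for \<open>X\<close> of type \<open>Pw A\<close>, \<open>Y\<close> of type \<open>Pw B\<close>.\<close>

definition expset :: "'g ty \<Rightarrow> 'g ty \<Rightarrow> ('g, 'f) tm \<Rightarrow> ('g, 'f) tm \<Rightarrow> ('g, 'f) tm" where
  "expset A B X Y =
    (let u = (0, Pw (Prod [A, B])); x = (1, A); y = (2, B)
     in compr u (conj (subs (Prod [A, B]) (Fv u) (prodset [A, B] [X, Y]))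
          (all x (imp (Mem (Fv x) X)
             (ex1 y (conj (Mem (Fv y) Y) (Mem (Tup [Fv x, Fv y]) (Fv u))))))))"

section \<open>Local set theories\<close>

type_synonym ('g, 'f) sequent = "('g, 'f) tm set \<times> ('g, 'f) tm"

definition sequent :: "('g, 'f) lang \<Rightarrow> ('g, 'f) sequent \<Rightarrow> bool" where
  "sequent L = (\<lambda>(\<Gamma>, \<alpha>). finite \<Gamma> \<and> (\<forall>\<gamma>\<in>\<Gamma>. formula L \<gamma>) \<and> formula L \<alpha>)"

text \<open>Since types may be empty, the cut rule requires the free variables of the cut formula to
  occur in the conclusion.\<close>

inductive derives ::
    "('g, 'f) lang \<Rightarrow> ('g, 'f) sequent set \<Rightarrow> ('g, 'f) tm set \<Rightarrow> ('g, 'f) tm \<Rightarrow> bool"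
  for L :: "('g, 'f) lang" and S :: "('g, 'f) sequent set" where
  hypothesis: "(\<Gamma>, \<alpha>) \<in> S \<Longrightarrow> derives L S \<Gamma> \<alpha>"
| tautology: "formula L \<alpha> \<Longrightarrow> derives L S {\<alpha>} \<alpha>"
| unity: "snd x = One \<Longrightarrow> derives L S {} (Eq (Fv x) (Tup []))"
| equality: "formula L \<alpha> \<Longrightarrow> wf_ty (gnds L) A \<Longrightarrow> snd x = A \<Longrightarrow> snd y = A \<Longrightarrow> snd z = A \<Longrightarrow>
    derives L S {Eq (Fv x) (Fv y), subst z (Fv x) \<alpha>} (subst z (Fv y) \<alpha>)"
| product_comp: "wf_ty (gnds L) (Prod (map snd xs)) \<Longrightarrow> i < length xs \<Longrightarrow>
    derives L S {} (Eq (Pr (map snd xs) i (Tup (map Fv xs))) (Fv (xs ! i)))"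
| product_eta: "wf_ty (gnds L) (Prod As) \<Longrightarrow> snd x = Prod As \<Longrightarrow>
    derives L S {} (Eq (Fv x) (Tup (map (\<lambda>i. Pr As i (Fv x)) [0..<length As])))"
| comprehension: "formula L \<alpha> \<Longrightarrow> wf_ty (gnds L) (snd x) \<Longrightarrow>
    derives L S {} (Eq (Mem (Fv x) (compr x \<alpha>)) \<alpha>)"
| thinning: "derives L S \<Gamma> \<alpha> \<Longrightarrow> formula L \<beta> \<Longrightarrow> derives L S (insert \<beta> \<Gamma>) \<alpha>"
| cut: "derives L S \<Gamma> \<alpha> \<Longrightarrow> derives L S (insert \<alpha> \<Gamma>) \<beta> \<Longrightarrow> fv \<alpha> \<subseteq> \<Union> (fv ` \<Gamma>) \<union> fv \<beta> \<Longrightarrow>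
    derives L S \<Gamma> \<beta>"
| substitution: "derives L S \<Gamma> \<alpha> \<Longrightarrow> has_ty L [] s (snd x) \<Longrightarrow>
    derives L S (subst x s ` \<Gamma>) (subst x s \<alpha>)"
| extensionality: "derives L S \<Gamma> (Eq (Mem (Fv x) s) (Mem (Fv x) t)) \<Longrightarrow>
    has_ty L [] s (Pw (snd x)) \<Longrightarrow> has_ty L [] t (Pw (snd x)) \<Longrightarrow>
    x \<notin> \<Union> (fv ` \<Gamma>) \<union> fv s \<union> fv t \<Longrightarrow> derives L S \<Gamma> (Eq s t)"
| equivalence: "derives L S (insert \<alpha> \<Gamma>) \<beta> \<Longrightarrow> derives L S (insert \<beta> \<Gamma>) \<alpha> \<Longrightarrow>
    derives L S \<Gamma> (Eq \<alpha> \<beta>)"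

definition local_set_theory :: "('g, 'f) lang \<Rightarrow> ('g, 'f) sequent set \<Rightarrow> bool" where
  "local_set_theory L S \<longleftrightarrow>
    (\<forall>q\<in>S. sequent L q) \<and> (\<forall>\<Gamma> \<alpha>. derives L S \<Gamma> \<alpha> \<longrightarrow> (\<Gamma>, \<alpha>) \<in> S)"

definition closed_of :: "('g, 'f) lang \<Rightarrow> ('g, 'f) tm \<Rightarrow> 'g ty \<Rightarrow> bool" where
  "closed_of L t A \<longleftrightarrow> has_ty L [] t A \<and> fv t = {}"

text \<open>The triple \<open>(F, X, Y)\<close> is an \<open>S\<close>-function, with \<open>X\<close> of type \<open>Pw A\<close> and \<open>Y\<close> of type \<open>Pw B\<close>.\<close>

definition S_function ::
    "('g, 'f) lang \<Rightarrow> ('g, 'f) sequent set \<Rightarrow> 'g ty \<Rightarrow> 'g ty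
      \<Rightarrow> ('g, 'f) tm \<times> ('g, 'f) tm \<times> ('g, 'f) tm \<Rightarrow> bool" where
  "S_function L S A B = (\<lambda>(F, X, Y).
     closed_of L X (Pw A) \<and> closed_of L Y (Pw B) \<and> closed_of L F (Pw (Prod [A, B])) \<and>
     derives L S {} (Mem F (expset A B X Y)))"

text \<open>\<open>(x \<mapsto> \<tau>) : X \<rightarrow> Y\<close>, for \<open>Y\<close> of type \<open>Pw B\<close>.\<close>

definition mapsto :: "'g var \<Rightarrow> ('g, 'f) tm \<Rightarrow> 'g ty \<Rightarrow> ('g, 'f) tm \<Rightarrow> ('g, 'f) tm
    \<Rightarrow> ('g, 'f) tm \<times> ('g, 'f) tm \<times> ('g, 'f) tm" where
  "mapsto x \<tau> B X Y = (sabs [x] (Prod [snd x, B]) (Tup [Fv x, \<tau>]) (Mem (Fv x) X), X, Y)"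

section \<open>Toposes, internal languages and the theory of a topos\<close>

text \<open>
  The data of a topos in Bell's sense, with specified finite products (\<open>Prd []\<close> terminal,
  projections \<open>Pj As i : Prd As \<rightarrow> As ! i\<close>), truth value object \<open>Tru : Prd [] \<rightarrow> Omg\<close>, and power
  objects \<open>Eps A : Prd [A, Pwr A] \<rightarrow> Omg\<close>. Pairings, characteristic arrows and transposes are
  determined by their universal properties; they are written with \<open>THE\<close> below and are meaningful
  when the data do form a topos.
\<close>

record ('o, 'a) topos_data =
  Obj :: "'o set"
  Arr :: "'a set"
  Dom :: "'a \<Rightarrow> 'o"
  Cod :: "'a \<Rightarrow> 'o"
  Idn :: "'o \<Rightarrow> 'a"
  Cmp :: "'a \<Rightarrow> 'a \<Rightarrow> 'a"  \<comment> \<open>\<open>Cmp g f\<close> is \<open>g\<close> after \<open>f\<close>\<close>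
  Prd :: "'o list \<Rightarrow> 'o"
  Pj :: "'o list \<Rightarrow> nat \<Rightarrow> 'a"
  Omg :: 'o
  Tru :: 'a
  Pwr :: "'o \<Rightarrow> 'o"
  Eps :: "'o \<Rightarrow> 'a"

definition hom :: "('o, 'a) topos_data \<Rightarrow> 'o \<Rightarrow> 'o \<Rightarrow> 'a set" where
  "hom E A B = {f \<in> Arr E. Dom E f = A \<and> Cod E f = B}"

definition tuple :: "('o, 'a) topos_data \<Rightarrow> 'o \<Rightarrow> 'a list \<Rightarrow> 'a" where
  "tuple E W fs = (let As = map (Cod E) fs in
     THE h. h \<in> hom E W (Prd E As) \<and> (\<forall>i<length fs. Cmp E (Pj E As i) h = fs ! i))"

definition true_on :: "('o, 'a) topos_data \<Rightarrow> 'o \<Rightarrow> 'a" where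
  "true_on E A = Cmp E (Tru E) (tuple E A [])"

text \<open>\<open>m\<close> is a pullback of \<open>Tru\<close> along \<open>u\<close>; that is, \<open>u\<close> is the characteristic arrow of \<open>m\<close>.\<close>

definition kernel :: "('o, 'a) topos_data \<Rightarrow> 'a \<Rightarrow> 'a \<Rightarrow> bool" where
  "kernel E m u \<longleftrightarrow> m \<in> Arr E \<and> u \<in> hom E (Cod E m) (Omg E) \<and> Cmp E u m = true_on E (Dom E m) \<and>
     (\<forall>g\<in>Arr E. Cod E g = Cod E m \<and> Cmp E u g = true_on E (Dom E g) \<longrightarrow>
        (\<exists>!k. k \<in> hom E (Dom E g) (Dom E m) \<and> Cmp E m k = g))"

definition eq_arr :: "('o, 'a) topos_data \<Rightarrow> 'o \<Rightarrow> 'a" where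
  "eq_arr E A = (THE u. kernel E (tuple E A [Idn E A, Idn E A]) u)"

definition transpose :: "('o, 'a) topos_data \<Rightarrow> 'o \<Rightarrow> 'o \<Rightarrow> 'a \<Rightarrow> 'a" where
  "transpose E A W g = (THE h. h \<in> hom E W (Pwr E A) \<and>
     (let AW = Prd E [A, W] in
      Cmp E (Eps E A) (tuple E AW [Pj E [A, W] 0, Cmp E h (Pj E [A, W] 1)]) = g))"

text \<open>The order on \<open>hom E A (Omg E)\<close> given by inclusion of the classified subobjects.\<close>

definition leq :: "('o, 'a) topos_data \<Rightarrow> 'a \<Rightarrow> 'a \<Rightarrow> bool" where
  "leq E u v \<longleftrightarrow> (\<forall>m n. kernel E m u \<and> kernel E n v \<longrightarrow>
     (\<exists>k \<in> hom E (Dom E m) (Dom E n). Cmp E n k = m))"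

definition is_meet :: "('o, 'a) topos_data \<Rightarrow> 'o \<Rightarrow> 'a set \<Rightarrow> 'a \<Rightarrow> bool" where
  "is_meet E A U w \<longleftrightarrow> w \<in> hom E A (Omg E) \<and> (\<forall>u\<in>U. leq E w u) \<and>
     (\<forall>v \<in> hom E A (Omg E). (\<forall>u\<in>U. leq E v u) \<longrightarrow> leq E v w)"

text \<open>An interpretation of a language in \<open>E\<close> is given by a map \<open>I\<close> from ground types to objects
  and a map \<open>J\<close> from function symbols to arrows.\<close>

primrec ty_obj :: "('o, 'a) topos_data \<Rightarrow> ('g \<Rightarrow> 'o) \<Rightarrow> 'g ty \<Rightarrow> 'o" where
  "ty_obj E I (Gr g) = I g"
| "ty_obj E I Om = Omg E"
| "ty_obj E I (Prod As) = Prd E (map (ty_obj E I) As)"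
| "ty_obj E I (Pw A) = Pwr E (ty_obj E I A)"

text \<open>
  \<open>interp E I J t W bs \<rho>\<close> is the arrow with domain \<open>W\<close> interpreting \<open>t\<close>, where the arrows \<open>bs\<close>
  and \<open>\<rho>\<close>, with domain \<open>W\<close>, interpret the dangling indices and the free variables. For
  \<open>W = Prd [A\<^sub>1,\<dots>,A\<^sub>n]\<close> and \<open>\<rho>\<close> the projections this is Bell's interpretation
  \<open>A\<^sub>1 \<times> \<dots> \<times> A\<^sub>n \<rightarrow> B\<close> of a term in the variables \<open>x\<^sub>1,\<dots>,x\<^sub>n\<close>.
\<close>

primrec interp :: "('o, 'a) topos_data \<Rightarrow> ('g \<Rightarrow> 'o) \<Rightarrow> ('f \<Rightarrow> 'a) \<Rightarrow> ('g, 'f) tm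
    \<Rightarrow> 'o \<Rightarrow> 'a list \<Rightarrow> ('g var \<Rightarrow> 'a) \<Rightarrow> 'a" where
  "interp E I J (Fv x) W bs \<rho> = \<rho> x"
| "interp E I J (Bv i) W bs \<rho> = bs ! i"
| "interp E I J (Fn h t) W bs \<rho> = Cmp E (J h) (interp E I J t W bs \<rho>)"
| "interp E I J (Tup ts) W bs \<rho> = tuple E W (map (\<lambda>t. interp E I J t W bs \<rho>) ts)"
| "interp E I J (Pr As i t) W bs \<rho> = Cmp E (Pj E (map (ty_obj E I) As) i) (interp E I J t W bs \<rho>)"
| "interp E I J (Cm A t) W bs \<rho> =
    (let A' = ty_obj E I A; p = Pj E [A', W] 0; q = Pj E [A', W] 1 in
     transpose E A' W
       (interp E I J t (Prd E [A', W]) (p # map (\<lambda>b. Cmp E b q) bs) (\<lambda>x. Cmp E (\<rho> x) q)))"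
| "interp E I J (Eq s t) W bs \<rho> =
    (let a = interp E I J s W bs \<rho>; b = interp E I J t W bs \<rho> in
     Cmp E (eq_arr E (Cod E a)) (tuple E W [a, b]))"
| "interp E I J (Mem s t) W bs \<rho> =
    (let a = interp E I J s W bs \<rho>; b = interp E I J t W bs \<rho> in
     Cmp E (Eps E (Cod E a)) (tuple E W [a, b]))"

text \<open>Validity of a sequent: with \<open>xs\<close> the list of all its free variables, the meet of the
  interpretations of the antecedents lies below the interpretation of the succedent.\<close>

definition valid :: "('o, 'a) topos_data \<Rightarrow> ('g \<Rightarrow> 'o) \<Rightarrow> ('f \<Rightarrow> 'a) \<Rightarrow> ('g, 'f) sequent \<Rightarrow> bool" where
  "valid E I J = (\<lambda>(\<Gamma>, \<alpha>). \<forall>xs. distinct xs \<and> set xs = \<Union> (fv ` \<Gamma>) \<union> fv \<alpha> \<longrightarrow>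
     (let As = map (ty_obj E I \<circ> snd) xs; W = Prd E As;
          \<rho> = (\<lambda>x. Pj E As (THE i. i < length xs \<and> xs ! i = x));
          val = (\<lambda>\<phi>. interp E I J \<phi> W [] \<rho>)
      in \<exists>w. is_meet E W (val ` \<Gamma>) w \<and> leq E w (val \<alpha>)))"

text \<open>
  The internal language, following Bell: a ground type symbol for each object other than the
  terminal object and the truth value object, for which the types \<open>One\<close> and \<open>Om\<close> serve; so
  \<open>ty_sym E Z\<close> is the type symbol of an arbitrary object \<open>Z\<close>. Function symbols are triples
  \<open>(g, A, B)\<close> of signature \<open>A \<rightarrow> B\<close> where the types \<open>A\<close> and \<open>B\<close> denote the domain and the codomain
  of \<open>g\<close>. In particular \<open>(g, ty_sym E (Dom E g), ty_sym E (Cod E g))\<close> is one of them; the other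
  triples allow for compound types in signatures.
\<close>

definition ty_sym :: "('o, 'a) topos_data \<Rightarrow> 'o \<Rightarrow> 'o ty" where
  "ty_sym E Z = (if Z = Prd E [] then One else if Z = Omg E then Om else Gr Z)"

definition internal_lang :: "('o, 'a) topos_data \<Rightarrow> ('o, 'a \<times> 'o ty \<times> 'o ty) lang" where
  "internal_lang E = (let G = Obj E - {Prd E [], Omg E} in
     \<lparr>gnds = G,
      fns = {(g, A, B). g \<in> Arr E \<and> wf_ty G A \<and> wf_ty G B \<and>
              ty_obj E (\<lambda>Z. Z) A = Dom E g \<and> ty_obj E (\<lambda>Z. Z) B = Cod E g},
      fdom = (\<lambda>(g, A, B). A), fcod = (\<lambda>(g, A, B). B)\<rparr>)"

definition Th :: "('o, 'a) topos_data \<Rightarrow> ('o, 'a \<times> 'o ty \<times> 'o ty) sequent set" where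
  "Th E = {q. sequent (internal_lang E) q \<and> valid E (\<lambda>Z. Z) (\<lambda>(g, A, B). g) q}"

section \<open>The linguistic topos\<close>

text \<open>
  As usual, \<open>S\<close>-sets and graphs are identified when \<open>S\<close> proves them equal: objects are the classes
  \<open>cls L S X\<close> of closed terms of power type, and the arrow of an \<open>S\<close>-function \<open>(F, X, Y)\<close> is the
  triple of the classes of \<open>F\<close>, \<open>X\<close> and \<open>Y\<close>. Operations are defined on representatives.
\<close>

definition cls :: "('g, 'f) lang \<Rightarrow> ('g, 'f) sequent set \<Rightarrow> ('g, 'f) tm \<Rightarrow> ('g, 'f) tm set" where
  "cls L S X = {X'. (\<exists>A. closed_of L X' (Pw A)) \<and> derives L S {} (Eq X X')}"

definition arrow :: "('g, 'f) lang \<Rightarrow> ('g, 'f) sequent set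
    \<Rightarrow> ('g, 'f) tm \<times> ('g, 'f) tm \<times> ('g, 'f) tm
    \<Rightarrow> ('g, 'f) tm set \<times> ('g, 'f) tm set \<times> ('g, 'f) tm set" where
  "arrow L S = (\<lambda>(F, X, Y). (cls L S F, cls L S X, cls L S Y))"

definition rep :: "('g, 'f) tm set \<Rightarrow> ('g, 'f) tm" where
  "rep Q = (SOME X. X \<in> Q)"

definition elem_ty :: "('g, 'f) lang \<Rightarrow> ('g, 'f) tm set \<Rightarrow> 'g ty" where
  "elem_ty L Q = (THE A. has_ty L [] (rep Q) (Pw A))"

text \<open>\<open>G \<circ> F = {\<langle>x,z\<rangle> : \<exists>y. \<langle>x,y\<rangle> \<in> F \<and> \<langle>y,z\<rangle> \<in> G}\<close>\<close>

definition comp_graph ::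
    "'g ty \<Rightarrow> 'g ty \<Rightarrow> 'g ty \<Rightarrow> ('g, 'f) tm \<Rightarrow> ('g, 'f) tm \<Rightarrow> ('g, 'f) tm" where
  "comp_graph A B C G F = (let x = (0, A); y = (1, B); z = (2, C) in
     sabs [x, z] (Prod [A, C]) (Tup [Fv x, Fv z])
       (ex y (conj (Mem (Tup [Fv x, Fv y]) F) (Mem (Tup [Fv y, Fv z]) G))))"

text \<open>The \<open>i\<close>-th projection \<open>(\<langle>x\<^sub>1,\<dots>,x\<^sub>n\<rangle> \<mapsto> x\<^sub>i)\<close> and \<open>(\<langle>x,u\<rangle> \<mapsto> x \<in> u) : X \<times> PX \<rightarrow> \<Omega>\<close>.\<close>

definition proj_graph :: "'g ty list \<Rightarrow> ('g, 'f) tm list \<Rightarrow> nat \<Rightarrow> ('g, 'f) tm" where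
  "proj_graph As Xs i = sabs (vars As) (Prod [Prod As, As ! i])
     (Tup [Tup (map Fv (vars As)), Fv (vars As ! i)]) (mems As Xs)"

definition eps_graph :: "'g ty \<Rightarrow> ('g, 'f) tm \<Rightarrow> ('g, 'f) tm" where
  "eps_graph A X = (let x = (0, A); u = (1, Pw A) in
     sabs [x, u] (Prod [Prod [A, Pw A], Om]) (Tup [Tup [Fv x, Fv u], Mem (Fv x) (Fv u)])
       (conj (Mem (Fv x) X) (Mem (Fv u) (powset A X))))"

definition ling_topos :: "('g, 'f) lang \<Rightarrow> ('g, 'f) sequent set \<Rightarrow>
    (('g, 'f) tm set, ('g, 'f) tm set \<times> ('g, 'f) tm set \<times> ('g, 'f) tm set) topos_data" where
  "ling_topos L S =
    (let ety = elem_ty L;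
         idn = (\<lambda>Q. arrow L S (mapsto (0, ety Q) (Fv (0, ety Q)) (ety Q) (rep Q) (rep Q)));
         prd = (\<lambda>Qs. if length Qs = 1 then hd Qs else cls L S (prodset (map ety Qs) (map rep Qs)));
         pwr = (\<lambda>Q. cls L S (powset (ety Q) (rep Q)))
     in
     \<lparr>Obj = {cls L S X | X. \<exists>A. closed_of L X (Pw A)},
      Arr = {arrow L S f | f. \<exists>A B. S_function L S A B f},
      Dom = (\<lambda>(F, X, Y). X),
      Cod = (\<lambda>(F, X, Y). Y),
      Idn = idn,
      Cmp = (\<lambda>(G, _, Z) (F, X, Y).
               (cls L S (comp_graph (ety X) (ety Y) (ety Z) (rep G) (rep F)), X, Z)),
      Prd = prd,
      Pj = (\<lambda>Qs i. if length Qs = 1 then idn (hd Qs)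
              else (cls L S (proj_graph (map ety Qs) (map rep Qs) i), prd Qs, Qs ! i)),
      Omg = cls L S (univ Om),
      Tru = arrow L S (mapsto (0, One) tt Om (prodset [] []) (univ Om)),
      Pwr = pwr,
      Eps = (\<lambda>Q. (cls L S (eps_graph (ety Q) (rep Q)), prd [Q, pwr Q], cls L S (univ Om)))\<rparr>)"

section \<open>The canonical translation\<close>

text \<open>
  As a translation of local languages, \<open>\<eta>\<close> preserves \<open>One\<close>, \<open>Om\<close>, products and powers, and sends
  a ground type \<open>A\<close> to the type symbol of \<open>U\<^sub>A\<close>. For a compound type \<open>A\<close>, \<open>eta_ty L S A\<close> denotes the
  object \<open>U\<^sub>A\<close> under the natural interpretation, and it plays the role of the type symbol of \<open>U\<^sub>A\<close>.
\<close>

primrec eta_ty :: "('g, 'f) lang \<Rightarrow> ('g, 'f) sequent set \<Rightarrow> 'g ty \<Rightarrow> ('g, 'f) tm set ty" where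
  "eta_ty L S (Gr g) = ty_sym (ling_topos L S) (cls L S (univ (Gr g)))"
| "eta_ty L S Om = Om"
| "eta_ty L S (Prod As) = Prod (map (eta_ty L S) As)"
| "eta_ty L S (Pw A) = Pw (eta_ty L S A)"

type_synonym ('g, 'f) ling_fn =
  "(('g, 'f) tm set \<times> ('g, 'f) tm set \<times> ('g, 'f) tm set)
     \<times> ('g, 'f) tm set ty \<times> ('g, 'f) tm set ty"

definition eta_fn :: "('g, 'f) lang \<Rightarrow> ('g, 'f) sequent set \<Rightarrow> 'f \<Rightarrow> ('g, 'f) ling_fn" where
  "eta_fn L S h = (let A = fdom L h; B = fcod L h in
     (arrow L S (mapsto (0, A) (Fn h (Fv (0, A))) B (univ A) (univ B)), eta_ty L S A, eta_ty L S B))"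

primrec eta :: "('g, 'f) lang \<Rightarrow> ('g, 'f) sequent set \<Rightarrow> ('g, 'f) tm
    \<Rightarrow> (('g, 'f) tm set, ('g, 'f) ling_fn) tm" where
  "eta L S (Fv x) = Fv (fst x, eta_ty L S (snd x))"
| "eta L S (Bv i) = Bv i"
| "eta L S (Fn h t) = Fn (eta_fn L S h) (eta L S t)"
| "eta L S (Tup ts) = Tup (map (eta L S) ts)"
| "eta L S (Pr As i t) = Pr (map (eta_ty L S) As) i (eta L S t)"
| "eta L S (Cm A t) = Cm (eta_ty L S A) (eta L S t)"
| "eta L S (Eq s t) = Eq (eta L S s) (eta L S t)"
| "eta L S (Mem s t) = Mem (eta L S s) (eta L S t)"

text \<open>The function symbols of \<open>f : X \<rightarrow> Y\<close>, and of \<open>i\<^sub>X = (x \<mapsto> x) : X \<rightarrow> U\<^sub>A\<close> for \<open>X\<close> of type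
  \<open>Pw A\<close>; the codomain type of the latter is \<open>eta_ty L S A\<close>, the type of the translated elements
  of \<open>U\<^sub>A\<close>.\<close>

definition fn_sym :: "('g, 'f) lang \<Rightarrow> ('g, 'f) sequent set
    \<Rightarrow> ('g, 'f) tm \<times> ('g, 'f) tm \<times> ('g, 'f) tm \<Rightarrow> ('g, 'f) ling_fn" where
  "fn_sym L S f = (let E = ling_topos L S; a = arrow L S f in
     (a, ty_sym E (Dom E a), ty_sym E (Cod E a)))"

definition incl_sym :: "('g, 'f) lang \<Rightarrow> ('g, 'f) sequent set \<Rightarrow> 'g ty
    \<Rightarrow> ('g, 'f) tm \<Rightarrow> ('g, 'f) ling_fn" where
  "incl_sym L S A X = (let E = ling_topos L S;
       a = arrow L S (mapsto (0, A) (Fv (0, A)) A X (univ A)) in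
     (a, ty_sym E (Dom E a), eta_ty L S A))"

end

(*
  Read derivability in S as forcing over stages (finite sets of hypotheses), so that the connectives, the
  quantifiers and equality obey the clauses of Beth-Kripke semantics. Arrows of the linguistic topos
  then become stagewise functional relations, and the pairings, characteristic arrows and transposes between
  the objects U_A can be computed explicitly. By induction on terms, the interpretation of a translated closed
  term t at an object X is the arrow (x |-> t). Hence the formula is interpreted by (x |-> <x, f x> in |f|),
  which is the arrow true on X; so it is valid, and it is an axiom of Th(T(S)).
*)

theory Submission
  imports Defs
begin

section \<open>Typing and simultaneous instantiation\<close>

text \<open>Types may be empty, so the cut rule may not lose free variables. For this reason a stage
  also controls which variables exist, and an existential forced at a stage is used through an
  elimination rule instead of through a witness. The operations \<open>tuple\<close>,
  \<open>transpose\<close> and \<open>eq_arr\<close> are definite descriptions, so computing one of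
  them means proving existence and uniqueness; the uniqueness parts meet arbitrary arrows, which are
  relations and not terms. The variable \<open>u\<close> has the type of \<open>X\<close>, so the
  interpretation lives over the object \<open>X\<close>, whereas translated types denote universes:
  arrows have an arbitrary domain, but mostly a universe as codomain. Although \<open>|f|\<close> is
  closed, the bodies of its comprehensions have dangling indices, and each comprehension replaces
  the domain \<open>X\<close> by the product of a universe with \<open>X\<close>. Hence the
  induction on terms ranges over all domains at once and carries a list of terms standing for the
  dangling indices.\<close>

lemma list_all2_memD: "list_all2 P xs ys \<Longrightarrow> x \<in> set xs \<Longrightarrow> \<exists>y\<in>set ys. P x y"
  by (fastforce simp: list_all2_conv_all_nth in_set_conv_nth)

text \<open>\<open>inst \<tau>s \<sigma> t k\<close> replaces every free variable \<open>x\<close> by \<open>\<sigma> x\<close> and the dangling indices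
  \<open>k, k + 1, \<dots>\<close> by the terms \<open>\<tau>s\<close>. Both \<open>subst\<close> and the opening of a comprehension are instances.\<close>

primrec inst :: "('g, 'f) tm list \<Rightarrow> ('g var \<Rightarrow> ('g, 'f) tm) \<Rightarrow> ('g, 'f) tm \<Rightarrow> nat \<Rightarrow> ('g, 'f) tm" where
  "inst \<tau>s \<sigma> (Fv x) k = \<sigma> x"
| "inst \<tau>s \<sigma> (Bv i) k = (if i < k then Bv i else if i - k < length \<tau>s then \<tau>s ! (i - k) else Bv i)"
| "inst \<tau>s \<sigma> (Fn h t) k = Fn h (inst \<tau>s \<sigma> t k)"
| "inst \<tau>s \<sigma> (Tup ts) k = Tup (map (\<lambda>t. inst \<tau>s \<sigma> t k) ts)"
| "inst \<tau>s \<sigma> (Pr As i t) k = Pr As i (inst \<tau>s \<sigma> t k)"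
| "inst \<tau>s \<sigma> (Cm A t) k = Cm A (inst \<tau>s \<sigma> t (Suc k))"
| "inst \<tau>s \<sigma> (Eq t u) k = Eq (inst \<tau>s \<sigma> t k) (inst \<tau>s \<sigma> u k)"
| "inst \<tau>s \<sigma> (Mem t u) k = Mem (inst \<tau>s \<sigma> t k) (inst \<tau>s \<sigma> u k)"

lemma finite_fv [simp]: "finite (fv t)"
  by (induction t) auto

lemma subst_inst: "subst x s t = inst [] (Fv(x := s)) t k"
  by (induction t arbitrary: k) auto

lemma inst_cong: "(\<And>x. x \<in> fv t \<Longrightarrow> \<sigma> x = \<sigma>' x) \<Longrightarrow> inst \<tau>s \<sigma> t k = inst \<tau>s \<sigma>' t k"
proof (induction t arbitrary: k)
  case (Tup ts)
  then show ?case by (simp, blast)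
qed auto

lemma fv_inst: "fv (inst \<tau>s \<sigma> t k) \<subseteq> (\<Union>x\<in>fv t. fv (\<sigma> x)) \<union> (\<Union>\<tau>\<in>set \<tau>s. fv \<tau>)"
  by (induction t arbitrary: k) (auto, fastforce+)

section \<open>Inversion of the typing rules\<close>

lemma has_ty_Fv [simp]: "has_ty L Bs (Fv x) A \<longleftrightarrow> A = snd x \<and> wf_ty (gnds L) (snd x)"
  by (subst has_ty.simps) auto

lemma has_ty_Bv [simp]: "has_ty L Bs (Bv i) A \<longleftrightarrow> i < length Bs \<and> A = Bs ! i"
  by (subst has_ty.simps) auto

lemma has_ty_Fn [simp]:
  "has_ty L Bs (Fn h t) A \<longleftrightarrow> h \<in> fns L \<and> A = fcod L h \<and> has_ty L Bs t (fdom L h)"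
  by (subst has_ty.simps) auto

lemma has_ty_Tup [simp]:
  "has_ty L Bs (Tup ts) A \<longleftrightarrow> length ts \<noteq> 1 \<and> (\<exists>As. A = Prod As \<and> list_all2 (has_ty L Bs) ts As)"
  by (subst has_ty.simps) auto

lemma has_ty_Pr [simp]:
  "has_ty L Bs (Pr As i t) A \<longleftrightarrow> i < length As \<and> A = As ! i \<and> has_ty L Bs t (Prod As)"
  by (subst has_ty.simps) auto

lemma has_ty_Cm [simp]:
  "has_ty L Bs (Cm B t) A \<longleftrightarrow> A = Pw B \<and> wf_ty (gnds L) B \<and> has_ty L (B # Bs) t Om"
  by (subst has_ty.simps) auto

lemma has_ty_Eq [simp]:
  "has_ty L Bs (Eq s t) A \<longleftrightarrow> A = Om \<and> (\<exists>B. has_ty L Bs s B \<and> has_ty L Bs t B)"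
  by (subst has_ty.simps) auto

lemma has_ty_Mem [simp]:
  "has_ty L Bs (Mem s t) A \<longleftrightarrow> A = Om \<and> (\<exists>B. has_ty L Bs s B \<and> has_ty L Bs t (Pw B))"
  by (subst has_ty.simps) auto

section \<open>Typing under weakening and instantiation\<close>

lemma has_ty_weaken: "has_ty L Bs t A \<Longrightarrow> has_ty L (Bs @ Cs) t A"
proof (induction rule: has_ty.induct)
  case (4 ts Bs As)
  then show ?case by (auto elim: list_all2_mono)
qed (auto simp: nth_append)

lemma has_ty_weaken0: "has_ty L [] t A \<Longrightarrow> has_ty L Bs t A"
  using has_ty_weaken[of L "[]" t A Bs] by simp

lemma has_ty_unique: "has_ty L Bs t A \<Longrightarrow> has_ty L Bs t A' \<Longrightarrow> A' = A"
proof (induction t arbitrary: A A' rule: tm.induct)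
  case (Tup ts)
  obtain As As' where "A = Prod As" "A' = Prod As'" "list_all2 (has_ty L Bs) ts As"
      "list_all2 (has_ty L Bs) ts As'"
    using Tup.prems unfolding has_ty_Tup by metis
  moreover from this have "As' = As"
    using Tup.IH by (metis list_all2_conv_all_nth nth_equalityI nth_mem)
  ultimately show ?case by metis
qed (use has_ty_Fv has_ty_Bv has_ty_Fn has_ty_Pr has_ty_Cm has_ty_Eq has_ty_Mem in metis)+

text \<open>The context splits as \<open>Cs @ Bs\<close>: the innermost \<open>k\<close> indices,
  typed by \<open>Cs\<close>, belong to comprehensions already entered and stay dangling, the others
  are filled by \<open>\<tau>s\<close>. This is the form that survives a comprehension, which puts
  its own type in front of \<open>Cs\<close>. The terms \<open>\<tau>s\<close> have no dangling
  indices, so they are never shifted.\<close>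

lemma has_ty_inst:
  assumes "has_ty L Ds t A" and "Ds = Cs @ Bs" and "length Cs = k"
    and "list_all2 (has_ty L []) \<tau>s Bs" and "\<And>x. x \<in> fv t \<Longrightarrow> has_ty L [] (\<sigma> x) (snd x)"
  shows "has_ty L Cs (inst \<tau>s \<sigma> t k) A"
  using assms
proof (induction arbitrary: Cs k rule: has_ty.induct)
  case (2 i Ds)
  then show ?case
    by (auto simp: nth_append list_all2_conv_all_nth intro: has_ty_weaken0)
next
  case (4 ts Ds As)
  have "has_ty L Cs (inst \<tau>s \<sigma> (ts ! i) k) (As ! i)" if "i < length ts" for i
  proof -
    have "x \<in> fv (Tup ts)" if "x \<in> fv (ts ! i)" for x
      using that nth_mem[OF \<open>i < length ts\<close>] by auto
    then show ?thesis using that 4 by (auto simp: list_all2_conv_all_nth simp del: fv.simps)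
  qed
  then show ?case using 4 by (auto simp: list_all2_conv_all_nth)
next
  case (6 A Ds t)
  then show ?case using "6.IH"[of "A # Cs" "Suc k"] by simp
next
  case (8 Ds s A t)
  then show ?case by (metis UnI1 UnI2 inst.simps(8) fv.simps(8) has_ty.intros(8))
next
  case (7 Ds s A t)
  then show ?case by (metis UnI1 UnI2 inst.simps(7) fv.simps(7) has_ty.intros(7))
qed (auto intro: has_ty_weaken0)

section \<open>Depth and composition of instantiations\<close>

lemma inst_Nil_Suc: "inst [] \<sigma> t (Suc k) = inst [] \<sigma> t 0"
  by (induction t arbitrary: k) auto

lemma inst_Nil_depth: "inst [] \<sigma> t k = inst [] \<sigma> t 0"
  by (cases k) (simp_all add: inst_Nil_Suc)

lemma has_ty_msub:
  assumes "has_ty L [] t A" and "\<And>x. x \<in> fv t \<Longrightarrow> has_ty L [] (\<sigma> x) (snd x)"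
  shows "has_ty L [] (inst [] \<sigma> t k) A"
  using has_ty_inst[OF assms(1), of "[]" "[]" 0 "[]" \<sigma>] assms(2) inst_Nil_depth[of \<sigma> t k] by simp

text \<open>All dangling indices of \<open>t\<close> lie below \<open>k\<close>, where
  \<open>inst\<close> leaves them alone, so neither the depth nor the list matters.\<close>

lemma inst_closed_level:
  "has_ty L Bs t A \<Longrightarrow> length Bs \<le> k \<Longrightarrow> inst \<tau>s \<sigma> t k = inst [] \<sigma> t 0"
proof (induction arbitrary: k rule: has_ty.induct)
  case (4 ts Bs As)
  then show ?case by (fastforce simp: list_all2_conv_all_nth in_set_conv_nth)
next
  case (6 A Bs t)
  then show ?case using inst_Nil_depth[of \<sigma> t 1] by simp
qed auto

lemma inst_Fv: "inst [] Fv t k = t"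
  by (induction t arbitrary: k) (auto simp: map_idI)

lemma inst_id:
  assumes "has_ty L [] t A" and "\<And>x. x \<in> fv t \<Longrightarrow> \<sigma> x = Fv x"
  shows "inst \<tau>s \<sigma> t k = t"
proof -
  have "inst \<tau>s \<sigma> t k = inst [] \<sigma> t 0" using assms(1) by (intro inst_closed_level) auto
  also have "\<dots> = inst [] Fv t 0" using assms(2) by (rule inst_cong)
  finally show ?thesis by (simp add: inst_Fv)
qed

text \<open>The inner instantiation acts \<open>length \<omega>s\<close> levels deeper, so it skips
  the indices that \<open>\<omega>s\<close> is going to fill; the two lists therefore concatenate.
  The typing hypotheses say that \<open>\<tau>s\<close> and the values of \<open>\<sigma>\<close>
  have no dangling indices, so that inside them only \<open>\<rho>\<close> acts.\<close>

lemma inst_inst: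
  assumes "\<And>\<tau>. \<tau> \<in> set \<tau>s \<Longrightarrow> \<exists>A. has_ty L [] \<tau> A" and "\<And>x. x \<in> fv t \<Longrightarrow> \<exists>A. has_ty L [] (\<sigma> x) A"
  shows "inst \<omega>s \<rho> (inst \<tau>s \<sigma> t (k + length \<omega>s)) k
    = inst (\<omega>s @ map (\<lambda>\<tau>. inst [] \<rho> \<tau> 0) \<tau>s) (\<lambda>x. inst [] \<rho> (\<sigma> x) 0) t k"
  using assms
proof (induction t arbitrary: k)
  case (Fv x)
  then show ?case by (auto dest: inst_closed_level[of L "[]"])
next
  case (Bv i)
  have "i - (k + length \<omega>s) < length \<tau>s \<Longrightarrow>
      inst \<omega>s \<rho> (\<tau>s ! (i - (k + length \<omega>s))) k = inst [] \<rho> (\<tau>s ! (i - (k + length \<omega>s))) 0"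
    using Bv(1) inst_closed_level[of L "[]" _ _ k \<omega>s \<rho>] by (metis list.size(3) nth_mem zero_le)
  then show ?case by (auto simp: nth_append)
next
  case (Cm A t)
  then show ?case using Cm(1)[of "Suc k"] by simp
next
  case (Tup ts)
  have "inst \<omega>s \<rho> (inst \<tau>s \<sigma> t (k + length \<omega>s)) k
    = inst (\<omega>s @ map (\<lambda>\<tau>. inst [] \<rho> \<tau> 0) \<tau>s) (\<lambda>x. inst [] \<rho> (\<sigma> x) 0) t k" if "t \<in> set ts" for t
    using that Tup.prems by (intro Tup.IH) (simp, blast)+
  then show ?case by simp
qed auto

lemma inst_inst_Nil:
  assumes "\<And>x. x \<in> fv t \<Longrightarrow> \<exists>A. has_ty L [] (\<sigma> x) A"
  shows "inst [] \<rho> (inst [] \<sigma> t k) k' = inst [] (\<lambda>x. inst [] \<rho> (\<sigma> x) 0) t k''"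
  using inst_inst[where \<omega>s = "[]" and \<tau>s = "[]" and k = 0 and t = t and L = L and \<sigma> = \<sigma> and \<rho> = \<rho>] assms
    inst_Nil_depth[of \<rho> "inst [] \<sigma> t k" k'] inst_Nil_depth[of \<sigma> t k]
    inst_Nil_depth[of "\<lambda>x. inst [] \<rho> (\<sigma> x) 0" t k''] by simp

text \<open>The form needed for comprehensions: the body has been instantiated below its own index,
  and that index is then filled by \<open>a\<close>.\<close>

lemma inst_open:
  assumes "\<And>\<tau>. \<tau> \<in> set \<tau>s \<Longrightarrow> \<exists>A. has_ty L [] \<tau> A" and "\<And>x. x \<in> fv t \<Longrightarrow> \<exists>A. has_ty L [] (\<sigma> x) A"
  shows "inst [a] Fv (inst \<tau>s \<sigma> t (Suc 0)) 0 = inst (a # \<tau>s) \<sigma> t 0"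
  using inst_inst[OF assms, where \<omega>s = "[a]" and \<rho> = Fv and k = 0] by (simp add: inst_Fv)

section \<open>Abstraction of a variable\<close>

lemma fv_bind [simp]: "fv (bind x t k) = fv t - {x}"
  by (induction t arbitrary: k) auto

lemma inst_bind:
  "has_ty L Bs t A \<Longrightarrow> length Bs \<le> k \<Longrightarrow> inst [a] \<sigma> (bind x t k) k = inst [] (\<sigma>(x := a)) t k"
proof (induction arbitrary: k rule: has_ty.induct)
  case (4 ts Bs As)
  then show ?case by (fastforce simp: list_all2_conv_all_nth in_set_conv_nth)
qed auto

text \<open>The index created by \<open>bind\<close> is the outermost one, so its type goes to the
  end of the context.\<close>

lemma has_ty_bind:
  "has_ty L Bs t A \<Longrightarrow> length Bs = k \<Longrightarrow> has_ty L (Bs @ [snd x]) (bind x t k) A"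
proof (induction arbitrary: k rule: has_ty.induct)
  case (1 y Bs)
  then show ?case by (auto simp: nth_append)
next
  case (2 i Bs)
  then show ?case by (auto simp: nth_append)
next
  case (4 ts Bs As)
  then show ?case by (auto simp: list_all2_conv_all_nth)
next
  case (7 Bs s A t)
  then show ?case by (metis bind.simps(7) has_ty.intros(7))
next
  case (8 Bs s A t)
  then show ?case by (metis bind.simps(8) has_ty.intros(8))
qed auto

lemma fv_compr [simp]: "fv (compr x \<alpha>) = fv \<alpha> - {x}"
  by (simp add: compr_def)

lemma has_ty_compr:
  "has_ty L [] \<alpha> Om \<Longrightarrow> wf_ty (gnds L) (snd x) \<Longrightarrow> has_ty L [] (compr x \<alpha>) (Pw (snd x))"
  using has_ty_bind[of L "[]" \<alpha> Om 0 x] by (simp add: compr_def)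

section \<open>Instantiation, variables and typing of the logical operations\<close>

lemma inst_tt [simp]: "inst \<tau>s \<sigma> tt k = tt"
  by (simp add: tt_def)

lemma inst_conj [simp]: "inst \<tau>s \<sigma> (conj \<alpha> \<beta>) k = conj (inst \<tau>s \<sigma> \<alpha> k) (inst \<tau>s \<sigma> \<beta> k)"
  by (simp add: conj_def)

lemma inst_imp [simp]: "inst \<tau>s \<sigma> (imp \<alpha> \<beta>) k = imp (inst \<tau>s \<sigma> \<alpha> k) (inst \<tau>s \<sigma> \<beta> k)"
  by (simp add: imp_def)

lemma fv_tt [simp]: "fv tt = {}"
  by (simp add: tt_def)

lemma fv_conj [simp]: "fv (conj \<alpha> \<beta>) = fv \<alpha> \<union> fv \<beta>"
  by (simp add: conj_def)

lemma fv_imp [simp]: "fv (imp \<alpha> \<beta>) = fv \<alpha> \<union> fv \<beta>"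
  by (auto simp add: imp_def)

lemma fv_all [simp]: "fv (all x \<alpha>) = fv \<alpha> - {x}"
  by (auto simp add: all_def)

lemma has_ty_tt [simp]: "has_ty L Bs tt A \<longleftrightarrow> A = Om"
  by (auto simp: tt_def)

lemma has_ty_conj [simp]: "has_ty L Bs (conj \<alpha> \<beta>) A \<longleftrightarrow> A = Om \<and> has_ty L Bs \<alpha> Om \<and> has_ty L Bs \<beta> Om"
  by (auto simp: conj_def list_all2_Cons1)

lemma has_ty_imp [simp]: "has_ty L Bs (imp \<alpha> \<beta>) A \<longleftrightarrow> A = Om \<and> has_ty L Bs \<alpha> Om \<and> has_ty L Bs \<beta> Om"
  by (auto simp: imp_def)

lemma has_ty_all: "has_ty L [] \<alpha> Om \<Longrightarrow> wf_ty (gnds L) (snd x) \<Longrightarrow> has_ty L [] (all x \<alpha>) Om"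
  using has_ty_compr[of L \<alpha> x] has_ty_compr[of L tt x] by (auto simp: all_def)

section \<open>Fresh variables\<close>

lemma fresh_notin: "finite V \<Longrightarrow> (fresh A V, A) \<notin> V"
proof -
  assume "finite V"
  then have "finite (fst ` V)" by simp
  then obtain n where "n \<notin> fst ` V" using ex_new_if_finite infinite_UNIV_nat by blast
  then have "(n, A) \<notin> V" by force
  then show ?thesis unfolding fresh_def by (rule LeastI)
qed

lemma fv_ex [simp]: "fv (ex x \<alpha>) = fv \<alpha> - {x}"
  using fresh_notin[of "insert x (fv \<alpha>)" Om] by (auto simp add: ex_def Let_def)

lemma has_ty_ex: "has_ty L [] \<alpha> Om \<Longrightarrow> wf_ty (gnds L) (snd x) \<Longrightarrow> has_ty L [] (ex x \<alpha>) Om"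
  by (auto simp: ex_def Let_def intro!: has_ty_all)

lemma has_ty_fv: "has_ty L Bs t A \<Longrightarrow> x \<in> fv t \<Longrightarrow> wf_ty (gnds L) (snd x)"
  by (induction rule: has_ty.induct) (fastforce simp: list_all2_conv_all_nth in_set_conv_nth)+

lemma wf_ty_has_ty:
  assumes "local_language L"
  shows "has_ty L Bs t A \<Longrightarrow> \<forall>B\<in>set Bs. wf_ty (gnds L) B \<Longrightarrow> wf_ty (gnds L) A"
proof (induction rule: has_ty.induct)
  case (3 h Bs t)
  then show ?case using assms by (auto simp: local_language_def)
next
  case (4 ts Bs As)
  then show ?case by (auto simp: list_all2_conv_all_nth in_set_conv_nth)
qed auto

lemma ex_fresh_var: "finite (V :: 'g var set) \<Longrightarrow> \<exists>z. snd z = A \<and> z \<notin> V"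
  using fresh_notin[of V A] by (metis snd_conv)

lemma fresh_varE:
  fixes V :: "'g var set"
  assumes "finite V" obtains z where "snd z = A" "z \<notin> V"
  using ex_fresh_var[OF assms] by blast

lemma ex_fresh_vars: "finite (V :: 'g var set) \<Longrightarrow> \<exists>xs. map snd xs = As \<and> distinct xs \<and> set xs \<inter> V = {}"
proof (induction As)
  case (Cons A As)
  then obtain xs where xs: "map snd xs = As" "distinct xs" "set xs \<inter> V = {}" by blast
  obtain z where "snd z = A" "z \<notin> V \<union> set xs" using Cons(2) ex_fresh_var[of "V \<union> set xs"] by blast
  then show ?case using xs by (intro exI[of _ "z # xs"]) auto
qed simp

section \<open>Stages and forcing\<close>

locale lst =
  fixes L :: "('g, 'f) lang" and S :: "('g, 'f) sequent set"
  assumes local_language: "local_language L" and local_set_theory: "local_set_theory L S"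
begin

text \<open>
  A stage is a finite set of hypotheses. Only variables occurring in it are available at the stage, and
  adding a hypothesis \<open>x = x\<close> makes a new one available. The side condition of the cut rule then always holds.
\<close>

definition stage :: "('g, 'f) tm set \<Rightarrow> bool" where
  "stage p \<longleftrightarrow> finite p \<and> (\<forall>\<gamma>\<in>p. formula L \<gamma>)"

definition FV :: "('g, 'f) tm set \<Rightarrow> 'g var set" where
  "FV p = \<Union> (fv ` p)"

definition le (infix "\<preceq>" 50) where
  "p \<preceq> q \<longleftrightarrow> p \<subseteq> q \<and> stage q"

definition over where
  "over p t A \<longleftrightarrow> stage p \<and> has_ty L [] t A \<and> fv t \<subseteq> FV p"

definition forces (infix "||-" 45) where
  "p ||- \<alpha> \<longleftrightarrow> over p \<alpha> Om \<and> derives L S p \<alpha>"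

definition env where
  "env p \<sigma> V \<longleftrightarrow> stage p \<and> (\<forall>x\<in>V. over p (\<sigma> x) (snd x))"

text \<open>A local set theory contains every sequent derivable from it, and all its members are
  well formed; no induction on derivations is involved.\<close>

lemma derives_wf: "derives L S \<Gamma> \<alpha> \<Longrightarrow> finite \<Gamma> \<and> (\<forall>\<gamma>\<in>\<Gamma>. formula L \<gamma>) \<and> formula L \<alpha>"
  using local_set_theory by (fastforce simp: local_set_theory_def sequent_def)

lemma wf_ty_tm: "has_ty L [] t A \<Longrightarrow> wf_ty (gnds L) A"
  using wf_ty_has_ty[OF local_language] by fastforce

lemma over_wf: "over p t A \<Longrightarrow> wf_ty (gnds L) A"
  by (auto simp: over_def dest: wf_ty_tm)

lemma over_stage: "over p t A \<Longrightarrow> stage p"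
  by (simp add: over_def)

lemma over_ty: "over p t A \<Longrightarrow> has_ty L [] t A"
  by (simp add: over_def)

lemma forces_over: "p ||- \<alpha> \<Longrightarrow> over p \<alpha> Om"
  by (simp add: forces_def)

lemma forces_stage: "p ||- \<alpha> \<Longrightarrow> stage p"
  by (simp add: forces_def over_def)

section \<open>The order of stages and monotonicity\<close>

lemma le_refl: "stage p \<Longrightarrow> p \<preceq> p"
  by (simp add: le_def)

lemma le_trans: "p \<preceq> q \<Longrightarrow> q \<preceq> r \<Longrightarrow> p \<preceq> r"
  by (auto simp: le_def)

lemma le_stage: "p \<preceq> q \<Longrightarrow> stage q"
  by (simp add: le_def)

lemma FV_mono: "p \<preceq> q \<Longrightarrow> FV p \<subseteq> FV q"
  by (auto simp: le_def FV_def)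

lemma over_mono: "over p t A \<Longrightarrow> p \<preceq> q \<Longrightarrow> over q t A"
  using FV_mono[of p q] by (auto simp: le_def over_def)

lemma env_mono: "env p \<sigma> V \<Longrightarrow> p \<preceq> q \<Longrightarrow> env q \<sigma> V"
  by (auto simp: env_def le_stage intro: over_mono)

lemma thinning_finite: "finite \<Delta> \<Longrightarrow> derives L S \<Gamma> \<alpha> \<Longrightarrow> \<forall>\<gamma>\<in>\<Delta>. formula L \<gamma> \<Longrightarrow> derives L S (\<Gamma> \<union> \<Delta>) \<alpha>"
proof (induction rule: finite_induct)
  case (insert \<delta> \<Delta>)
  then show ?case using derives.thinning[of L S "\<Gamma> \<union> \<Delta>" \<alpha> \<delta>] by simp
qed simp

lemma forces_mono: "p ||- \<alpha> \<Longrightarrow> p \<preceq> q \<Longrightarrow> q ||- \<alpha>"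
proof -
  assume a: "p ||- \<alpha>" and l: "p \<preceq> q"
  have "derives L S (p \<union> q) \<alpha>" using a l by (intro thinning_finite) (auto simp: forces_def le_def stage_def)
  moreover have "p \<union> q = q" using l by (auto simp: le_def)
  ultimately show ?thesis using a l by (auto simp: forces_def intro: over_mono)
qed

section \<open>Hypotheses, cut and derived rules at a stage\<close>

lemma stage_insert: "stage p \<Longrightarrow> formula L \<alpha> \<Longrightarrow> stage (insert \<alpha> p)"
  by (simp add: stage_def)

lemma le_insert: "stage p \<Longrightarrow> formula L \<alpha> \<Longrightarrow> p \<preceq> insert \<alpha> p"
  by (auto simp add: le_def stage_insert)

lemma forces_hyp: "stage p \<Longrightarrow> \<alpha> \<in> p \<Longrightarrow> p ||- \<alpha>"
proof -
  assume a: "stage p" "\<alpha> \<in> p"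
  then have "formula L \<alpha>" by (simp add: stage_def)
  then have "derives L S ({\<alpha>} \<union> p) \<alpha>"
    using a by (intro thinning_finite derives.tautology) (auto simp: stage_def)
  then show ?thesis using a \<open>formula L \<alpha>\<close> by (auto simp: forces_def over_def insert_absorb FV_def)
qed

lemma forces_insert: "over p \<alpha> Om \<Longrightarrow> insert \<alpha> p ||- \<alpha>"
  by (auto simp: over_def stage_insert intro: forces_hyp)

lemma forces_cut: "p ||- \<alpha> \<Longrightarrow> insert \<alpha> p ||- \<beta> \<Longrightarrow> p ||- \<beta>"
proof -
  assume a: "p ||- \<alpha>" "insert \<alpha> p ||- \<beta>"
  then have "FV (insert \<alpha> p) = FV p" by (auto simp: FV_def forces_def over_def)
  then show ?thesis using a derives.cut[of L S p \<alpha> \<beta>] by (auto simp: forces_def over_def FV_def)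
qed

lemma forces_ax: "derives L S {} \<alpha> \<Longrightarrow> stage p \<Longrightarrow> fv \<alpha> \<subseteq> FV p \<Longrightarrow> p ||- \<alpha>"
  using thinning_finite[of p "{}" \<alpha>] derives_wf[of "{}" \<alpha>] by (auto simp: forces_def over_def stage_def)

text \<open>Turns a derivable sequent into a rule for stages: thin it by \<open>p\<close>, then cut
  the members of \<Gamma> one after the other.\<close>

lemma forces_rule:
  assumes "derives L S \<Gamma> \<alpha>" and "\<And>\<gamma>. \<gamma> \<in> \<Gamma> \<Longrightarrow> p ||- \<gamma>" and "fv \<alpha> \<subseteq> FV p" and "stage p"
  shows "p ||- \<alpha>"
proof -
  have wft: "finite \<Gamma>" "\<forall>\<gamma>\<in>\<Gamma>. formula L \<gamma>" "formula L \<alpha>" using assms(1) derives_wf by auto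
  have "derives L S (\<Gamma> \<union> p) \<alpha>" using assms(1,4) by (intro thinning_finite) (auto simp: stage_def)
  moreover have "FV p \<subseteq> FV (\<Gamma> \<union> p)" "stage (\<Gamma> \<union> p)" using wft assms(4) by (auto simp: FV_def stage_def)
  ultimately have "\<Gamma> \<union> p ||- \<alpha>" using assms wft by (auto simp: forces_def over_def)
  with wft(1) assms(2) show ?thesis
  proof (induction \<Gamma> rule: finite_induct)
    case (insert \<gamma> \<Gamma>)
    have "\<Gamma> \<union> p ||- \<gamma>"
    proof (rule forces_mono)
      show "p ||- \<gamma>" using insert by simp
      show "p \<preceq> \<Gamma> \<union> p" using insert by (auto simp: le_def stage_def dest: forces_stage forces_over over_ty)
    qed
    moreover have "insert \<gamma> (\<Gamma> \<union> p) ||- \<alpha>" using insert by simp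
    ultimately have "\<Gamma> \<union> p ||- \<alpha>" by (rule forces_cut)
    then show ?case using insert by simp
  qed simp
qed

text \<open>The calculus substitutes for one variable at a time. Iterating over \<open>V\<close>
  amounts to a simultaneous substitution because no inserted term contains a variable of
  \<open>V\<close>, so later substitutions do not touch earlier results.\<close>

lemma derives_msub:
  assumes "derives L S \<Gamma> \<alpha>" and "finite V"
    and "\<And>x. x \<in> V \<Longrightarrow> has_ty L [] (\<sigma> x) (snd x)" and "\<And>x. x \<in> V \<Longrightarrow> fv (\<sigma> x) \<inter> V = {}"
  shows "derives L S ((\<lambda>\<gamma>. inst [] (\<lambda>x. if x \<in> V then \<sigma> x else Fv x) \<gamma> 0) ` \<Gamma>)
    (inst [] (\<lambda>x. if x \<in> V then \<sigma> x else Fv x) \<alpha> 0)"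
  using assms(2-4)
proof (induction V rule: finite_induct)
  case empty
  then show ?case using assms(1) by (simp add: inst_Fv)
next
  case (insert y V)
  let ?s = "\<lambda>V x. if x \<in> V then \<sigma> x else Fv x"
  have eq: "subst y (\<sigma> y) (inst [] (?s V) \<gamma> 0) = inst [] (?s (insert y V)) \<gamma> 0" if "formula L \<gamma>" for \<gamma>
  proof -
    have "\<exists>A. has_ty L [] (?s V x) A" if "x \<in> fv \<gamma>" for x
    proof (cases "x \<in> V")
      case False
      then show ?thesis using that \<open>formula L \<gamma>\<close> by (auto dest: has_ty_fv)
    qed (use insert.prems(1)[of x] in auto)
    then have "subst y (\<sigma> y) (inst [] (?s V) \<gamma> 0) = inst [] (\<lambda>x. inst [] (Fv(y := \<sigma> y)) (?s V x) 0) \<gamma> 0"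
      unfolding subst_inst[where k = 0] by (rule inst_inst_Nil)
    also have "\<dots> = inst [] (?s (insert y V)) \<gamma> 0"
    proof (rule inst_cong)
      fix x assume "x \<in> fv \<gamma>"
      have "inst [] (Fv(y := \<sigma> y)) (\<sigma> x) 0 = \<sigma> x" if "x \<in> V"
        using insert.prems(1)[of x] insert.prems(2)[of x] that by (intro inst_id) auto
      then show "inst [] (Fv(y := \<sigma> y)) (?s V x) 0 = ?s (insert y V) x" using insert.hyps by auto
    qed
    finally show ?thesis .
  qed
  have wft: "\<forall>\<gamma>\<in>\<Gamma>. formula L \<gamma>" "formula L \<alpha>" using assms(1) derives_wf by auto
  have "derives L S ((\<lambda>\<gamma>. inst [] (?s V) \<gamma> 0) ` \<Gamma>) (inst [] (?s V) \<alpha> 0)"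
    using insert by auto
  from derives.substitution[OF this, of "\<sigma> y" y]
  have "derives L S (subst y (\<sigma> y) ` (\<lambda>\<gamma>. inst [] (?s V) \<gamma> 0) ` \<Gamma>) (subst y (\<sigma> y) (inst [] (?s V) \<alpha> 0))"
    using insert by simp
  moreover have "subst y (\<sigma> y) ` (\<lambda>\<gamma>. inst [] (?s V) \<gamma> 0) ` \<Gamma> = (\<lambda>\<gamma>. inst [] (?s (insert y V)) \<gamma> 0) ` \<Gamma>"
    unfolding image_image using wft(1) by (intro image_cong) (simp_all add: eq)
  ultimately show ?case using eq[OF wft(2)] by simp
qed

end

section \<open>Equality\<close>

abbreviation inst1 :: "'g var \<Rightarrow> ('g, 'f) tm \<Rightarrow> ('g, 'f) tm \<Rightarrow> ('g, 'f) tm" where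
  "inst1 x s t \<equiv> inst [] (Fv(x := s)) t 0"

text \<open>Converse to opening: a body of a comprehension is recovered by filling its index with a
  fresh variable and abstracting it again. It lets axioms stated with named variables apply to an
  arbitrary \<open>Cm\<close>.\<close>

lemma bind_inst:
  "has_ty L Ds t B \<Longrightarrow> Ds = Cs @ [A] \<Longrightarrow> length Cs = k \<Longrightarrow> x \<notin> fv t \<Longrightarrow> bind x (inst [Fv x] Fv t k) k = t"
proof (induction arbitrary: Cs k rule: has_ty.induct)
  case (4 ts Ds As)
  have "bind x (inst [Fv x] Fv (ts ! i) k) k = ts ! i" if "i < length ts" for i
  proof -
    have "x \<notin> fv (ts ! i)" using nth_mem[OF that] 4(5) by auto
    then show ?thesis using 4 that by (simp add: list_all2_conv_all_nth)
  qed
  then show ?case by (auto intro: nth_equalityI)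
next
  case (6 D Ds t)
  then show ?case using "6.IH"[of "D # Cs"] by simp
qed auto

context lst begin

text \<open>The equality axiom mentions variables only. It is used for two fresh variables
  \<open>x\<close> and \<open>y\<close>, which are then replaced by \<open>s\<close> and
  \<open>t\<close> simultaneously.\<close>

lemma derives_leibniz:
  assumes "formula L \<alpha>" and "has_ty L [] s (snd z)" and "has_ty L [] t (snd z)"
  shows "derives L S {Eq s t, inst1 z s \<alpha>} (inst1 z t \<alpha>)"
proof -
  obtain x where x: "snd x = snd z" "x \<notin> insert z (fv s \<union> fv t \<union> fv \<alpha>)"
    by (rule fresh_varE[of "insert z (fv s \<union> fv t \<union> fv \<alpha>)"]) auto
  obtain y where y: "snd y = snd z" "y \<notin> insert x (insert z (fv s \<union> fv t \<union> fv \<alpha>))"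
    by (rule fresh_varE[of "insert x (insert z (fv s \<union> fv t \<union> fv \<alpha>))"]) auto
  let ?\<sigma> = "\<lambda>v. if v = x then s else t"
  let ?\<rho> = "\<lambda>v. if v \<in> {x, y} then ?\<sigma> v else Fv v"
  have eq: "inst [] ?\<rho> (inst1 z (Fv v) \<alpha>) 0 = inst1 z (?\<rho> v) \<alpha>" if "snd v = snd z" for v
  proof -
    have wft: "wf_ty (gnds L) (snd z)" using assms(2) by (rule wf_ty_tm)
    have "inst [] ?\<rho> (inst1 z (Fv v) \<alpha>) 0 = inst [] (\<lambda>w. inst [] ?\<rho> ((Fv(z := Fv v)) w) 0) \<alpha> 0"
      using wft that assms(1) by (intro inst_inst_Nil[of \<alpha> L]) (auto dest: has_ty_fv)
    also have "\<dots> = inst1 z (?\<rho> v) \<alpha>"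
      using x y by (intro inst_cong) auto
    finally show ?thesis .
  qed
  have "derives L S {Eq (Fv x) (Fv y), subst z (Fv x) \<alpha>} (subst z (Fv y) \<alpha>)"
    using assms x y wf_ty_tm[OF assms(2)] by (intro derives.equality) auto
  then have "derives L S {Eq (Fv x) (Fv y), inst1 z (Fv x) \<alpha>} (inst1 z (Fv y) \<alpha>)"
    unfolding subst_inst[where k = 0] .
  then have "derives L S ((\<lambda>\<gamma>. inst [] ?\<rho> \<gamma> 0) ` {Eq (Fv x) (Fv y), inst1 z (Fv x) \<alpha>})
      (inst [] ?\<rho> (inst1 z (Fv y) \<alpha>) 0)"
    using x y assms(2,3) by (intro derives_msub) (auto split: if_splits)
  then have "derives L S {inst [] ?\<rho> (Eq (Fv x) (Fv y)) 0, inst [] ?\<rho> (inst1 z (Fv x) \<alpha>) 0}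
      (inst [] ?\<rho> (inst1 z (Fv y) \<alpha>) 0)" by simp
  then show ?thesis using x y by (simp only: eq) simp
qed

text \<open>Reflexivity is not an axiom: it follows from \<open>\<langle>x,x\<rangle>\<^sub>0 = x\<close> by replacing the left-hand side.\<close>

lemma derives_refl_var:
  assumes "wf_ty (gnds L) (snd x)"
  shows "derives L S {} (Eq (Fv x) (Fv x))"
proof -
  let ?s = "Pr [snd x, snd x] 0 (Tup [Fv x, Fv x])"
  obtain z where z: "snd z = snd x" "z \<noteq> x" using ex_fresh_var[of "{x}" "snd x"] by auto
  have "derives L S {Eq ?s (Fv x), inst1 z ?s (Eq (Fv z) (Fv x))} (inst1 z (Fv x) (Eq (Fv z) (Fv x)))"
    using assms z by (intro derives_leibniz) auto
  then have "derives L S {Eq ?s (Fv x)} (Eq (Fv x) (Fv x))" using z by simp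
  moreover have "derives L S {} (Eq ?s (Fv x))"
    using derives.product_comp[of L "[x, x]" 0 S] assms by simp
  ultimately show ?thesis using derives.cut[of L S "{}" "Eq ?s (Fv x)"] by simp
qed

lemma forces_refl: "over p t A \<Longrightarrow> p ||- Eq t t"
proof -
  assume t: "over p t A"
  have "derives L S {} (Eq (Fv (0, A)) (Fv (0, A)))"
    using t by (intro derives_refl_var) (auto dest: over_wf)
  from derives.substitution[OF this, of t "(0, A)"] t show ?thesis
    by (intro forces_ax) (auto simp: over_def)
qed

lemma forces_leibniz:
  assumes "p ||- Eq s t" and "p ||- inst1 z s \<alpha>" and "formula L \<alpha>" and "fv \<alpha> \<subseteq> insert z (FV p)"
    and "has_ty L [] s (snd z)"
  shows "p ||- inst1 z t \<alpha>"
proof -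
  have t: "has_ty L [] t (snd z)"
    using assms(1,5) has_ty_unique by (fastforce simp: forces_def over_def)
  show ?thesis
  proof (rule forces_rule[OF derives_leibniz[OF assms(3,5) t]])
    show "fv (inst1 z t \<alpha>) \<subseteq> FV p"
      using fv_inst[of "[]" "Fv(z := t)" \<alpha> 0] assms(1,4) by (force simp: forces_def over_def split: if_splits)
  qed (use assms in \<open>auto dest: forces_stage\<close>)
qed

section \<open>Congruence and transport along equality\<close>

lemma forces_EqE:
  assumes "p ||- Eq s t" obtains A where "over p s A" "over p t A"
  using assms by (auto simp: forces_def over_def)

lemma forces_Eq_over: "p ||- Eq s t \<Longrightarrow> over p s A \<Longrightarrow> over p t A"
  by (erule forces_EqE) (auto simp: over_def dest: has_ty_unique)

lemma forces_Eq_over': "p ||- Eq s t \<Longrightarrow> over p t A \<Longrightarrow> over p s A"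
  by (erule forces_EqE) (auto simp: over_def dest: has_ty_unique)

lemma finite_FV: "stage p \<Longrightarrow> finite (FV p)"
  by (auto simp: stage_def FV_def)

lemma inst1_id: "has_ty L [] t A \<Longrightarrow> z \<notin> fv t \<Longrightarrow> inst1 z s t = t"
  by (rule inst_id) auto

text \<open>Leibniz's rule for the formula \<open>Eq (inst1 z s u) u\<close> in \<open>z\<close>.
  The left-hand side is already free of \<open>z\<close>, as \<open>z\<close> is not in
  \<open>FV p\<close>, so only the right-hand copy of \<open>u\<close> moves from \<open>s\<close>
  to \<open>t\<close>; the starting instance is reflexivity.\<close>

lemma forces_cong:
  assumes "p ||- Eq s t" and "has_ty L [] u B" and "fv u \<subseteq> insert z (FV p)" and "z \<notin> FV p"
    and "has_ty L [] s (snd z)"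
  shows "p ||- Eq (inst1 z s u) (inst1 z t u)"
proof -
  have s: "over p s (snd z)" using assms(1,5) by (auto elim!: forces_EqE simp: over_def)
  have wft: "wf_ty (gnds L) (snd x)" if "x \<in> fv u" for x using assms(2) that by (rule has_ty_fv)
  have us: "over p (inst1 z s u) B"
  proof -
    have "fv (inst1 z s u) \<subseteq> FV p"
      using fv_inst[of "[]" "Fv(z := s)" u 0] s assms(3) by (force simp: forces_def over_def split: if_splits)
    moreover have "has_ty L [] (inst1 z s u) B"
      using assms(2) wft assms(5) by (intro has_ty_msub) auto
    ultimately show ?thesis using s by (auto simp: over_def)
  qed
  have id: "inst1 z r (inst1 z s u) = inst1 z s u" for r
    using us assms(4) by (intro inst1_id[of _ B]) (auto simp: over_def)
  have "p ||- inst1 z t (Eq (inst1 z s u) u)"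
  proof (rule forces_leibniz[OF assms(1) _ _ _ assms(5)])
    show "p ||- inst1 z s (Eq (inst1 z s u) u)" using forces_refl[OF us] id by simp
  qed (use us assms(2,3) in \<open>auto simp: over_def\<close>)
  then show ?thesis using id by simp
qed

lemma forces_sym:
  assumes "p ||- Eq s t" shows "p ||- Eq t s"
proof -
  obtain A where A: "over p s A" "over p t A" using assms by (rule forces_EqE)
  obtain z where z: "snd z = A" "z \<notin> FV p" using ex_fresh_var[OF finite_FV[OF forces_stage[OF assms]]] by blast
  have "inst1 z r s = s" for r using A z by (intro inst1_id[of _ A]) (auto simp: over_def)
  moreover have "p ||- inst1 z t (Eq (Fv z) s)"
    using A z calculation forces_refl[OF A(1)] over_wf[OF A(1)]
    by (intro forces_leibniz[OF assms]) (auto simp: over_def)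
  ultimately show ?thesis by simp
qed

lemma forces_trans:
  assumes "p ||- Eq s t" and "p ||- Eq t u" shows "p ||- Eq s u"
proof -
  obtain A where A: "over p s A" "over p t A" using assms(1) by (rule forces_EqE)
  have u: "over p u A" using assms(2) A(2) by (rule forces_Eq_over)
  obtain z where z: "snd z = A" "z \<notin> FV p" using ex_fresh_var[OF finite_FV[OF forces_stage[OF assms(1)]]] by blast
  have "inst1 z r s = s" for r using A z by (intro inst1_id[of _ A]) (auto simp: over_def)
  moreover have "p ||- inst1 z u (Eq s (Fv z))"
    using A z calculation assms over_wf[OF A(1)]
    by (intro forces_leibniz[OF assms(2)]) (auto simp: over_def)
  ultimately show ?thesis by simp
qed

lemma forces_Eq_OmD:
  assumes "p ||- Eq \<alpha> \<beta>" and "p ||- \<alpha>" shows "p ||- \<beta>"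
proof -
  let ?z = "(0, Om)"
  \<comment> \<open>Leibniz's rule for the simplest formula in a truth value variable: the variable
    itself.\<close>
  have "p ||- inst1 ?z \<beta> (Fv ?z)"
    using assms by (intro forces_leibniz[OF assms(1)]) (auto simp: forces_def over_def)
  then show ?thesis by simp
qed

lemma over_Eq: "over p s A \<Longrightarrow> over p t A \<Longrightarrow> over p (Eq s t) Om"
  by (auto simp: over_def)

lemma over_Mem: "over p s A \<Longrightarrow> over p t (Pw A) \<Longrightarrow> over p (Mem s t) Om"
  by (auto simp: over_def)

lemma over_Pr: "over p t (Prod As) \<Longrightarrow> i < length As \<Longrightarrow> A = As ! i \<Longrightarrow> over p (Pr As i t) A"
  by (auto simp: over_def)

lemma over_Tup: "stage p \<Longrightarrow> list_all2 (over p) ts As \<Longrightarrow> length As \<noteq> 1 \<Longrightarrow> over p (Tup ts) (Prod As)"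
  by (force simp: over_def list_all2_conv_all_nth in_set_conv_nth)

lemma over_Tup2: "over p s A \<Longrightarrow> over p t B \<Longrightarrow> over p (Tup [s, t]) (Prod [A, B])"
  by (auto simp: over_def)

lemma over_tt: "stage p \<Longrightarrow> over p tt Om"
  by (auto simp: over_def)

lemma forces_MemE:
  assumes "p ||- Mem s t" obtains A where "over p s A" "over p t (Pw A)"
  using assms by (auto simp: forces_def over_def)

lemma forces_Mem_over: "p ||- Mem s t \<Longrightarrow> has_ty L [] t (Pw A) \<Longrightarrow> over p s A"
  by (erule forces_MemE) (auto simp: over_def dest: has_ty_unique)

text \<open>The premises about all later stages are used at two of them,
  \<open>insert \<alpha> p\<close> and \<open>insert \<beta> p\<close>; these are the premises of
  the equivalence rule.\<close>

lemma forces_Eq_OmI: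
  assumes "over p \<alpha> Om" "over p \<beta> Om" "\<And>q. p \<preceq> q \<Longrightarrow> q ||- \<alpha> \<Longrightarrow> q ||- \<beta>"
    "\<And>q. p \<preceq> q \<Longrightarrow> q ||- \<beta> \<Longrightarrow> q ||- \<alpha>"
  shows "p ||- Eq \<alpha> \<beta>"
proof -
  have "insert \<alpha> p ||- \<beta>" "insert \<beta> p ||- \<alpha>"
    using assms(1,2) by (auto intro!: assms(3,4) le_insert forces_insert simp: over_def)
  then have "derives L S p (Eq \<alpha> \<beta>)" by (intro derives.equivalence) (auto simp: forces_def)
  then show ?thesis using assms(1,2) by (auto simp: forces_def intro: over_Eq)
qed

text \<open>The context is given as a function \<open>U\<close> on terms, so that the fresh variable
  marking the place of the argument is chosen once, here.\<close>

lemma forces_cong_unary: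
  assumes "p ||- Eq s t" and "has_ty L [] (U s) B" and "\<And>z. snd z = A \<Longrightarrow> wf_ty (gnds L) A \<Longrightarrow> has_ty L [] (U (Fv z)) B"
    and "over p s A" and "\<And>z. fv (U (Fv z)) \<subseteq> insert z (FV p)"
    and "\<And>z r. z \<notin> FV p \<Longrightarrow> inst1 z r (U (Fv z)) = U r"
  shows "p ||- Eq (U s) (U t)"
proof -
  obtain z where z: "snd z = A" "z \<notin> FV p" using ex_fresh_var[OF finite_FV[OF forces_stage[OF assms(1)]]] by blast
  have "p ||- Eq (inst1 z s (U (Fv z))) (inst1 z t (U (Fv z)))"
    using assms(1,4,5) assms(3)[of z] z over_wf[OF assms(4)]
    by (intro forces_cong[of p s t _ B]) (auto simp: over_def)
  then show ?thesis using assms(6) z by simp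
qed

lemma forces_Fn_cong: "p ||- Eq s t \<Longrightarrow> over p s (fdom L h) \<Longrightarrow> h \<in> fns L \<Longrightarrow> p ||- Eq (Fn h s) (Fn h t)"
  by (rule forces_cong_unary[of p s t "Fn h" "fcod L h" "fdom L h"]) (auto simp: over_def)

lemma forces_Pr_cong: "p ||- Eq s t \<Longrightarrow> over p s (Prod As) \<Longrightarrow> i < length As \<Longrightarrow> p ||- Eq (Pr As i s) (Pr As i t)"
  by (rule forces_cong_unary[of p s t "Pr As i" "As ! i" "Prod As"]) (auto simp: over_def)

lemma over_inst1_id: "over p t A \<Longrightarrow> z \<notin> FV p \<Longrightarrow> inst1 z r t = t"
  by (rule inst1_id) (auto simp: over_def)

lemma forces_Mem_eq:
  assumes "p ||- Eq s t" "p ||- Mem s u" shows "p ||- Mem t u"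
proof -
  obtain A where A: "over p s A" "over p u (Pw A)" using assms(2) by (rule forces_MemE)
  have "p ||- Eq (Mem s u) (Mem t u)"
    by (rule forces_cong_unary[of p s t "\<lambda>s. Mem s u" Om A, OF assms(1)])
      (use A in \<open>auto simp: over_inst1_id[OF A(2)]\<close>, auto simp: over_def)
  then show ?thesis using assms(2) by (rule forces_Eq_OmD)
qed

lemma forces_Eq_PwD:
  assumes "p ||- Eq s t" "p ||- Mem u s" shows "p ||- Mem u t"
proof -
  obtain A where A: "over p u A" "over p s (Pw A)" using assms(2) by (rule forces_MemE)
  have "p ||- Eq (Mem u s) (Mem u t)"
    by (rule forces_cong_unary[of p s t "\<lambda>s. Mem u s" Om "Pw A", OF assms(1)])
      (use A in \<open>auto simp: over_inst1_id[OF A(1)]\<close>, auto simp: over_def)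
  then show ?thesis using assms(2) by (rule forces_Eq_OmD)
qed

lemma forces_Mem_cong:
  assumes "p ||- Eq s t" "p ||- Eq u v" "p ||- Mem s u" shows "p ||- Mem t v"
  using assms by (blast intro: forces_Mem_eq forces_Eq_PwD)

lemma forces_Eq_cong:
  assumes "p ||- Eq s t" "p ||- Eq u v" "p ||- Eq s u" shows "p ||- Eq t v"
  using assms by (blast intro: forces_sym forces_trans)

lemma over_TupD: "over p (Tup ts) A \<Longrightarrow> u \<in> set ts \<Longrightarrow> \<exists>B. over p u B"
  by (fastforce simp: over_def list_all2_conv_all_nth in_set_conv_nth)

text \<open>The components are exchanged from left to right; \<open>us\<close> collects those
  already exchanged.\<close>

lemma forces_Tup_cong_aux:
  assumes "list_all2 (\<lambda>s t. p ||- Eq s t) ss ts" "over p (Tup (us @ ss)) (Prod As)" 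
  shows "p ||- Eq (Tup (us @ ss)) (Tup (us @ ts))"
  using assms
proof (induction ss ts arbitrary: us rule: list_all2_induct)
  case Nil
  then show ?case by (simp add: forces_refl)
next
  case (Cons s ss t ts)
  obtain A where A: "over p s A" "over p t A" using Cons(1) by (rule forces_EqE)
  have tus: "\<exists>B. over p u B" if "u \<in> set us \<union> set ss" for u
    using over_TupD[OF Cons.prems, of u] that by auto
  have id: "inst1 z r u = u" if "u \<in> set us \<union> set ss" "z \<notin> FV p" for u z r
    using tus[OF that(1)] that(2) over_inst1_id by blast
  have ty: "has_ty L [] (Tup (us @ r # ss)) (Prod As)" if "has_ty L [] r A" for r
  proof -
    have len: "length (us @ s # ss) \<noteq> 1" and "list_all2 (has_ty L []) (us @ s # ss) As"
      using Cons.prems by (auto simp: over_def)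
    then obtain A1 D A2 where As: "As = A1 @ D # A2" "list_all2 (has_ty L []) us A1"
        "has_ty L [] s D" "list_all2 (has_ty L []) ss A2"
      by (auto simp: list_all2_append1 list_all2_Cons1)
    have "D = A" using As(3) A(1) by (auto simp: over_def intro: has_ty_unique)
    then have "list_all2 (has_ty L []) (us @ r # ss) As"
      using As that by (auto intro!: list_all2_appendI)
    then show ?thesis using len by simp
  qed
  have 1: "p ||- Eq (Tup (us @ s # ss)) (Tup (us @ t # ss))"
  proof (rule forces_cong_unary[OF Cons(1) _ _ A(1)])
    show "has_ty L [] (Tup (us @ s # ss)) (Prod As)" using A by (intro ty) (simp add: over_def)
    show "has_ty L [] (Tup (us @ Fv z # ss)) (Prod As)" if "snd z = A" "wf_ty (gnds L) A" for z
      using that by (intro ty) auto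
    show "fv (Tup (us @ Fv z # ss)) \<subseteq> insert z (FV p)" for z
      using Cons.prems by (auto simp: over_def)
    show "inst1 z r (Tup (us @ Fv z # ss)) = Tup (us @ r # ss)" if "z \<notin> FV p" for z r
      using id that by (auto simp: map_idI)
  qed
  have "over p (Tup ((us @ [t]) @ ss)) (Prod As)"
    using ty[of t] A Cons.prems by (auto simp: over_def)
  then have "p ||- Eq (Tup ((us @ [t]) @ ss)) (Tup ((us @ [t]) @ ts))" by (rule Cons.IH)
  then show ?case using 1 by (auto intro: forces_trans)
qed

lemma forces_Tup_cong:
  assumes "list_all2 (\<lambda>s t. p ||- Eq s t) ss ts" "over p (Tup ss) (Prod As)" 
  shows "p ||- Eq (Tup ss) (Tup ts)"
  using forces_Tup_cong_aux[of p ss ts "[]"] assms by simp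

section \<open>Projections and surjective pairing\<close>

lemma forces_eta:
  assumes "over p t (Prod As)"
  shows "p ||- Eq t (Tup (map (\<lambda>i. Pr As i t) [0..<length As]))"
proof -
  let ?x = "(0, Prod As)"
  have "derives L S {} (Eq (Fv ?x) (Tup (map (\<lambda>i. Pr As i (Fv ?x)) [0..<length As])))"
    using over_wf[OF assms] by (intro derives.product_eta) auto
  from derives.substitution[OF this, of t ?x] assms show ?thesis
    by (intro forces_ax) (auto simp: over_def o_def)
qed

lemma forces_Eq_ProdI:
  assumes "over p s (Prod As)" "over p t (Prod As)"
    and "\<And>i. i < length As \<Longrightarrow> p ||- Eq (Pr As i s) (Pr As i t)"
  shows "p ||- Eq s t"
proof -
  have e: "p ||- Eq s (Tup (map (\<lambda>i. Pr As i s) [0..<length As]))"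
    using assms(1) by (rule forces_eta)
  have "p ||- Eq (Tup (map (\<lambda>i. Pr As i s) [0..<length As])) (Tup (map (\<lambda>i. Pr As i t) [0..<length As]))"
    using assms forces_Eq_over[OF e assms(1)]
    by (intro forces_Tup_cong) (auto simp: list_all2_conv_all_nth)
  then show ?thesis using e forces_eta[OF assms(2)] by (blast intro: forces_trans forces_sym)
qed

text \<open>The axiom is about tuples of variables. It is taken for distinct variables that avoid
  \<open>FV p\<close>, and the components of the tuple are then substituted for them all at
  once.\<close>

lemma forces_Pr_Tup:
  assumes "list_all2 (over p) ts As" "length As \<noteq> 1" "i < length As"
  shows "p ||- Eq (Pr As i (Tup ts)) (ts ! i)"
proof -
  have len: "length ts = length As" using assms(1) by (rule list_all2_lengthD)
  have ts: "over p (ts ! i) (As ! i)" if "i < length As" for i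
    using assms(1) that by (simp add: list_all2_conv_all_nth)
  have p: "stage p" using ts[OF assms(3)] by (rule over_stage)
  obtain xs where xs: "map snd xs = As" "distinct xs" "set xs \<inter> FV p = {}"
    using ex_fresh_vars[OF finite_FV[OF p]] by blast
  have lx: "length xs = length As" using xs(1) by auto
  have sx: "snd (xs ! j) = As ! j" if "j < length As" for j using xs(1) that lx by (metis nth_map)
  define \<sigma> where "\<sigma> x = ts ! (THE j. j < length xs \<and> xs ! j = x)" for x
  have \<sigma>: "\<sigma> (xs ! j) = ts ! j" if "j < length As" for j
  proof -
    have "(THE j'. j' < length xs \<and> xs ! j' = xs ! j) = j"
      using that lx xs(2) by (intro the_equality) (auto simp: nth_eq_iff_index_eq)
    then show ?thesis by (simp add: \<sigma>_def)
  qed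
  have \<sigma>x: "map (\<lambda>x. if x \<in> set xs then \<sigma> x else Fv x) xs = ts"
    using \<sigma> lx len by (intro nth_equalityI) auto
  have "wf_ty (gnds L) (Prod (map snd xs))"
    unfolding xs(1) using assms(2) over_wf[OF ts] by (auto simp: in_set_conv_nth)
  then have "derives L S {} (Eq (Pr (map snd xs) i (Tup (map Fv xs))) (Fv (xs ! i)))"
    using assms(3) lx by (intro derives.product_comp) auto
  moreover have "has_ty L [] (\<sigma> x) (snd x) \<and> fv (\<sigma> x) \<inter> set xs = {}" if x: "x \<in> set xs" for x
  proof -
    obtain j where j: "j < length As" "x = xs ! j" using x lx by (auto simp: in_set_conv_nth)
    then show ?thesis using ts[of j] \<sigma>[of j] sx[of j] xs(3) by (auto simp: over_def)
  qed
  ultimately have "derives L S ((\<lambda>\<gamma>. inst [] (\<lambda>x. if x \<in> set xs then \<sigma> x else Fv x) \<gamma> 0) ` {})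
    (inst [] (\<lambda>x. if x \<in> set xs then \<sigma> x else Fv x) (Eq (Pr (map snd xs) i (Tup (map Fv xs))) (Fv (xs ! i))) 0)"
    by (intro derives_msub) auto
  then have "derives L S {} (Eq (Pr As i (Tup (map (\<lambda>x. if x \<in> set xs then \<sigma> x else Fv x) xs))) (\<sigma> (xs ! i)))"
    using assms(3) lx xs(1) by (simp add: o_def)
  then have "derives L S {} (Eq (Pr As i (Tup ts)) (ts ! i))"
    using \<sigma>[OF assms(3)] \<sigma>x by simp
  then show ?thesis
    using p assms(1,3) len over_Tup[OF p assms(1,2)] ts[OF assms(3)] by (intro forces_ax) (auto simp: over_def)
qed

lemma forces_Pr_Tup2:
  assumes "over p s A" "over p t B"
  shows "p ||- Eq (Pr [A, B] 0 (Tup [s, t])) s" "p ||- Eq (Pr [A, B] (Suc 0) (Tup [s, t])) t"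
  using forces_Pr_Tup[of p "[s, t]" "[A, B]" 0] forces_Pr_Tup[of p "[s, t]" "[A, B]" 1] assms by auto

lemma forces_Eq_Tup2D:
  assumes "p ||- Eq (Tup [s, t]) (Tup [s', t'])"
  shows "p ||- Eq s s'" "p ||- Eq t t'"
proof -
  obtain A B where t: "over p s A" "over p t B" "over p s' A" "over p t' B"
    using assms by (auto elim!: forces_EqE simp: over_def list_all2_Cons1)
  have "p ||- Eq (Pr [A, B] 0 (Tup [s, t])) (Pr [A, B] 0 (Tup [s', t']))"
      "p ||- Eq (Pr [A, B] (Suc 0) (Tup [s, t])) (Pr [A, B] (Suc 0) (Tup [s', t']))"
    using assms t by (auto intro!: forces_Pr_cong over_Tup2)
  then show "p ||- Eq s s'" "p ||- Eq t t'"
    using forces_Pr_Tup2[OF t(1,2)] forces_Pr_Tup2[OF t(3,4)] by (blast intro: forces_Eq_cong)+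
qed

lemma forces_Eq_Tup2I:
  "p ||- Eq s s' \<Longrightarrow> p ||- Eq t t' \<Longrightarrow> p ||- Eq (Tup [s, t]) (Tup [s', t'])"
  by (rule forces_EqE, assumption, rule forces_EqE, assumption, rule forces_Tup_cong)
    (auto intro: over_Tup2)

lemma forces_eta2:
  "over p t (Prod [A, B]) \<Longrightarrow> p ||- Eq t (Tup [Pr [A, B] 0 t, Pr [A, B] (Suc 0) t])"
  using forces_eta[of p t "[A, B]"] by (simp add: upt_rec)

text \<open>The comprehension axiom speaks of \<open>compr x \<alpha>\<close>. With \<alpha> the
  body opened by a fresh \<open>x\<close>, this term is \<open>Cm A t\<close> again, and
  \<open>a\<close> is finally substituted for \<open>x\<close>.\<close>

lemma forces_Mem_Cm:
  assumes "over p a A" "over p (Cm A t) (Pw A)"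
  shows "p ||- Eq (Mem a (Cm A t)) (inst [a] Fv t 0)"
proof -
  obtain x where x: "snd x = A" "x \<notin> fv t" by (rule fresh_varE[of "fv t"]) auto
  have t: "has_ty L [A] t Om" and wft: "wf_ty (gnds L) A" using assms(2) by (auto simp: over_def)
  let ?\<alpha> = "inst [Fv x] Fv t 0"
  have \<alpha>: "formula L ?\<alpha>" using t x wft has_ty_fv[OF t] by (intro has_ty_inst[OF t]) auto
  have "derives L S {} (Eq (Mem (Fv x) (compr x ?\<alpha>)) ?\<alpha>)"
    using \<alpha> x wft by (intro derives.comprehension) auto
  then have "derives L S {} (Eq (Mem (Fv x) (Cm A t)) ?\<alpha>)"
    using bind_inst[OF t, of "[]" A 0 x] x by (simp add: compr_def)
  from derives.substitution[OF this, of a x]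
  have "derives L S {} (subst x a (Eq (Mem (Fv x) (Cm A t)) ?\<alpha>))"
    using assms x by (simp add: over_def)
  moreover have "subst x a t = t"
  proof -
    have "inst1 x a t = inst [] Fv t 0" using x by (intro inst_cong) auto
    then show ?thesis by (simp add: inst_Fv subst_inst[of _ _ _ 0])
  qed
  moreover have "subst x a ?\<alpha> = inst [a] Fv t 0"
  proof -
    have "subst x a ?\<alpha> = inst ([] @ map (\<lambda>\<tau>. inst [] (Fv(x := a)) \<tau> 0) [Fv x]) (\<lambda>y. inst [] (Fv(x := a)) (Fv y) 0) t 0"
      unfolding subst_inst[of _ _ _ 0] using x wft has_ty_fv[OF t]
      by (subst inst_inst[of "[Fv x]" L t Fv "[]", symmetric]) auto
    then show ?thesis using x by (auto intro: inst_cong)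
  qed
  ultimately have "derives L S {} (Eq (Mem a (Cm A t)) (inst [a] Fv t 0))" by simp
  then show ?thesis
    using assms fv_inst[of "[a]" Fv t 0] by (intro forces_ax) (auto simp: over_def)
qed

lemma forces_Mem_Cm_iff:
  assumes "over p a A" "over p (Cm A t) (Pw A)"
  shows "p ||- Mem a (Cm A t) \<longleftrightarrow> p ||- inst [a] Fv t 0"
  using forces_Mem_Cm[OF assms] by (blast intro: forces_Eq_OmD forces_sym)

text \<open>Extensionality through a generic element: the hypothesis \<open>x = x\<close> makes a
  fresh variable \<open>x\<close> available, and the premises are used for this \<open>x\<close>
  alone.\<close>

lemma forces_Eq_PwI:
  assumes s: "over p s (Pw A)" and t: "over p t (Pw A)"
    and "\<And>q a. p \<preceq> q \<Longrightarrow> over q a A \<Longrightarrow> q ||- Mem a s \<Longrightarrow> q ||- Mem a t"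
    and "\<And>q a. p \<preceq> q \<Longrightarrow> over q a A \<Longrightarrow> q ||- Mem a t \<Longrightarrow> q ||- Mem a s"
  shows "p ||- Eq s t"
proof -
  have p: "stage p" using s by (rule over_stage)
  obtain x where x: "snd x = A" "x \<notin> FV p" using ex_fresh_var[OF finite_FV[OF p]] by blast
  have wft: "wf_ty (gnds L) A" using over_wf[OF s] by simp
  let ?e = "Eq (Fv x) (Fv x)"
  let ?q = "insert ?e p"
  have q: "p \<preceq> ?q" using p wft x by (intro le_insert) auto
  have a: "over ?q (Fv x) A" using le_stage[OF q] wft x by (auto simp: over_def FV_def)
  have "?q ||- Eq (Mem (Fv x) s) (Mem (Fv x) t)"
  proof (rule forces_Eq_OmI)
    show "over ?q (Mem (Fv x) s) Om" "over ?q (Mem (Fv x) t) Om"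
      using a over_mono[OF s q] over_mono[OF t q] by (auto intro: over_Mem)
  qed (use q a in \<open>auto intro!: assms(3,4) elim: le_trans over_mono\<close>)
  then have "derives L S ?q (Eq (Mem (Fv x) s) (Mem (Fv x) t))" by (simp add: forces_def)
  \<comment> \<open>The auxiliary hypothesis can be cut away although \<open>x\<close> is not in
    \<open>FV p\<close>, because \<open>x\<close> occurs in the formula being derived, whereas it
    would not after passing to \<open>Eq s t\<close>. So the cut precedes extensionality.\<close>
  moreover have "derives L S p ?e"
    using thinning_finite[of p "{}" ?e] derives_refl_var[of x] wft x p by (auto simp: stage_def)
  ultimately have "derives L S p (Eq (Mem (Fv x) s) (Mem (Fv x) t))"
    using derives.cut[of L S p ?e "Eq (Mem (Fv x) s) (Mem (Fv x) t)"] by simp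
  then have "derives L S p (Eq s t)"
    by (rule derives.extensionality) (use s t x in \<open>auto simp: over_def FV_def\<close>)
  then show ?thesis using s t by (auto simp: forces_def intro: over_Eq)
qed

section \<open>Connectives and quantifiers\<close>

lemma forces_tt: "stage p \<Longrightarrow> p ||- tt"
  unfolding tt_def by (rule forces_refl[of _ _ One]) (auto simp: over_def)

lemma forces_Eq_tt: "p ||- Eq \<alpha> tt \<longleftrightarrow> p ||- \<alpha>"
proof
  assume "p ||- Eq \<alpha> tt"
  then show "p ||- \<alpha>" by (metis forces_Eq_OmD forces_sym forces_tt forces_stage)
next
  assume "p ||- \<alpha>"
  then show "p ||- Eq \<alpha> tt"
    by (intro forces_Eq_OmI) (auto intro: forces_over over_tt forces_stage forces_mono forces_tt)
qed

lemma forces_conj: "p ||- conj \<alpha> \<beta> \<longleftrightarrow> p ||- \<alpha> \<and> p ||- \<beta>"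
  unfolding conj_def by (metis forces_Eq_tt forces_Eq_Tup2I forces_Eq_Tup2D)

lemma over_conj: "over p (conj \<alpha> \<beta>) Om \<longleftrightarrow> over p \<alpha> Om \<and> over p \<beta> Om"
  by (auto simp: over_def)

lemma forces_impI:
  "over p \<alpha> Om \<Longrightarrow> over p \<beta> Om \<Longrightarrow> (\<And>q. p \<preceq> q \<Longrightarrow> q ||- \<alpha> \<Longrightarrow> q ||- \<beta>) \<Longrightarrow> p ||- imp \<alpha> \<beta>"
  unfolding imp_def by (rule forces_Eq_OmI) (auto simp: over_conj forces_conj)

lemma forces_impD: "p ||- imp \<alpha> \<beta> \<Longrightarrow> p ||- \<alpha> \<Longrightarrow> p ||- \<beta>"
  unfolding imp_def by (metis forces_conj forces_sym forces_Eq_OmD)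

section \<open>Environments and membership in comprehensions\<close>

lemma over_inst:
  assumes "has_ty L [] t A" and "env p \<sigma> (fv t)"
  shows "over p (inst [] \<sigma> t k) A"
  using assms fv_inst[of "[]" \<sigma> t k] by (fastforce simp: over_def env_def intro!: has_ty_msub)

lemma env_subset: "env p \<sigma> V \<Longrightarrow> W \<subseteq> V \<Longrightarrow> env p \<sigma> W"
  by (auto simp: env_def)

lemma env_upd: "env p \<sigma> (V - {x}) \<Longrightarrow> over p s (snd x) \<Longrightarrow> env p (\<sigma>(x := s)) V"
  by (auto simp: env_def)

lemma forces_Mem_compr:
  assumes "formula L \<alpha>" and "env p \<sigma> (fv \<alpha> - {x})" and "over p a (snd x)"
  shows "p ||- Mem a (inst [] \<sigma> (compr x \<alpha>) 0) \<longleftrightarrow> p ||- inst [] (\<sigma>(x := a)) \<alpha> 0"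
proof -
  have "has_ty L [] (compr x \<alpha>) (Pw (snd x))"
    using assms over_wf[OF assms(3)] by (intro has_ty_compr)
  then have c: "over p (inst [] \<sigma> (compr x \<alpha>) 0) (Pw (snd x))" using assms(2) by (intro over_inst) auto
  have "\<exists>A. has_ty L [] (\<sigma> y) A" if "y \<in> fv (bind x \<alpha> 0)" for y
    using assms(2) that by (auto simp: env_def over_def)
  then have "inst [a] Fv (inst [] \<sigma> (bind x \<alpha> 0) (Suc 0)) 0 = inst [a] \<sigma> (bind x \<alpha> 0) 0"
    by (intro inst_open) auto
  also have "\<dots> = inst [] (\<sigma>(x := a)) \<alpha> 0" using assms(1) by (intro inst_bind) auto
  finally show ?thesis
    using forces_Mem_Cm_iff[of p a "snd x" "inst [] \<sigma> (bind x \<alpha> 0) (Suc 0)"] assms(3) c by (simp add: compr_def)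
qed

text \<open>A universal statement is the equation \<open>{x : \<alpha>} = {x : tt}\<close>, so it is
  proved by extensionality, with elements appearing at later stages.\<close>

lemma forces_allI:
  assumes "formula L \<alpha>" and "wf_ty (gnds L) (snd x)" and "env p \<sigma> (fv \<alpha> - {x})"
    and "\<And>q s. p \<preceq> q \<Longrightarrow> over q s (snd x) \<Longrightarrow> q ||- inst [] (\<sigma>(x := s)) \<alpha> 0"
  shows "p ||- inst [] \<sigma> (all x \<alpha>) 0"
  unfolding all_def inst.simps
proof (rule forces_Eq_PwI)
  show "over p (inst [] \<sigma> (compr x \<alpha>) 0) (Pw (snd x))" "over p (inst [] \<sigma> (compr x tt) 0) (Pw (snd x))"
    using assms(1-3) by (auto intro!: over_inst has_ty_compr elim: env_subset)
next
  fix q a assume q: "p \<preceq> q" and a: "over q a (snd x)"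
  show "q ||- Mem a (inst [] \<sigma> (compr x \<alpha>) 0)"
    using assms(1,4) a q env_mono[OF assms(3) q] by (simp add: forces_Mem_compr)
  show "q ||- Mem a (inst [] \<sigma> (compr x tt) 0)"
    using a over_stage[OF a] by (subst forces_Mem_compr) (auto simp: env_def forces_tt)
qed

lemma forces_allD:
  assumes "p ||- inst [] \<sigma> (all x \<alpha>) 0" and "formula L \<alpha>" and "env p \<sigma> (fv \<alpha> - {x})" and "over p s (snd x)"
  shows "p ||- inst [] (\<sigma>(x := s)) \<alpha> 0"
proof -
  have "p ||- Mem s (inst [] \<sigma> (compr x tt) 0)"
    using assms(4) over_stage[OF assms(4)] by (subst forces_Mem_compr) (auto simp: env_def forces_tt)
  moreover have "p ||- Eq (inst [] \<sigma> (compr x tt) 0) (inst [] \<sigma> (compr x \<alpha>) 0)"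
    using assms(1) by (simp add: all_def forces_sym)
  ultimately have "p ||- Mem s (inst [] \<sigma> (compr x \<alpha>) 0)" by (rule forces_Eq_PwD[rotated])
  then show ?thesis using assms by (simp add: forces_Mem_compr)
qed

text \<open>In the encoding by \<open>w\<close>, with every \<open>\<alpha>\<close> implying
  \<open>w\<close>, a witness at \<open>p\<close> remains one at all later stages and yields
  whatever truth value stands for \<open>w\<close>.\<close>

lemma forces_exI:
  assumes "formula L \<alpha>" and "env p \<sigma> (fv \<alpha> - {x})" and "over p s (snd x)"
    and "p ||- inst [] (\<sigma>(x := s)) \<alpha> 0"
  shows "p ||- inst [] \<sigma> (ex x \<alpha>) 0"
proof -
  define w where "w = (fresh Om (insert x (fv \<alpha>)), Om :: 'g ty)"
  have w: "w \<notin> insert x (fv \<alpha>)" unfolding w_def by (rule fresh_notin) simp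
  have wO: "snd w = Om" by (simp add: w_def)
  have ex: "ex x \<alpha> = all w (imp (all x (imp \<alpha> (Fv w))) (Fv w))" by (simp add: ex_def w_def Let_def)
  have wft: "wf_ty (gnds L) (snd x)" using assms(3) by (rule over_wf)
  have f: "formula L (all x (imp \<alpha> (Fv w)))"
    using assms(1) wft wO by (intro has_ty_all) auto
  show ?thesis unfolding ex
  proof (rule forces_allI)
    fix q \<omega> assume q: "p \<preceq> q" and "over q \<omega> (snd w)"
    then have \<omega>: "over q \<omega> Om" by (simp add: wO)
    let ?\<sigma> = "\<sigma>(w := \<omega>)"
    have env: "env q ?\<sigma> (fv (imp \<alpha> (Fv w)) - {x})"
      using env_mono[OF assms(2) q] \<omega> wO by (auto simp: env_def)
    show "q ||- inst [] ?\<sigma> (imp (all x (imp \<alpha> (Fv w))) (Fv w)) 0"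
    proof (simp, rule forces_impI)
      show "over q (inst [] ?\<sigma> (all x (imp \<alpha> (Fv w))) 0) Om" using f env by (intro over_inst) auto
    next
      fix r assume r: "q \<preceq> r" and *: "r ||- inst [] ?\<sigma> (all x (imp \<alpha> (Fv w))) 0"
      have pr: "p \<preceq> r" using q r by (rule le_trans)
      have "r ||- inst [] (?\<sigma>(x := s)) (imp \<alpha> (Fv w)) 0"
        using assms(1) wO env_mono[OF env r] over_mono[OF assms(3) pr] by (intro forces_allD[OF *]) auto
      moreover have "inst [] (?\<sigma>(x := s)) \<alpha> 0 = inst [] (\<sigma>(x := s)) \<alpha> 0"
        using w by (intro inst_cong) auto
      ultimately show "r ||- \<omega>"
        using w forces_mono[OF assms(4) pr] by (auto intro: forces_impD)
    qed (use \<omega> in simp)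
  qed (use f wO assms(2) in \<open>auto elim: env_subset\<close>)
qed

text \<open>The truth value variable \<open>w\<close> of the encoding is instantiated by the goal
  \<beta>. Only such an elimination is available: \<alpha> may lack a witness at \<open>p\<close>
  itself.\<close>

lemma forces_exE:
  assumes "p ||- inst [] \<sigma> (ex x \<alpha>) 0" and "formula L \<alpha>" and "wf_ty (gnds L) (snd x)"
    and "env p \<sigma> (fv \<alpha> - {x})" and "over p \<beta> Om"
    and "\<And>q s. p \<preceq> q \<Longrightarrow> over q s (snd x) \<Longrightarrow> q ||- inst [] (\<sigma>(x := s)) \<alpha> 0 \<Longrightarrow> q ||- \<beta>"
  shows "p ||- \<beta>"
proof -
  define w where "w = (fresh Om (insert x (fv \<alpha>)), Om :: 'g ty)"
  have w: "w \<notin> insert x (fv \<alpha>)" unfolding w_def by (rule fresh_notin) simp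
  have wO: "snd w = Om" by (simp add: w_def)
  have ex: "ex x \<alpha> = all w (imp (all x (imp \<alpha> (Fv w))) (Fv w))" by (simp add: ex_def w_def Let_def)
  have f: "formula L (all x (imp \<alpha> (Fv w)))"
    using assms(2,3) wO by (intro has_ty_all) auto
  let ?\<sigma> = "\<sigma>(w := \<beta>)"
  have env: "env p ?\<sigma> (fv (imp \<alpha> (Fv w)) - {x})"
    using assms(4,5) wO by (auto simp: env_def)
  have eq: "inst [] (?\<sigma>(x := s)) \<alpha> 0 = inst [] (\<sigma>(x := s)) \<alpha> 0" for s
    using w by (intro inst_cong) auto
  have "p ||- inst [] ?\<sigma> (imp (all x (imp \<alpha> (Fv w))) (Fv w)) 0"
    using assms(1) f assms(4,5) wO unfolding ex
    by (intro forces_allD) (auto elim: env_subset)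
  moreover have "p ||- inst [] ?\<sigma> (all x (imp \<alpha> (Fv w))) 0"
  proof (rule forces_allI[OF _ assms(3) env])
    fix q s assume q: "p \<preceq> q" and s: "over q s (snd x)"
    have "env q (\<sigma>(x := s)) (fv \<alpha>)" using s env_mono[OF assms(4) q] by (intro env_upd)
    then have "over q (inst [] (\<sigma>(x := s)) \<alpha> 0) Om" using assms(2) by (intro over_inst)
    then show "q ||- inst [] (?\<sigma>(x := s)) (imp \<alpha> (Fv w)) 0"
      using w eq over_mono[OF assms(5) q]
      by (auto intro!: forces_impI assms(6) elim: le_trans[OF q] over_mono[OF s])
  qed (use assms(2) wO in auto)
  ultimately show ?thesis by (auto intro: forces_impD)
qed

section \<open>Unique existence\<close>

lemma inst_subst_Fv:
  assumes "formula L \<alpha>" "wf_ty (gnds L) (snd y)"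
  shows "inst [] \<sigma> (subst x (Fv y) \<alpha>) 0 = inst [] (\<sigma>(x := \<sigma> y)) \<alpha> 0"
proof -
  have "inst [] \<sigma> (subst x (Fv y) \<alpha>) 0 = inst [] (\<lambda>z. inst [] \<sigma> ((Fv(x := Fv y)) z) 0) \<alpha> 0"
    unfolding subst_inst[of _ _ _ 0] using assms by (intro inst_inst_Nil[of \<alpha> L]) (auto dest: has_ty_fv)
  also have "\<dots> = inst [] (\<sigma>(x := \<sigma> y)) \<alpha> 0" by (intro inst_cong) auto
  finally show ?thesis .
qed

lemma fv_subst_Fv: "fv (subst x (Fv y) \<alpha>) \<subseteq> insert y (fv \<alpha> - {x})"
  using fv_inst[of "[]" "Fv(x := Fv y)" \<alpha> 0] unfolding subst_inst[of _ _ _ 0] by (force split: if_splits)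

lemma ex1_props:
  assumes "formula L \<alpha>" "wf_ty (gnds L) (snd x)"
  obtains y where "ex1 x \<alpha> = ex x (conj \<alpha> (all y (imp (subst x (Fv y) \<alpha>) (Eq (Fv x) (Fv y)))))"
    "snd y = snd x" "y \<noteq> x" "y \<notin> fv \<alpha>" "formula L (subst x (Fv y) \<alpha>)"
    "formula L (all y (imp (subst x (Fv y) \<alpha>) (Eq (Fv x) (Fv y))))"
proof
  let ?y = "(fresh (snd x) (insert x (fv \<alpha>)), snd x)"
  show "ex1 x \<alpha> = ex x (conj \<alpha> (all ?y (imp (subst x (Fv ?y) \<alpha>) (Eq (Fv x) (Fv ?y)))))"
    by (simp add: ex1_def Let_def)
  show 1: "formula L (subst x (Fv ?y) \<alpha>)" unfolding subst_inst[of _ _ _ 0]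
    using assms by (intro has_ty_msub) (auto dest: has_ty_fv)
  show "formula L (all ?y (imp (subst x (Fv ?y) \<alpha>) (Eq (Fv x) (Fv ?y))))"
    using 1 assms by (intro has_ty_all) auto
qed (use fresh_notin[of "insert x (fv \<alpha>)" "snd x"] in auto)

lemma fv_ex1: "formula L \<alpha> \<Longrightarrow> wf_ty (gnds L) (snd x) \<Longrightarrow> fv (ex1 x \<alpha>) \<subseteq> fv \<alpha> - {x}"
  by (erule ex1_props, assumption) (use fv_subst_Fv in fastforce)

lemma has_ty_ex1: "formula L \<alpha> \<Longrightarrow> wf_ty (gnds L) (snd x) \<Longrightarrow> formula L (ex1 x \<alpha>)"
  using has_ty_ex[of L _ x] by (metis ex1_props has_ty_conj)

lemma forces_ex1I:
  assumes "formula L \<alpha>" and "env p \<sigma> (fv \<alpha> - {x})" and s: "over p s (snd x)"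
    and "p ||- inst [] (\<sigma>(x := s)) \<alpha> 0"
    and "\<And>q t. p \<preceq> q \<Longrightarrow> over q t (snd x) \<Longrightarrow> q ||- inst [] (\<sigma>(x := t)) \<alpha> 0 \<Longrightarrow> q ||- Eq s t"
  shows "p ||- inst [] \<sigma> (ex1 x \<alpha>) 0"
proof -
  have wft: "wf_ty (gnds L) (snd x)" using s by (rule over_wf)
  obtain y where y: "ex1 x \<alpha> = ex x (conj \<alpha> (all y (imp (subst x (Fv y) \<alpha>) (Eq (Fv x) (Fv y)))))"
    "snd y = snd x" "y \<noteq> x" "y \<notin> fv \<alpha>" "formula L (subst x (Fv y) \<alpha>)"
    "formula L (all y (imp (subst x (Fv y) \<alpha>) (Eq (Fv x) (Fv y))))"
    using ex1_props[OF assms(1) wft] by metis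
  let ?u = "imp (subst x (Fv y) \<alpha>) (Eq (Fv x) (Fv y))"
  have e: "env p (\<sigma>(x := s)) (fv ?u - {y})"
    using assms(2) s fv_subst_Fv[of x y \<alpha>] by (auto simp: env_def)
  have "p ||- inst [] (\<sigma>(x := s)) (all y ?u) 0"
  proof (rule forces_allI[OF _ _ e])
    fix q t assume q: "p \<preceq> q" and t: "over q t (snd y)"
    have "inst [] (\<sigma>(x := s, y := t)) (subst x (Fv y) \<alpha>) 0 = inst [] ((\<sigma>(x := s, y := t))(x := t)) \<alpha> 0"
      using inst_subst_Fv[OF assms(1)] y wft by simp
    also have "\<dots> = inst [] (\<sigma>(x := t)) \<alpha> 0" using y by (intro inst_cong) auto
    finally have *: "inst [] (\<sigma>(x := s, y := t)) (subst x (Fv y) \<alpha>) 0 = inst [] (\<sigma>(x := t)) \<alpha> 0" .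
    have "env q (\<sigma>(x := t)) (fv \<alpha>)" using t y(2) env_mono[OF assms(2) q] by (intro env_upd) auto
    then have "over q (inst [] (\<sigma>(x := t)) \<alpha> 0) Om" using assms(1) by (intro over_inst)
    moreover have "over q (Eq s t) Om" using over_mono[OF s q] t y(2) by (auto intro: over_Eq)
    ultimately show "q ||- inst [] (\<sigma>(x := s, y := t)) ?u 0"
      using * y t by (auto intro!: forces_impI assms(5) intro: le_trans[OF q] over_mono)
  qed (use y wft in auto)
  then show ?thesis unfolding y(1)
    using assms y fv_subst_Fv[of x y \<alpha>] by (intro forces_exI[of _ _ _ _ s]) (auto simp: forces_conj env_def)
qed

text \<open>The element \<open>s\<close> obtained at stage \<open>q\<close> is compared only with
  elements of the same stage; the universal clause is used at \<open>q\<close>.\<close>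

lemma forces_ex1E:
  assumes "p ||- inst [] \<sigma> (ex1 x \<alpha>) 0" and "formula L \<alpha>" and wft: "wf_ty (gnds L) (snd x)"
    and "env p \<sigma> (fv \<alpha> - {x})" and "over p \<beta> Om"
    and "\<And>q s. p \<preceq> q \<Longrightarrow> over q s (snd x) \<Longrightarrow> q ||- inst [] (\<sigma>(x := s)) \<alpha> 0 \<Longrightarrow>
      (\<And>t. over q t (snd x) \<Longrightarrow> q ||- inst [] (\<sigma>(x := t)) \<alpha> 0 \<Longrightarrow> q ||- Eq s t) \<Longrightarrow> q ||- \<beta>"
  shows "p ||- \<beta>"
proof -
  obtain y where y: "ex1 x \<alpha> = ex x (conj \<alpha> (all y (imp (subst x (Fv y) \<alpha>) (Eq (Fv x) (Fv y)))))"
    "snd y = snd x" "y \<noteq> x" "y \<notin> fv \<alpha>" "formula L (subst x (Fv y) \<alpha>)"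
    "formula L (all y (imp (subst x (Fv y) \<alpha>) (Eq (Fv x) (Fv y))))"
    using ex1_props[OF assms(2) wft] by metis
  let ?u = "imp (subst x (Fv y) \<alpha>) (Eq (Fv x) (Fv y))"
  show ?thesis
  proof (rule forces_exE[OF assms(1)[unfolded y(1)] _ wft _ assms(5)])
    fix q s assume q: "p \<preceq> q" and s: "over q s (snd x)"
      and *: "q ||- inst [] (\<sigma>(x := s)) (conj \<alpha> (all y ?u)) 0"
    have e: "env q (\<sigma>(x := s)) (fv ?u - {y})"
      using env_mono[OF assms(4) q] s fv_subst_Fv[of x y \<alpha>] by (auto simp: env_def)
    show "q ||- \<beta>"
    proof (rule assms(6)[OF q s])
      show "q ||- inst [] (\<sigma>(x := s)) \<alpha> 0" using * by (simp add: forces_conj)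
      fix t assume t: "over q t (snd x)" "q ||- inst [] (\<sigma>(x := t)) \<alpha> 0"
      have "inst [] (\<sigma>(x := s, y := t)) (subst x (Fv y) \<alpha>) 0 = inst [] ((\<sigma>(x := s, y := t))(x := t)) \<alpha> 0"
        using inst_subst_Fv[OF assms(2)] y wft by simp
      also have "\<dots> = inst [] (\<sigma>(x := t)) \<alpha> 0" using y by (intro inst_cong) auto
      finally have **: "inst [] (\<sigma>(x := s, y := t)) (subst x (Fv y) \<alpha>) 0 = inst [] (\<sigma>(x := t)) \<alpha> 0" .
      have "q ||- inst [] (\<sigma>(x := s, y := t)) ?u 0"
      proof (rule forces_allD[OF _ _ e])
        show "q ||- inst [] (\<sigma>(x := s)) (all y ?u) 0" using * by (simp add: forces_conj)
      qed (use t y wft in auto)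
      then show "q ||- Eq s t" using ** t y by (auto dest: forces_impD)
    qed
  qed (use assms(2,4) y fv_subst_Fv[of x y \<alpha>] in \<open>auto simp: env_def\<close>)
qed

end

section \<open>Set constructions\<close>

fun upd :: "('v \<Rightarrow> 't) \<Rightarrow> 'v list \<Rightarrow> 't list \<Rightarrow> 'v \<Rightarrow> 't" where
  "upd \<sigma> (x # xs) (s # ss) = upd (\<sigma>(x := s)) xs ss"
| "upd \<sigma> _ _ = \<sigma>"

lemma upd_notin: "x \<notin> set xs \<Longrightarrow> upd \<sigma> xs ss x = \<sigma> x"
  by (induction \<sigma> xs ss rule: upd.induct) auto

lemma upd_nth: "distinct xs \<Longrightarrow> length ss = length xs \<Longrightarrow> i < length xs \<Longrightarrow> upd \<sigma> xs ss (xs ! i) = ss ! i"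
proof (induction \<sigma> xs ss arbitrary: i rule: upd.induct)
  case (1 \<sigma> x xs s ss)
  then show ?case by (cases i) (auto simp: upd_notin fun_upd_def)
qed auto

lemma upd_cong: "(\<And>y. y \<noteq> w \<Longrightarrow> \<sigma> y = \<sigma>' y) \<Longrightarrow> z \<noteq> w \<Longrightarrow> upd \<sigma> xs ss z = upd \<sigma>' xs ss z"
proof (induction \<sigma> xs ss arbitrary: \<sigma>' rule: upd.induct)
  case (1 \<sigma> x xs s ss)
  show ?case using "1.IH"[of "\<sigma>'(x := s)"] "1.prems" by (simp add: fun_upd_def)
qed auto

section \<open>Iterated quantifiers and conjunctions; the variables of products\<close>

lemma fv_exs [simp]: "fv (foldr ex xs \<gamma>) = fv \<gamma> - set xs"
  by (induction xs) auto

lemma has_ty_exs: "formula L \<gamma> \<Longrightarrow> \<forall>x\<in>set xs. wf_ty (gnds L) (snd x) \<Longrightarrow> formula L (foldr ex xs \<gamma>)"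
  by (induction xs) (auto intro: has_ty_ex)

lemma fv_conjs [simp]: "fv (conjs \<alpha>s) = \<Union> (fv ` set \<alpha>s)"
  by (induction \<alpha>s rule: conjs.induct) auto

lemma has_ty_conjs: "\<forall>\<alpha>\<in>set \<alpha>s. has_ty L Bs \<alpha> Om \<Longrightarrow> has_ty L Bs (conjs \<alpha>s) Om"
  by (induction \<alpha>s rule: conjs.induct) auto

lemma inst_conjs: "inst \<tau>s \<sigma> (conjs \<alpha>s) k = conjs (map (\<lambda>\<alpha>. inst \<tau>s \<sigma> \<alpha> k) \<alpha>s)"
  by (induction \<alpha>s rule: conjs.induct) auto

lemma length_vars [simp]: "length (vars As) = length As"
  by (simp add: vars_def)

lemma vars_nth: "i < length As \<Longrightarrow> vars As ! i = (i, As ! i)"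
  by (simp add: vars_def)

lemma distinct_vars: "distinct (vars As)"
  by (simp add: vars_def distinct_zipI1)

lemma set_vars: "set (vars As) = {(i, As ! i) | i. i < length As}"
  by (force simp: vars_def set_zip)

context lst begin

section \<open>Closed terms as sets\<close>

abbreviation cl where "cl X A \<equiv> closed_of L X A"

lemma inst_cl [simp]: "cl X A \<Longrightarrow> inst \<tau>s \<sigma> X k = X"
  by (rule inst_id) (auto simp: closed_of_def)

lemma cl_over: "cl X A \<Longrightarrow> stage p \<Longrightarrow> over p X A"
  by (auto simp: closed_of_def over_def)

lemma cl_fv: "cl X A \<Longrightarrow> fv X = {}"
  by (simp add: closed_of_def)

lemma cl_ty: "cl X A \<Longrightarrow> has_ty L [] X A"
  by (simp add: closed_of_def)

lemma cl_wf: "cl X A \<Longrightarrow> wf_ty (gnds L) A"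
  by (auto simp add: closed_of_def dest: wf_ty_tm)

lemma cl_wf_Pw: "cl X (Pw A) \<Longrightarrow> wf_ty (gnds L) A"
  using cl_wf by fastforce

lemma cl_Mem_over: "p ||- Mem s X \<Longrightarrow> cl X (Pw A) \<Longrightarrow> over p s A"
  by (auto simp: closed_of_def intro: forces_Mem_over)

lemma forces_conjs: "p ||- conjs \<alpha>s \<longleftrightarrow> stage p \<and> (\<forall>\<alpha>\<in>set \<alpha>s. p ||- \<alpha>)"
  by (induction \<alpha>s rule: conjs.induct) (auto simp: forces_conj forces_tt dest: forces_stage)

lemma forces_exsI:
  assumes "formula L \<gamma>" and "list_all2 (\<lambda>s x. over p s (snd x)) ss xs" and "env p \<sigma> (fv \<gamma> - set xs)"
    and "p ||- inst [] (upd \<sigma> xs ss) \<gamma> 0"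
  shows "p ||- inst [] \<sigma> (foldr ex xs \<gamma>) 0"
  using assms(2-)
proof (induction ss xs arbitrary: \<sigma> rule: list_all2_induct)
  case (Cons s ss x xs)
  have "\<forall>y\<in>set xs. wf_ty (gnds L) (snd y)"
    using Cons(2) over_wf by (metis in_set_conv_nth list_all2_conv_all_nth)
  then have "formula L (foldr ex xs \<gamma>)" using assms(1) by (intro has_ty_exs)
  moreover have "p ||- inst [] (\<sigma>(x := s)) (foldr ex xs \<gamma>) 0"
    using Cons.prems Cons(1) by (intro Cons.IH) (auto simp: env_def fun_upd_def)
  ultimately show ?case using Cons(1) Cons.prems(1) by (auto intro!: forces_exI simp: env_def)
qed simp

lemma forces_exsE:
  assumes "formula L \<gamma>" and "\<forall>x\<in>set xs. wf_ty (gnds L) (snd x)" and "env p \<sigma> (fv \<gamma> - set xs)"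
    and "p ||- inst [] \<sigma> (foldr ex xs \<gamma>) 0" and "over p \<beta> Om"
    and "\<And>q ss. p \<preceq> q \<Longrightarrow> list_all2 (\<lambda>s x. over q s (snd x)) ss xs \<Longrightarrow>
       q ||- inst [] (upd \<sigma> xs ss) \<gamma> 0 \<Longrightarrow> q ||- \<beta>"
  shows "p ||- \<beta>"
  using assms(2-)
proof (induction xs arbitrary: p \<sigma>)
  case Nil
  then show ?case using Nil.prems(5)[of p "[]"] by (auto intro: le_refl forces_stage)
next
  case (Cons x xs)
  have *: "p ||- inst [] \<sigma> (ex x (foldr ex xs \<gamma>)) 0" using Cons.prems(3) by simp
  show ?case
  proof (rule forces_exE[OF *])
    show "formula L (foldr ex xs \<gamma>)" using assms(1) Cons.prems(1) by (intro has_ty_exs) auto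
    show "env p \<sigma> (fv (foldr ex xs \<gamma>) - {x})" using Cons.prems(2) by (auto simp: env_def)
    fix q s assume q: "p \<preceq> q" and s: "over q s (snd x)" and *: "q ||- inst [] (\<sigma>(x := s)) (foldr ex xs \<gamma>) 0"
    have e: "env q (\<sigma>(x := s)) (fv \<gamma> - set xs)"
      using env_mono[OF Cons.prems(2) q] s by (auto simp: env_def)
    show "q ||- \<beta>"
    proof (rule Cons.IH[OF _ e * over_mono[OF Cons.prems(4) q]])
      fix r ss assume r: "q \<preceq> r" and ss: "list_all2 (\<lambda>s x. over r s (snd x)) ss xs"
        and "r ||- inst [] (upd (\<sigma>(x := s)) xs ss) \<gamma> 0"
      then show "r ||- \<beta>"
        using Cons.prems(5)[of r "s # ss"] le_trans[OF q r] over_mono[OF s r] by simp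
    qed (use Cons.prems in simp)
  qed (use Cons.prems in auto)
qed

section \<open>Sets of values of a term under a condition\<close>

lemma sabs_props:
  fixes xs C \<tau> \<alpha>
  assumes "has_ty L [] \<tau> C" and "formula L \<alpha>" and "\<forall>x\<in>set xs. wf_ty (gnds L) (snd x)"
    and "fv \<tau> \<union> fv \<alpha> \<subseteq> set xs"
  obtains w where "sabs xs C \<tau> \<alpha> = compr w (foldr ex xs (conj (Eq (Fv w) \<tau>) \<alpha>))" "snd w = C"
    "w \<notin> set xs" "formula L (conj (Eq (Fv w) \<tau>) \<alpha>)" "formula L (foldr ex xs (conj (Eq (Fv w) \<tau>) \<alpha>))"
    "fv (foldr ex xs (conj (Eq (Fv w) \<tau>) \<alpha>)) - {w} = {}"
proof
  let ?w = "(fresh C (set xs \<union> fv \<tau> \<union> fv \<alpha>), C)"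
  show "sabs xs C \<tau> \<alpha> = compr ?w (foldr ex xs (conj (Eq (Fv ?w) \<tau>) \<alpha>))"
    by (simp add: sabs_def Let_def)
  show "formula L (conj (Eq (Fv ?w) \<tau>) \<alpha>)" using assms wf_ty_tm by auto
  then show "formula L (foldr ex xs (conj (Eq (Fv ?w) \<tau>) \<alpha>))" using assms(3) by (rule has_ty_exs)
  show "?w \<notin> set xs" using fresh_notin[of "set xs \<union> fv \<tau> \<union> fv \<alpha>" C] by simp
  show "fv (foldr ex xs (conj (Eq (Fv ?w) \<tau>) \<alpha>)) - {?w} = {}" using assms(4) by auto
qed simp

lemma cl_sabs:
  assumes "has_ty L [] \<tau> C" and "formula L \<alpha>" and "\<forall>x\<in>set xs. wf_ty (gnds L) (snd x)"
    and "fv \<tau> \<union> fv \<alpha> \<subseteq> set xs"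
  shows "cl (sabs xs C \<tau> \<alpha>) (Pw C)"
  by (rule sabs_props[OF assms])
    (use assms(1) wf_ty_tm has_ty_compr in \<open>fastforce simp: closed_of_def simp del: fv_exs\<close>)

lemma inst_upd_fresh:
  assumes "w \<notin> set xs"  "w \<notin> fv t" 
  shows "inst [] (upd (\<sigma>(w := r)) xs ss) t 0 = inst [] (upd \<sigma> xs ss) t 0"
  using assms by (intro inst_cong upd_cong[of w]) auto

lemma forces_sabsI:
  assumes ty: "has_ty L [] \<tau> C" "formula L \<alpha>" "\<forall>x\<in>set xs. wf_ty (gnds L) (snd x)"
    "fv \<tau> \<union> fv \<alpha> \<subseteq> set xs"
    and ss: "list_all2 (\<lambda>s x. over p s (snd x)) ss xs"
    and "p ||- inst [] (upd Fv xs ss) \<alpha> 0" and eq: "p ||- Eq r (inst [] (upd Fv xs ss) \<tau> 0)" and r: "over p r C"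
  shows "p ||- Mem r (sabs xs C \<tau> \<alpha>)"
proof (rule sabs_props[OF ty])
  fix w assume w: "sabs xs C \<tau> \<alpha> = compr w (foldr ex xs (conj (Eq (Fv w) \<tau>) \<alpha>))" "snd w = C"
    "w \<notin> set xs" "formula L (conj (Eq (Fv w) \<tau>) \<alpha>)" "formula L (foldr ex xs (conj (Eq (Fv w) \<tau>) \<alpha>))"
    "fv (foldr ex xs (conj (Eq (Fv w) \<tau>) \<alpha>)) - {w} = {}"
  have p: "stage p" using eq by (rule forces_stage)
  have fresh: "w \<notin> fv \<tau>" "w \<notin> fv \<alpha>" using w(3) ty(4) by auto
  have "p ||- inst [] (Fv(w := r)) (foldr ex xs (conj (Eq (Fv w) \<tau>) \<alpha>)) 0"
  proof (rule forces_exsI[OF w(4) ss])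
    show "env p (Fv(w := r)) (fv (conj (Eq (Fv w) \<tau>) \<alpha>) - set xs)"
      using ty(4) p r w(2) by (auto simp: env_def)
    show "p ||- inst [] (upd (Fv(w := r)) xs ss) (conj (Eq (Fv w) \<tau>) \<alpha>) 0"
      using assms(6) eq w(3) fresh by (simp add: forces_conj inst_upd_fresh upd_notin)
  qed
  then have "p ||- Mem r (inst [] Fv (sabs xs C \<tau> \<alpha>) 0)"
    unfolding w(1) using w p r by (subst forces_Mem_compr) (auto simp: env_def)
  then show ?thesis by (simp add: inst_Fv)
qed

text \<open>An elimination rule, since membership hides a block of existentials: the parameters
  \<open>ss\<close> exist at a later stage only.\<close>

lemma forces_sabsE:
  assumes "p ||- Mem r (sabs xs C \<tau> \<alpha>)"
    and ty: "has_ty L [] \<tau> C" "formula L \<alpha>" "\<forall>x\<in>set xs. wf_ty (gnds L) (snd x)"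
    "fv \<tau> \<union> fv \<alpha> \<subseteq> set xs" and \<beta>: "over p \<beta> Om"
    and "\<And>q ss. p \<preceq> q \<Longrightarrow> list_all2 (\<lambda>s x. over q s (snd x)) ss xs \<Longrightarrow>
       q ||- inst [] (upd Fv xs ss) \<alpha> 0 \<Longrightarrow> q ||- Eq r (inst [] (upd Fv xs ss) \<tau> 0) \<Longrightarrow> q ||- \<beta>"
  shows "p ||- \<beta>"
proof (rule sabs_props[OF ty])
  fix w assume w: "sabs xs C \<tau> \<alpha> = compr w (foldr ex xs (conj (Eq (Fv w) \<tau>) \<alpha>))" "snd w = C"
    "w \<notin> set xs" "formula L (conj (Eq (Fv w) \<tau>) \<alpha>)" "formula L (foldr ex xs (conj (Eq (Fv w) \<tau>) \<alpha>))"
    "fv (foldr ex xs (conj (Eq (Fv w) \<tau>) \<alpha>)) - {w} = {}"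
  have p: "stage p" using \<beta> by (rule over_stage)
  have fresh: "w \<notin> fv \<tau>" "w \<notin> fv \<alpha>" using w(3) ty(4) by auto
  have r: "over p r C" using cl_Mem_over[OF assms(1) cl_sabs[OF ty]] .
  have "p ||- Mem r (inst [] Fv (sabs xs C \<tau> \<alpha>) 0)" using assms(1) by (simp add: inst_Fv)
  then have *: "p ||- inst [] (Fv(w := r)) (foldr ex xs (conj (Eq (Fv w) \<tau>) \<alpha>)) 0"
    unfolding w(1) using w p r by (subst (asm) forces_Mem_compr) (auto simp: env_def)
  show ?thesis
  proof (rule forces_exsE[OF w(4) ty(3) _ * \<beta>])
    show "env p (Fv(w := r)) (fv (conj (Eq (Fv w) \<tau>) \<alpha>) - set xs)"
      using ty(4) p r w(2) by (auto simp: env_def)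
    fix q ss assume "p \<preceq> q" "list_all2 (\<lambda>s x. over q s (snd x)) ss xs"
      "q ||- inst [] (upd (Fv(w := r)) xs ss) (conj (Eq (Fv w) \<tau>) \<alpha>) 0"
    then show "q ||- \<beta>" using w(3) fresh
      by (intro assms(7)) (auto simp add: forces_conj inst_upd_fresh upd_notin)
  qed
qed

section \<open>Universes, subsets and power sets\<close>

lemma cl_univ: "wf_ty (gnds L) A \<Longrightarrow> cl (univ A) (Pw A)"
  using has_ty_compr[of L tt "(0, A)"] by (simp add: univ_def closed_of_def)

lemma forces_univ: "wf_ty (gnds L) A \<Longrightarrow> p ||- Mem a (univ A) \<longleftrightarrow> over p a A"
proof
  assume wft: "wf_ty (gnds L) A"
  show "p ||- Mem a (univ A) \<Longrightarrow> over p a A" using cl_univ[OF wft] by (rule cl_Mem_over[rotated])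
  assume a: "over p a A"
  then have "p ||- Mem a (inst [] Fv (univ A) 0)"
    unfolding univ_def using over_stage[OF a] by (subst forces_Mem_compr) (auto simp: env_def forces_tt)
  then show "p ||- Mem a (univ A)" by (simp add: inst_Fv)
qed

lemma subs_props:
  assumes "has_ty L [] s (Pw A)" "has_ty L [] t (Pw A)"
  obtains x where "subs A s t = all x (imp (Mem (Fv x) s) (Mem (Fv x) t))" "snd x = A"
    "x \<notin> fv s" "x \<notin> fv t" "formula L (imp (Mem (Fv x) s) (Mem (Fv x) t))" "wf_ty (gnds L) A"
proof
  let ?x = "(fresh A (fv s \<union> fv t), A)"
  show "subs A s t = all ?x (imp (Mem (Fv ?x) s) (Mem (Fv ?x) t))" by (simp add: subs_def Let_def)
  show "wf_ty (gnds L) A" using wf_ty_tm[OF assms(1)] by simp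
  then show "formula L (imp (Mem (Fv ?x) s) (Mem (Fv ?x) t))" using assms by auto
qed (use fresh_notin[of "fv s \<union> fv t" A] in auto)

lemma has_ty_subs: "has_ty L [] s (Pw A) \<Longrightarrow> has_ty L [] t (Pw A) \<Longrightarrow> formula L (subs A s t)"
  by (metis subs_props has_ty_all)

lemma fv_subs: "has_ty L [] s (Pw A) \<Longrightarrow> has_ty L [] t (Pw A) \<Longrightarrow> fv (subs A s t) = fv s \<union> fv t"
  by (rule subs_props[of s A t]) auto

lemma forces_subs:
  assumes "has_ty L [] s (Pw A)" "has_ty L [] t (Pw A)" "env p \<sigma> (fv s \<union> fv t)"
  shows "p ||- inst [] \<sigma> (subs A s t) 0 \<longleftrightarrow>
    (\<forall>q a. p \<preceq> q \<longrightarrow> q ||- Mem a (inst [] \<sigma> s 0) \<longrightarrow> q ||- Mem a (inst [] \<sigma> t 0))"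
proof (rule subs_props[OF assms(1,2)])
  fix x assume x: "subs A s t = all x (imp (Mem (Fv x) s) (Mem (Fv x) t))" "snd x = A"
    "x \<notin> fv s" "x \<notin> fv t" "formula L (imp (Mem (Fv x) s) (Mem (Fv x) t))" "wf_ty (gnds L) A"
  have e: "env q \<sigma> (fv (imp (Mem (Fv x) s) (Mem (Fv x) t)) - {x})" if "p \<preceq> q" for q
    using env_mono[OF assms(3) that] by (auto simp: env_def)
  have id: "inst [] (\<sigma>(x := a)) s 0 = inst [] \<sigma> s 0" "inst [] (\<sigma>(x := a)) t 0 = inst [] \<sigma> t 0" for a
    using x(3,4) by (auto intro!: inst_cong)
  have p: "p \<preceq> p" using assms(3) by (simp add: env_def le_refl)
  have ty: "over q (inst [] \<sigma> s 0) (Pw A)" "over q (inst [] \<sigma> t 0) (Pw A)" if "p \<preceq> q" for q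
    using assms env_mono[OF assms(3) that] by (auto intro!: over_inst elim: env_subset)
  show ?thesis
  proof (intro iffI allI impI)
    fix q a assume *: "p ||- inst [] \<sigma> (subs A s t) 0" and q: "p \<preceq> q" and a: "q ||- Mem a (inst [] \<sigma> s 0)"
    have a': "over q a A" using a over_ty[OF ty(1)[OF q]] by (rule forces_Mem_over)
    have "q ||- inst [] (\<sigma>(x := a)) (imp (Mem (Fv x) s) (Mem (Fv x) t)) 0"
      using forces_mono[OF * q] x(2) a' unfolding x(1) by (intro forces_allD[OF _ x(5) e[OF q]]) auto
    then show "q ||- Mem a (inst [] \<sigma> t 0)" using a id by (auto dest: forces_impD)
  next
    assume *: "\<forall>q a. p \<preceq> q \<longrightarrow> q ||- Mem a (inst [] \<sigma> s 0) \<longrightarrow> q ||- Mem a (inst [] \<sigma> t 0)"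
    show "p ||- inst [] \<sigma> (subs A s t) 0" unfolding x(1)
    proof (rule forces_allI[OF x(5) _ e[OF p]])
      fix q a assume q: "p \<preceq> q" and a: "over q a (snd x)"
      have "q ||- imp (Mem a (inst [] \<sigma> s 0)) (Mem a (inst [] \<sigma> t 0))"
        using ty[OF q] a x(2) * by (intro forces_impI) (auto intro: over_Mem le_trans[OF q])
      then show "q ||- inst [] (\<sigma>(x := a)) (imp (Mem (Fv x) s) (Mem (Fv x) t)) 0" using id by simp
    qed (use x in auto)
  qed
qed

lemma cl_powset: "cl X (Pw A) \<Longrightarrow> cl (powset A X) (Pw (Pw A))"
  using has_ty_compr[of L "subs A (Fv (0, Pw A)) X" "(0, Pw A)"] cl_wf[of X "Pw A"]
    has_ty_subs[of "Fv (0, Pw A)" A X]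
  by (simp add: powset_def closed_of_def fv_subs)

lemma forces_powset:
  assumes "cl X (Pw A)"
  shows "p ||- Mem s (powset A X) \<longleftrightarrow> over p s (Pw A) \<and> (\<forall>q a. p \<preceq> q \<longrightarrow> q ||- Mem a s \<longrightarrow> q ||- Mem a X)"
proof (cases "over p s (Pw A)")
  case True
  let ?u = "(0, Pw A)"
  have wft: "wf_ty (gnds L) (Pw A)" using assms by (rule cl_wf)
  have ty: "has_ty L [] (Fv ?u) (Pw A)" "has_ty L [] X (Pw A)" using wft assms by (auto simp: closed_of_def)
  have f: "formula L (subs A (Fv ?u) X)" using ty by (rule has_ty_subs)
  have "p ||- Mem s (inst [] Fv (powset A X) 0) \<longleftrightarrow> p ||- inst [] (Fv(?u := s)) (subs A (Fv ?u) X) 0"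
    unfolding powset_def using True over_stage[OF True] f fv_subs[OF ty] cl_fv[OF assms]
    by (intro forces_Mem_compr) (auto simp: env_def)
  also have "\<dots> \<longleftrightarrow> (\<forall>q a. p \<preceq> q \<longrightarrow> q ||- Mem a s \<longrightarrow> q ||- Mem a X)"
    using True over_stage[OF True] cl_fv[OF assms] inst_cl[OF assms] by (subst forces_subs[OF ty]) (auto simp: env_def)
  finally show ?thesis using True by (simp add: inst_Fv)
next
  case False
  then show ?thesis using cl_Mem_over[OF _ cl_powset[OF assms]] by blast
qed

section \<open>Finite products and their projections\<close>

lemma list_all2_vars:
  "list_all2 (\<lambda>s x. over p s (snd x)) ss (vars As) \<longleftrightarrow> list_all2 (over p) ss As"
  by (auto simp: list_all2_conv_all_nth vars_nth)

lemma upd_vars: "list_all2 (over p) ss As \<Longrightarrow> i < length As \<Longrightarrow> upd Fv (vars As) ss (i, As ! i) = ss ! i"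
  using upd_nth[of "vars As" ss i Fv] by (auto simp: distinct_vars vars_nth dest: list_all2_lengthD)

lemma map_upd_vars: "list_all2 (over p) ss As \<Longrightarrow> map (upd Fv (vars As) ss) (vars As) = ss"
  by (rule nth_equalityI) (auto simp: vars_nth upd_vars dest: list_all2_lengthD)

definition cls_list where "cls_list Xs As \<longleftrightarrow> list_all2 (\<lambda>X A. cl X (Pw A)) Xs As"

lemma mems_props:
  assumes "cls_list Xs As"
  shows "formula L (mems As Xs)" "fv (mems As Xs) \<subseteq> set (vars As)"
    "list_all2 (over p) ss As \<Longrightarrow> p ||- inst [] (upd Fv (vars As) ss) (mems As Xs) 0 \<longleftrightarrow>
       stage p \<and> (\<forall>i<length As. p ||- Mem (ss ! i) (Xs ! i))"
proof -
  have len: "length Xs = length As" using assms by (auto simp: cls_list_def dest: list_all2_lengthD)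
  have X: "cl (Xs ! i) (Pw (As ! i))" if "i < length As" for i
    using assms that by (auto simp: cls_list_def list_all2_conv_all_nth)
  have set: "set (zip (vars As) Xs) = {((i, As ! i), Xs ! i) | i. i < length As}"
    using len by (force simp: set_zip vars_nth)
  show "formula L (mems As Xs)" unfolding mems_def
    using X[THEN cl_ty] X[THEN cl_wf_Pw] by (intro has_ty_conjs) (auto simp: set)
  show "fv (mems As Xs) \<subseteq> set (vars As)" using X[THEN cl_fv] by (auto simp: mems_def set set_vars)
  assume ss: "list_all2 (over p) ss As"
  have "map (\<lambda>\<alpha>. inst [] (upd Fv (vars As) ss) \<alpha> 0) (map2 (\<lambda>x X. Mem (Fv x) X) (vars As) Xs)
     = map (\<lambda>i. Mem (ss ! i) (Xs ! i)) [0..<length As]"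
    using len inst_cl[OF X] upd_vars[OF ss] by (intro nth_equalityI) (auto simp: vars_nth)
  then show "p ||- inst [] (upd Fv (vars As) ss) (mems As Xs) 0 \<longleftrightarrow>
       stage p \<and> (\<forall>i<length As. p ||- Mem (ss ! i) (Xs ! i))"
    unfolding mems_def inst_conjs by (auto simp: forces_conjs)
qed

lemma cls_list_wf: "cls_list Xs As \<Longrightarrow> i < length As \<Longrightarrow> wf_ty (gnds L) (As ! i)"
  by (auto simp: cls_list_def list_all2_conv_all_nth dest: cl_wf_Pw)

lemma tup_vars_ty:
  assumes "cls_list Xs As" "length As \<noteq> 1"
  shows "has_ty L [] (Tup (map Fv (vars As))) (Prod As)" "\<forall>x\<in>set (vars As). wf_ty (gnds L) (snd x)"
  using assms cls_list_wf[OF assms(1)] by (auto simp: list_all2_conv_all_nth vars_nth set_vars)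

lemma prodset_ty:
  assumes "cls_list Xs As" "length As \<noteq> 1"
  shows "has_ty L [] (Tup (map Fv (vars As))) (Prod As)" "formula L (mems As Xs)"
    "\<forall>x\<in>set (vars As). wf_ty (gnds L) (snd x)"
    "fv (Tup (map Fv (vars As))) \<union> fv (mems As Xs) \<subseteq> set (vars As)"
  using tup_vars_ty[OF assms] mems_props[OF assms(1)] by auto

lemma cl_prodset: "cls_list Xs As \<Longrightarrow> length As \<noteq> 1 \<Longrightarrow> cl (prodset As Xs) (Pw (Prod As))"
  unfolding prodset_def by (intro cl_sabs prodset_ty)

text \<open>Projections turn the existential definition into a condition without quantifiers,
  checked at the same stage: an element equal to a tuple has the right projections, and by
  surjective pairing the projections of \<open>r\<close> are themselves the witnesses.\<close>

lemma forces_prodset: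
  assumes "cls_list Xs As" "length As \<noteq> 1"
  shows "p ||- Mem r (prodset As Xs) \<longleftrightarrow> over p r (Prod As) \<and> (\<forall>i<length As. p ||- Mem (Pr As i r) (Xs ! i))"
proof (intro iffI conjI allI impI)
  assume r: "p ||- Mem r (prodset As Xs)"
  show r': "over p r (Prod As)" using r cl_prodset[OF assms] by (rule cl_Mem_over)
  fix i assume i: "i < length As"
  have X: "cl (Xs ! i) (Pw (As ! i))" using assms i by (auto simp: cls_list_def list_all2_conv_all_nth)
  show "p ||- Mem (Pr As i r) (Xs ! i)"
  proof (rule forces_sabsE[OF r[unfolded prodset_def] prodset_ty[OF assms]])
    show "over p (Mem (Pr As i r) (Xs ! i)) Om"
      using r' i X cl_over[OF X over_stage[OF r']] by (auto intro!: over_Mem over_Pr)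
    fix q ss assume q: "p \<preceq> q" and ss: "list_all2 (\<lambda>s x. over q s (snd x)) ss (vars As)"
      and m: "q ||- inst [] (upd Fv (vars As) ss) (mems As Xs) 0"
      and e: "q ||- Eq r (inst [] (upd Fv (vars As) ss) (Tup (map Fv (vars As))) 0)"
    note ss = ss[unfolded list_all2_vars]
    have "q ||- Eq r (Tup ss)" using e map_upd_vars[OF ss] by (simp add: o_def)
    then have "q ||- Eq (Pr As i r) (Pr As i (Tup ss))" using over_mono[OF r' q] i by (rule forces_Pr_cong)
    then have "q ||- Eq (Pr As i r) (ss ! i)" using forces_Pr_Tup[OF ss assms(2) i] by (rule forces_trans)
    moreover have "q ||- Mem (ss ! i) (Xs ! i)" using m mems_props(3)[OF assms(1) ss] i by simp
    ultimately show "q ||- Mem (Pr As i r) (Xs ! i)" by (blast intro: forces_Mem_eq forces_sym)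
  qed
next
  assume r: "over p r (Prod As) \<and> (\<forall>i<length As. p ||- Mem (Pr As i r) (Xs ! i))"
  let ?ss = "map (\<lambda>i. Pr As i r) [0..<length As]"
  have ss: "list_all2 (over p) ?ss As" using r by (auto simp: list_all2_conv_all_nth intro: over_Pr)
  show "p ||- Mem r (prodset As Xs)" unfolding prodset_def
  proof (rule forces_sabsI[OF prodset_ty[OF assms]])
    show "list_all2 (\<lambda>s x. over p s (snd x)) ?ss (vars As)" using ss by (simp add: list_all2_vars)
    show "p ||- inst [] (upd Fv (vars As) ?ss) (mems As Xs) 0"
      using mems_props(3)[OF assms(1) ss] r over_stage[of p r "Prod As"] by auto
    show "p ||- Eq r (inst [] (upd Fv (vars As) ?ss) (Tup (map Fv (vars As))) 0)"
      using map_upd_vars[OF ss] forces_eta[of p r As] r by (simp add: o_def)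
  qed (use r in simp)
qed

lemma proj_graph_ty:
  assumes "cls_list Xs As" "length As \<noteq> 1" "i < length As"
  shows "has_ty L [] (Tup [Tup (map Fv (vars As)), Fv (vars As ! i)]) (Prod [Prod As, As ! i])"
    "fv (Tup [Tup (map Fv (vars As)), Fv (vars As ! i)]) \<union> fv (mems As Xs) \<subseteq> set (vars As)"
  using prodset_ty[OF assms(1,2)] assms(3) cls_list_wf[OF assms(1,3)] vars_nth[OF assms(3)]
  by (auto simp: set_vars)

lemma cl_proj_graph:
  "cls_list Xs As \<Longrightarrow> length As \<noteq> 1 \<Longrightarrow> i < length As \<Longrightarrow> cl (proj_graph As Xs i) (Pw (Prod [Prod As, As ! i]))"
  unfolding proj_graph_def by (intro cl_sabs proj_graph_ty prodset_ty)

lemma forces_proj_graph: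
  assumes "cls_list Xs As" "length As \<noteq> 1" "i < length As"
  shows "p ||- Mem (Tup [r, t]) (proj_graph As Xs i) \<longleftrightarrow> p ||- Mem r (prodset As Xs) \<and> p ||- Eq t (Pr As i r)"
proof
  assume m: "p ||- Mem (Tup [r, t]) (proj_graph As Xs i)"
  have "over p (Tup [r, t]) (Prod [Prod As, As ! i])" using m cl_proj_graph[OF assms] by (rule cl_Mem_over)
  then have rt: "over p r (Prod As)" "over p t (As ! i)" by (auto simp: over_def)
  have "p ||- conj (Mem r (prodset As Xs)) (Eq t (Pr As i r))"
  proof (rule forces_sabsE[OF m[unfolded proj_graph_def] proj_graph_ty(1)[OF assms] _ _ proj_graph_ty(2)[OF assms]])
    show "over p (conj (Mem r (prodset As Xs)) (Eq t (Pr As i r))) Om"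
      using rt assms(3) cl_over[OF cl_prodset[OF assms(1,2)] over_stage[OF rt(1)]]
      by (auto simp: over_conj intro!: over_Mem over_Eq over_Pr)
    fix q ss assume q: "p \<preceq> q" and ss: "list_all2 (\<lambda>s x. over q s (snd x)) ss (vars As)"
      and m: "q ||- inst [] (upd Fv (vars As) ss) (mems As Xs) 0"
      and e: "q ||- Eq (Tup [r, t]) (inst [] (upd Fv (vars As) ss) (Tup [Tup (map Fv (vars As)), Fv (vars As ! i)]) 0)"
    note ss = ss[unfolded list_all2_vars]
    note r = over_mono[OF rt(1) q]
    have e: "q ||- Eq r (Tup ss)" "q ||- Eq t (ss ! i)"
      using e map_upd_vars[OF ss] upd_vars[OF ss assms(3)] vars_nth[OF assms(3)]
      by (auto simp add: o_def dest: forces_Eq_Tup2D)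
    have pr: "q ||- Eq (Pr As j r) (ss ! j)" if "j < length As" for j
      using forces_Pr_cong[OF e(1) r that] forces_Pr_Tup[OF ss assms(2) that] by (rule forces_trans)
    have "q ||- Mem r (prodset As Xs)"
      using r mems_props(3)[OF assms(1) ss] m pr unfolding forces_prodset[OF assms(1,2)]
      by (blast intro: forces_Mem_eq forces_sym)
    then show "q ||- conj (Mem r (prodset As Xs)) (Eq t (Pr As i r))"
      unfolding forces_conj using e(2) pr[OF assms(3)] by (blast intro: forces_trans forces_sym)
  qed (use prodset_ty[OF assms(1,2)] in auto)
  then show "p ||- Mem r (prodset As Xs) \<and> p ||- Eq t (Pr As i r)" by (simp add: forces_conj)
next
  assume a: "p ||- Mem r (prodset As Xs) \<and> p ||- Eq t (Pr As i r)"
  then have r: "over p r (Prod As)" and rX: "\<forall>i<length As. p ||- Mem (Pr As i r) (Xs ! i)"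
    by (auto simp: forces_prodset[OF assms(1,2)])
  have t: "over p t (As ! i)" using a r assms(3) by (auto intro: forces_Eq_over' over_Pr)
  let ?ss = "map (\<lambda>i. Pr As i r) [0..<length As]"
  have ss: "list_all2 (over p) ?ss As" using r by (auto simp: list_all2_conv_all_nth intro: over_Pr)
  show "p ||- Mem (Tup [r, t]) (proj_graph As Xs i)" unfolding proj_graph_def
  proof (rule forces_sabsI[OF proj_graph_ty(1)[OF assms] _ _ proj_graph_ty(2)[OF assms]])
    show "list_all2 (\<lambda>s x. over p s (snd x)) ?ss (vars As)" using ss by (simp add: list_all2_vars)
    show "p ||- inst [] (upd Fv (vars As) ?ss) (mems As Xs) 0"
      using mems_props(3)[OF assms(1) ss] rX over_stage[OF r] by simp
    show "p ||- Eq (Tup [r, t]) (inst [] (upd Fv (vars As) ?ss) (Tup [Tup (map Fv (vars As)), Fv (vars As ! i)]) 0)"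
      using map_upd_vars[OF ss] upd_vars[OF ss assms(3)] forces_eta[OF r] a assms(3)
      by (simp add: o_def vars_nth forces_Eq_Tup2I)
    show "over p (Tup [r, t]) (Prod [Prod As, As ! i])" using r t by (rule over_Tup2)
  qed (use prodset_ty[OF assms(1,2)] in auto)
qed

section \<open>Congruence of instantiation\<close>

lemma over_inst_list:
  assumes "has_ty L Bs t A" and "list_all2 (over p) \<tau>s Bs" and "env p \<sigma> (fv t)"
  shows "over p (inst \<tau>s \<sigma> t 0) A"
proof -
  have "list_all2 (has_ty L []) \<tau>s Bs" using assms(2) by (auto simp: over_def elim: list_all2_mono)
  moreover have "fv \<tau> \<subseteq> FV p" if "\<tau> \<in> set \<tau>s" for \<tau>
    using assms(2) that by (auto simp: over_def list_all2_conv_all_nth in_set_conv_nth)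
  ultimately show ?thesis
    using assms fv_inst[of \<tau>s \<sigma> t 0] has_ty_inst[OF assms(1), of "[]" Bs 0 \<tau>s \<sigma>]
    by (fastforce simp: over_def env_def)
qed

text \<open>Equals may be replaced under binders as well. In the case of a comprehension,
  extensionality supplies an element \<open>a\<close> at a later stage \<open>q\<close>, and the
  induction hypothesis is applied at \<open>q\<close> to the lists extended by \<open>a\<close>;
  hence the stage is generalized.\<close>

lemma forces_inst_cong:
  assumes "has_ty L Bs t A"
    and "list_all2 (over p) \<tau>s Bs" "list_all2 (over p) \<tau>s' Bs" "env p \<sigma> (fv t)" "env p \<sigma>' (fv t)"
    and "\<forall>i<length Bs. p ||- Eq (\<tau>s ! i) (\<tau>s' ! i)" "\<forall>x\<in>fv t. p ||- Eq (\<sigma> x) (\<sigma>' x)"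
  shows "p ||- Eq (inst \<tau>s \<sigma> t 0) (inst \<tau>s' \<sigma>' t 0)"
  using assms
proof (induction arbitrary: p \<tau>s \<tau>s' rule: has_ty.induct)
  case (2 i Bs)
  then show ?case by (auto dest!: list_all2_lengthD)
next
  case (3 h Bs t)
  have "over p (inst \<tau>s \<sigma> t 0) (fdom L h)" using 3 by (intro over_inst_list) auto
  then show ?case using 3 by (auto intro!: forces_Fn_cong)
next
  case (4 ts Bs As)
  have sub: "env p \<sigma> (fv (ts ! i))" "env p \<sigma>' (fv (ts ! i))" "\<forall>x\<in>fv (ts ! i). p ||- Eq (\<sigma> x) (\<sigma>' x)"
    if "i < length ts" for i
    using 4(5,6,8) nth_mem[OF that] by (auto simp: env_def)
  have "has_ty L Bs (Tup ts) (Prod As)" using 4 by (auto elim: list_all2_mono)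
  then have "over p (inst \<tau>s \<sigma> (Tup ts) 0) (Prod As)" using 4 by (intro over_inst_list) auto
  moreover have "list_all2 (\<lambda>s t. p ||- Eq s t) (map (\<lambda>t. inst \<tau>s \<sigma> t 0) ts) (map (\<lambda>t. inst \<tau>s' \<sigma>' t 0) ts)"
    using 4 sub by (auto simp: list_all2_conv_all_nth)
  ultimately show ?case by (auto intro: forces_Tup_cong)
next
  case (5 Bs t As i)
  have "over p (inst \<tau>s \<sigma> t 0) (Prod As)" using 5 by (intro over_inst_list) auto
  then show ?case using 5 by (auto intro!: forces_Pr_cong)
next
  case (6 A Bs t)
  have ty: "has_ty L Bs (Cm A t) (Pw A)" using 6 by simp
  have c: "over p (inst \<tau>s \<sigma> (Cm A t) 0) (Pw A)" "over p (inst \<tau>s' \<sigma>' (Cm A t) 0) (Pw A)"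
    using 6 ty by (auto intro!: over_inst_list simp del: inst.simps)
  have *: "q ||- Mem a (inst \<omega>s \<rho> (Cm A t) 0) \<longleftrightarrow> q ||- inst (a # \<omega>s) \<rho> t 0"
    if "p \<preceq> q" "over q a A" "list_all2 (over p) \<omega>s Bs" "env p \<rho> (fv t)" "over p (inst \<omega>s \<rho> (Cm A t) 0) (Pw A)" for q a \<omega>s \<rho>
  proof -
    have "\<exists>A. has_ty L [] \<tau> A" if "\<tau> \<in> set \<omega>s" for \<tau>
      using \<open>list_all2 (over p) \<omega>s Bs\<close> that by (auto simp: over_def list_all2_conv_all_nth in_set_conv_nth)
    moreover have "\<exists>A. has_ty L [] (\<rho> x) A" if "x \<in> fv t" for x
      using \<open>env p \<rho> (fv t)\<close> that by (auto simp: over_def env_def)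
    ultimately have "inst [a] Fv (inst \<omega>s \<rho> t (Suc 0)) 0 = inst (a # \<omega>s) \<rho> t 0" by (rule inst_open)
    then show ?thesis
      using forces_Mem_Cm_iff[OF that(2), of "inst \<omega>s \<rho> t (Suc 0)"] over_mono[OF that(5,1)] by simp
  qed
  have IH: "q ||- Eq (inst (a # \<tau>s) \<sigma> t 0) (inst (a # \<tau>s') \<sigma>' t 0)" if q: "p \<preceq> q" and a: "over q a A" for q a
  proof (rule "6.IH")
    show "list_all2 (over q) (a # \<tau>s) (A # Bs)" "list_all2 (over q) (a # \<tau>s') (A # Bs)"
      using 6 q a by (auto elim!: list_all2_mono intro: over_mono)
    show "\<forall>i<length (A # Bs). q ||- Eq ((a # \<tau>s) ! i) ((a # \<tau>s') ! i)"
      using 6(8) a forces_mono[OF _ q] by (auto simp: nth_Cons' intro: forces_refl)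
    show "\<forall>x\<in>fv t. q ||- Eq (\<sigma> x) (\<sigma>' x)" using 6(9) forces_mono[OF _ q] by simp
  qed (use 6 env_mono[OF _ q] in auto)
  show ?case
  proof (rule forces_Eq_PwI[OF c])
    fix q a assume q: "p \<preceq> q" "over q a A"
    note ** = *[OF q 6(4) _ c(1)] *[OF q 6(5) _ c(2)]
    show "q ||- Mem a (inst \<tau>s \<sigma> (Cm A t) 0) \<Longrightarrow> q ||- Mem a (inst \<tau>s' \<sigma>' (Cm A t) 0)"
      using ** 6(6,7) forces_Eq_OmD[OF IH[OF q]] by simp
    show "q ||- Mem a (inst \<tau>s' \<sigma>' (Cm A t) 0) \<Longrightarrow> q ||- Mem a (inst \<tau>s \<sigma> (Cm A t) 0)"
      using ** 6(6,7) forces_Eq_OmD[OF forces_sym[OF IH[OF q]]] by simp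
  qed
next
  case (7 Bs s A t)
  have e: "env p \<sigma> (fv s)" "env p \<sigma> (fv t)" "env p \<sigma>' (fv s)" "env p \<sigma>' (fv t)"
    using 7 by (auto simp: env_def)
  have IH: "p ||- Eq (inst \<tau>s \<sigma> s 0) (inst \<tau>s' \<sigma>' s 0)" "p ||- Eq (inst \<tau>s \<sigma> t 0) (inst \<tau>s' \<sigma>' t 0)"
    using 7 e by auto
  have ty: "has_ty L Bs (Eq s t) Om" using 7 by auto
  show ?case
  proof (rule forces_Eq_OmI)
    show "over p (inst \<tau>s \<sigma> (Eq s t) 0) Om" "over p (inst \<tau>s' \<sigma>' (Eq s t) 0) Om"
      using 7 ty by (auto intro!: over_inst_list simp del: inst.simps)
  next
    fix q assume q: "p \<preceq> q"
    note IH' = forces_mono[OF IH(1) q] forces_mono[OF IH(2) q]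
    show "q ||- inst \<tau>s \<sigma> (Eq s t) 0 \<Longrightarrow> q ||- inst \<tau>s' \<sigma>' (Eq s t) 0"
      using forces_Eq_cong[OF IH'] by simp
    show "q ||- inst \<tau>s' \<sigma>' (Eq s t) 0 \<Longrightarrow> q ||- inst \<tau>s \<sigma> (Eq s t) 0"
      using forces_Eq_cong[OF IH'[THEN forces_sym]] by simp
  qed
next
  case (8 Bs s A t)
  have e: "env p \<sigma> (fv s)" "env p \<sigma> (fv t)" "env p \<sigma>' (fv s)" "env p \<sigma>' (fv t)"
    using 8 by (auto simp: env_def)
  have IH: "p ||- Eq (inst \<tau>s \<sigma> s 0) (inst \<tau>s' \<sigma>' s 0)" "p ||- Eq (inst \<tau>s \<sigma> t 0) (inst \<tau>s' \<sigma>' t 0)"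
    using 8 e by auto
  have ty: "has_ty L Bs (Mem s t) Om" using 8 by auto
  show ?case
  proof (rule forces_Eq_OmI)
    show "over p (inst \<tau>s \<sigma> (Mem s t) 0) Om" "over p (inst \<tau>s' \<sigma>' (Mem s t) 0) Om"
      using 8 ty by (auto intro!: over_inst_list simp del: inst.simps)
  next
    fix q assume q: "p \<preceq> q"
    note IH' = forces_mono[OF IH(1) q] forces_mono[OF IH(2) q]
    show "q ||- inst \<tau>s \<sigma> (Mem s t) 0 \<Longrightarrow> q ||- inst \<tau>s' \<sigma>' (Mem s t) 0"
      using forces_Mem_cong[OF IH'] by simp
    show "q ||- inst \<tau>s' \<sigma>' (Mem s t) 0 \<Longrightarrow> q ||- inst \<tau>s \<sigma> (Mem s t) 0"
      using forces_Mem_cong[OF IH'[THEN forces_sym]] by simp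
  qed
qed simp

lemma forces_inst1_cong:
  assumes "has_ty L [] t B" "fv t \<subseteq> {x}" "p ||- Eq a b" "over p a (snd x)"
  shows "p ||- Eq (inst1 x a t) (inst1 x b t)"
  using assms forces_Eq_over[OF assms(3,4)] forces_stage[OF assms(3)]
  by (intro forces_inst_cong[OF assms(1)]) (auto simp: env_def)

lemma over_inst1: "has_ty L [] t B \<Longrightarrow> fv t \<subseteq> {x} \<Longrightarrow> over p a (snd x) \<Longrightarrow> over p (inst1 x a t) B"
  by (intro over_inst) (auto simp: env_def dest: over_stage)

section \<open>Functional relations\<close>

lemma stage_empty: "stage {}"
  by (simp add: stage_def)

lemma forces_empty: "fv \<alpha> = {} \<Longrightarrow> derives L S {} \<alpha> \<longleftrightarrow> {} ||- \<alpha>"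
  by (auto simp: forces_def over_def stage_empty dest: derives_wf)

lemma empty_le: "stage p \<Longrightarrow> {} \<preceq> p"
  by (simp add: le_def)

lemma cls_mem: "X' \<in> cls L S X \<longleftrightarrow> (\<exists>A. cl X' (Pw A)) \<and> derives L S {} (Eq X X')"
  by (simp add: cls_def)

lemma derives_Eq_cl: "cl X A \<Longrightarrow> cl Y B \<Longrightarrow> derives L S {} (Eq X Y) \<longleftrightarrow> {} ||- Eq X Y"
  by (rule forces_empty) (simp add: closed_of_def)

lemma cls_eq_iff:
  assumes "cl X (Pw A)" "cl Y (Pw B)"
  shows "cls L S X = cls L S Y \<longleftrightarrow> {} ||- Eq X Y"
proof
  assume "cls L S X = cls L S Y"
  moreover have "Y \<in> cls L S Y"
    using assms derives_Eq_cl[OF assms(2,2)] forces_refl[OF cl_over[OF assms(2) stage_empty]] by (auto simp: cls_mem)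
  ultimately show "{} ||- Eq X Y" using derives_Eq_cl[OF assms] by (auto simp: cls_mem)
next
  assume e: "{} ||- Eq X Y"
  then show "cls L S X = cls L S Y"
    using assms derives_Eq_cl forces_trans[OF e] forces_trans[OF forces_sym[OF e]] by (auto simp: cls_mem)
qed

lemma cls_eqI:
  assumes "cl X (Pw A)" "cl Y (Pw A)" "\<And>p a. over p a A \<Longrightarrow> p ||- Mem a X \<Longrightarrow> p ||- Mem a Y"
    "\<And>p a. over p a A \<Longrightarrow> p ||- Mem a Y \<Longrightarrow> p ||- Mem a X"
  shows "cls L S X = cls L S Y"
  unfolding cls_eq_iff[OF assms(1,2)] using assms
  by (auto intro!: forces_Eq_PwI cl_over stage_empty)

text \<open>Provably equal terms have the same type, so a class determines the type of the elements
  along with the elements at every stage.\<close>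

lemma cls_eqD:
  assumes "cls L S X = cls L S Y" "cl X (Pw A)" "cl Y (Pw B)"
  shows "B = A" "p ||- Mem a X \<longleftrightarrow> p ||- Mem a Y"
proof -
  have e: "{} ||- Eq X Y" using assms cls_eq_iff by blast
  then have "over {} Y (Pw A)" using cl_over[OF assms(2) stage_empty] by (rule forces_Eq_over)
  then show "B = A" using assms(3) by (auto simp: over_def closed_of_def dest: has_ty_unique)
  have "p ||- Eq X Y" if "stage p" using e empty_le[OF that] by (rule forces_mono)
  then show "p ||- Mem a X \<longleftrightarrow> p ||- Mem a Y"
    by (blast intro: forces_Eq_PwD forces_sym dest: forces_stage)
qed

text \<open>The operations of the topos are defined on chosen representatives; this makes the choice
  harmless.\<close>

lemma rep_cls:
  assumes "cl X (Pw A)"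
  shows "cl (rep (cls L S X)) (Pw A)" "cls L S (rep (cls L S X)) = cls L S X"
    "p ||- Mem a (rep (cls L S X)) \<longleftrightarrow> p ||- Mem a X" "elem_ty L (cls L S X) = A"
proof -
  have "X \<in> cls L S X"
    using assms derives_Eq_cl[OF assms(1,1)] forces_refl[OF cl_over[OF assms(1) stage_empty]] by (auto simp: cls_mem)
  then have r: "rep (cls L S X) \<in> cls L S X" unfolding rep_def by (rule someI)
  then obtain B where B: "cl (rep (cls L S X)) (Pw B)" "{} ||- Eq X (rep (cls L S X))"
    using derives_Eq_cl[OF assms] by (auto simp: cls_mem)
  then show e: "cls L S (rep (cls L S X)) = cls L S X" using cls_eq_iff[OF assms B(1)] by simp
  show c: "cl (rep (cls L S X)) (Pw A)" using cls_eqD(1)[OF e[symmetric] assms B(1)] B(1) by simp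
  show "p ||- Mem a (rep (cls L S X)) \<longleftrightarrow> p ||- Mem a X" using cls_eqD(2)[OF e c assms] .
  show "elem_ty L (cls L S X) = A" unfolding elem_ty_def
    using c by (intro the_equality) (auto simp: closed_of_def dest: has_ty_unique)
qed

text \<open>Totality is stated as an elimination rule because an existential formula forced at a stage need not
  have a witness there.\<close>

definition fun_rel where
  "fun_rel A B F X Y \<longleftrightarrow> cl X (Pw A) \<and> cl Y (Pw B) \<and> cl F (Pw (Prod [A, B])) \<and>
    (\<forall>p s t. p ||- Mem (Tup [s, t]) F \<longrightarrow> p ||- Mem s X \<and> p ||- Mem t Y) \<and>
    (\<forall>p s \<beta>. p ||- Mem s X \<longrightarrow> over p \<beta> Om \<longrightarrow>
       (\<forall>q t. p \<preceq> q \<longrightarrow> q ||- Mem (Tup [s, t]) F \<longrightarrow> q ||- \<beta>) \<longrightarrow> p ||- \<beta>) \<and>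
    (\<forall>p s t t'. p ||- Mem (Tup [s, t]) F \<longrightarrow> p ||- Mem (Tup [s, t']) F \<longrightarrow> p ||- Eq t t')"

lemma fun_rel_cl: "fun_rel A B F X Y \<Longrightarrow> cl X (Pw A)" "fun_rel A B F X Y \<Longrightarrow> cl Y (Pw B)"
  "fun_rel A B F X Y \<Longrightarrow> cl F (Pw (Prod [A, B]))"
  by (simp_all add: fun_rel_def)

lemma fun_rel_dom: "fun_rel A B F X Y \<Longrightarrow> p ||- Mem (Tup [s, t]) F \<Longrightarrow> p ||- Mem s X"
  unfolding fun_rel_def by blast

lemma fun_rel_cod: "fun_rel A B F X Y \<Longrightarrow> p ||- Mem (Tup [s, t]) F \<Longrightarrow> p ||- Mem t Y"
  unfolding fun_rel_def by blast

lemma fun_rel_total: "fun_rel A B F X Y \<Longrightarrow> p ||- Mem s X \<Longrightarrow> over p \<beta> Om \<Longrightarrow>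
  (\<And>q t. p \<preceq> q \<Longrightarrow> q ||- Mem (Tup [s, t]) F \<Longrightarrow> q ||- \<beta>) \<Longrightarrow> p ||- \<beta>"
  unfolding fun_rel_def by blast

lemma fun_rel_unique: "fun_rel A B F X Y \<Longrightarrow> p ||- Mem (Tup [s, t]) F \<Longrightarrow> p ||- Mem (Tup [s, t']) F \<Longrightarrow> p ||- Eq t t'"
  unfolding fun_rel_def by blast

lemma fun_rel_over: "fun_rel A B F X Y \<Longrightarrow> p ||- Mem (Tup [s, t]) F \<Longrightarrow> over p s A \<and> over p t B"
  by (metis fun_rel_cl(1,2) fun_rel_dom fun_rel_cod cl_Mem_over)

section \<open>Equality of relations\<close>

lemma forces_Mem_pair_eq:
  "p ||- Mem (Tup [s, t]) F \<Longrightarrow> p ||- Eq s s' \<Longrightarrow> p ||- Eq t t' \<Longrightarrow> p ||- Mem (Tup [s', t']) F"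
  by (rule forces_Mem_eq[OF forces_Eq_Tup2I])

lemma over_Mem_pair: "cl F (Pw (Prod [A, B])) \<Longrightarrow> over p s A \<Longrightarrow> over p t B \<Longrightarrow> over p (Mem (Tup [s, t]) F) Om"
  by (rule over_Mem[OF over_Tup2 cl_over]) (auto dest: over_stage)

lemma cl_Mem_Tup2_over:
  "p ||- Mem (Tup [s, t]) F \<Longrightarrow> cl F (Pw (Prod [A, B])) \<Longrightarrow> over p s A \<and> over p t B"
  by (drule cl_Mem_over, assumption) (auto simp: over_def)

lemma rel_cls_eqI:
  assumes "cl F (Pw (Prod [A, B]))" "cl G (Pw (Prod [A, B]))"
    "\<And>p s t. p ||- Mem (Tup [s, t]) F \<Longrightarrow> p ||- Mem (Tup [s, t]) G"
    "\<And>p s t. p ||- Mem (Tup [s, t]) G \<Longrightarrow> p ||- Mem (Tup [s, t]) F"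
  shows "cls L S F = cls L S G"
proof (rule cls_eqI[OF assms(1,2)])
  fix p a assume a: "over p a (Prod [A, B])"
  show "p ||- Mem a F \<Longrightarrow> p ||- Mem a G" "p ||- Mem a G \<Longrightarrow> p ||- Mem a F"
    using forces_eta2[OF a] assms(3,4) by (blast intro: forces_Mem_eq forces_sym)+
qed

text \<open>Between functional relations with the same domain and codomain, inclusion is equality:
  if \<open>G\<close> relates \<open>s\<close> to \<open>t\<close>, totality of \<open>F\<close>
  provides some \<open>t'\<close>, which lies in \<open>G\<close> too, so \<open>t' = t\<close> by
  uniqueness in \<open>G\<close>. Most equations between arrows are reduced to an inclusion in this
  way.\<close>

lemma fun_rel_cls_eqI:
  assumes F: "fun_rel A B F X Y" and G: "fun_rel A B G X Y"
    and le: "\<And>p s t. p ||- Mem (Tup [s, t]) F \<Longrightarrow> p ||- Mem (Tup [s, t]) G"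
  shows "cls L S F = cls L S G"
proof (rule rel_cls_eqI[OF fun_rel_cl(3)[OF F] fun_rel_cl(3)[OF G] le])
  fix p s t assume stage: "p ||- Mem (Tup [s, t]) G"
  show "p ||- Mem (Tup [s, t]) F"
  proof (rule fun_rel_total[OF F fun_rel_dom[OF G stage]])
    show "over p (Mem (Tup [s, t]) F) Om"
      using fun_rel_over[OF G stage] fun_rel_cl(3)[OF F] by (blast intro: over_Mem_pair)
    fix q t' assume q: "p \<preceq> q" and stage': "q ||- Mem (Tup [s, t']) F"
    have "q ||- Eq t' t" using fun_rel_unique[OF G le[OF stage'] forces_mono[OF stage q]] .
    then show "q ||- Mem (Tup [s, t]) F"
      using forces_Mem_pair_eq[OF stage'] forces_refl fun_rel_over[OF F stage'] by blast
  qed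
qed

lemma fun_rel_cong:
  assumes "fun_rel A B F X Y" "cl X' (Pw A')" "cl Y' (Pw B')" "cl F' (Pw C)"
    and "cls L S X' = cls L S X" "cls L S Y' = cls L S Y" "cls L S F' = cls L S F"
  shows "fun_rel A B F' X' Y'"
proof -
  note c = fun_rel_cl[OF assms(1)]
  note e = cls_eqD(1)[OF assms(5,2) c(1)] cls_eqD(1)[OF assms(6,3) c(2)] cls_eqD(1)[OF assms(7,4) c(3)]
  note m = cls_eqD(2)[OF assms(5,2) c(1)] cls_eqD(2)[OF assms(6,3) c(2)] cls_eqD(2)[OF assms(7,4) c(3)]
  have c': "cl X' (Pw A)" "cl Y' (Pw B)" "cl F' (Pw (Prod [A, B]))" using assms(2-4) e by simp_all
  show ?thesis using assms(1) unfolding fun_rel_def m by (elim conjE) (intro conjI c'; assumption)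
qed

text \<open>The three clauses of \<open>fun_rel\<close> come out of the formula defining
  \<open>Y^X\<close>: the inclusion in the product gives domain and codomain, and the unique
  existence gives totality and uniqueness.\<close>

lemma forces_expset:
  assumes X: "cl X (Pw A)" and Y: "cl Y (Pw B)" and F: "cl F (Pw (Prod [A, B]))"
  shows "fun_rel A B F X Y \<longleftrightarrow> {} ||- Mem F (expset A B X Y)"
proof -
  define u :: "'g var" where "u = (0, Pw (Prod [A, B]))"
  define x :: "'g var" where "x = (1, A)"
  define y :: "'g var" where "y = (2, B)"
  have ne: "u \<noteq> x" "u \<noteq> y" "x \<noteq> y" "x \<noteq> u" "y \<noteq> u" "y \<noteq> x" by (auto simp: u_def x_def y_def)
  have sn: "snd u = Pw (Prod [A, B])" "snd x = A" "snd y = B" by (auto simp: u_def x_def y_def)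
  have wft: "wf_ty (gnds L) A" "wf_ty (gnds L) B" using X Y by (auto dest: cl_wf_Pw)
  have XY: "cls_list [X, Y] [A, B]" using X Y by (simp add: cls_list_def)
  let ?P = "prodset [A, B] [X, Y]"
  have P: "cl ?P (Pw (Prod [A, B]))" using XY by (rule cl_prodset) simp
  define e1 :: "('g, 'f) tm" where "e1 = conj (Mem (Fv y) Y) (Mem (Tup [Fv x, Fv y]) (Fv u))"
  define e2 :: "('g, 'f) tm" where "e2 = imp (Mem (Fv x) X) (ex1 y e1)"
  define e3 :: "('g, 'f) tm" where "e3 = conj (subs (Prod [A, B]) (Fv u) ?P) (all x e2)"
  have e: "expset A B X Y = compr u e3"
    by (simp add: expset_def e1_def e2_def e3_def u_def x_def y_def Let_def)
  have t1: "formula L e1" unfolding e1_def using sn wft cl_ty[OF Y] by auto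
  have t2: "formula L e2" unfolding e2_def
    using sn wft cl_ty[OF X] t1 by (auto intro!: has_ty_ex1)
  have ut: "has_ty L [] (Fv u) (Pw (Prod [A, B]))" using sn wft by simp
  have t3: "formula L e3" unfolding e3_def
    using sn wft cl_ty[OF P] t2 ut by (auto intro!: has_ty_all has_ty_subs simp del: has_ty_Fv)
  have f1: "fv e1 = {x, y, u}" using cl_fv[OF Y] by (auto simp: e1_def)
  have f2: "fv e2 \<subseteq> {x, u}"
    using cl_fv[OF X] fv_ex1[OF t1, of y] f1 sn wft by (auto simp: e2_def)
  have f3: "fv e3 - {u} = {}"
    using fv_subs[OF ut cl_ty[OF P]] f2 cl_fv[OF P] by (auto simp: e3_def)
  have stage: "stage {}" by (rule stage_empty)
  have Ft: "over p F (Pw (Prod [A, B]))" if "stage p" for p using F that by (rule cl_over)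
  have Xt: "over p X (Pw A)" if "stage p" for p using X that by (rule cl_over)
  have Yt: "over p Y (Pw B)" if "stage p" for p using Y that by (rule cl_over)
  let ?\<sigma> = "Fv(u := F)"
  have "{} ||- Mem F (expset A B X Y) \<longleftrightarrow> {} ||- Mem F (inst [] Fv (compr u e3) 0)" by (simp add: e inst_Fv)
  also have "\<dots> \<longleftrightarrow> {} ||- inst [] ?\<sigma> e3 0"
    using stage Ft[OF stage] t3 f3 sn by (intro forces_Mem_compr) (auto simp: env_def)
  also have "\<dots> \<longleftrightarrow> {} ||- inst [] ?\<sigma> (subs (Prod [A, B]) (Fv u) ?P) 0 \<and> {} ||- inst [] ?\<sigma> (all x e2) 0"
    by (simp add: e3_def forces_conj)
  also have "{} ||- inst [] ?\<sigma> (subs (Prod [A, B]) (Fv u) ?P) 0 \<longleftrightarrow>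
      (\<forall>q a. {} \<preceq> q \<longrightarrow> q ||- Mem a F \<longrightarrow> q ||- Mem a ?P)"
    using stage Ft[OF stage] cl_fv[OF P] sn inst_cl[OF P] by (subst forces_subs[OF ut cl_ty[OF P]]) (auto simp: env_def)
  also have "\<dots> \<longleftrightarrow> (\<forall>p s t. p ||- Mem (Tup [s, t]) F \<longrightarrow> p ||- Mem s X \<and> p ||- Mem t Y)"
  proof (intro iffI allI impI)
    fix p s t assume *: "\<forall>q a. {} \<preceq> q \<longrightarrow> q ||- Mem a F \<longrightarrow> q ||- Mem a ?P" and m: "p ||- Mem (Tup [s, t]) F"
    have "p ||- Mem (Tup [s, t]) ?P" using * m empty_le forces_stage by blast
    then have "p ||- Mem (Pr [A, B] 0 (Tup [s, t])) X" "p ||- Mem (Pr [A, B] (Suc 0) (Tup [s, t])) Y"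
      by (auto simp: forces_prodset[OF XY])
    then show "p ||- Mem s X \<and> p ||- Mem t Y"
      using forces_Pr_Tup2[of p s A t B] cl_Mem_Tup2_over[OF m F] by (auto intro: forces_Mem_eq)
  next
    fix q a assume *: "\<forall>p s t. p ||- Mem (Tup [s, t]) F \<longrightarrow> p ||- Mem s X \<and> p ||- Mem t Y" and m: "q ||- Mem a F"
    have a: "over q a (Prod [A, B])" using m F by (rule cl_Mem_over)
    have "q ||- Mem (Tup [Pr [A, B] 0 a, Pr [A, B] (Suc 0) a]) F" using forces_eta2[OF a] m by (rule forces_Mem_eq)
    then show "q ||- Mem a ?P" using * a by (auto simp: forces_prodset[OF XY] less_Suc_eq)
  qed
  \<comment> \<open>The right-hand side is the elimination rule for unique existence, in which
    \<open>t\<close> is unique among the elements of the stage \<open>q\<close> only.\<close>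
  also have "{} ||- inst [] ?\<sigma> (all x e2) 0 \<longleftrightarrow>
    (\<forall>p s \<beta>. p ||- Mem s X \<longrightarrow> over p \<beta> Om \<longrightarrow>
       (\<forall>q t. p \<preceq> q \<longrightarrow> q ||- Mem t Y \<longrightarrow> q ||- Mem (Tup [s, t]) F \<longrightarrow>
         (\<forall>t'. q ||- Mem t' Y \<longrightarrow> q ||- Mem (Tup [s, t']) F \<longrightarrow> q ||- Eq t t') \<longrightarrow> q ||- \<beta>) \<longrightarrow> p ||- \<beta>)"
    (is "_ \<longleftrightarrow> ?R")
  proof
    assume *: "{} ||- inst [] ?\<sigma> (all x e2) 0"
    show ?R
    proof (intro allI impI)
      fix p s \<beta> assume s: "p ||- Mem s X" and \<beta>: "over p \<beta> Om"
        and **: "\<forall>q t. p \<preceq> q \<longrightarrow> q ||- Mem t Y \<longrightarrow> q ||- Mem (Tup [s, t]) F \<longrightarrow>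
         (\<forall>t'. q ||- Mem t' Y \<longrightarrow> q ||- Mem (Tup [s, t']) F \<longrightarrow> q ||- Eq t t') \<longrightarrow> q ||- \<beta>"
      have p: "stage p" using s by (rule forces_stage)
      have s': "over p s (snd x)" using cl_Mem_over[OF s X] sn by simp
      have env: "env p (?\<sigma>(x := s)) {x, u}" using p Ft[OF p] s' sn ne by (auto simp: env_def)
      have "p ||- inst [] (?\<sigma>(x := s)) e2 0"
        using t2 s' env f2 ne by (intro forces_allD[OF forces_mono[OF * empty_le[OF p]]]) (auto simp: env_def)
      then have ex: "p ||- inst [] (?\<sigma>(x := s)) (ex1 y e1) 0"
        unfolding e2_def using s X by (auto dest: forces_impD)
      show "p ||- \<beta>"
      proof (rule forces_ex1E[OF ex t1 _ _ \<beta>])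
        show "env p (?\<sigma>(x := s)) (fv e1 - {y})" using env f1 by (auto elim: env_subset)
        fix q t assume q: "p \<preceq> q" and "over q t (snd y)"
          and e: "q ||- inst [] (?\<sigma>(x := s, y := t)) e1 0"
          and un: "\<And>t'. over q t' (snd y) \<Longrightarrow> q ||- inst [] (?\<sigma>(x := s, y := t')) e1 0 \<Longrightarrow> q ||- Eq t t'"
        show "q ||- \<beta>"
        proof (rule **[rule_format, OF q])
          show "q ||- Mem t Y" "q ||- Mem (Tup [s, t]) F" using e ne Y by (auto simp: e1_def forces_conj)
          fix t' assume "q ||- Mem t' Y" "q ||- Mem (Tup [s, t']) F"
          then show "q ||- Eq t t'" using ne Y sn cl_Mem_over[of q t' Y B]
            by (intro un) (auto simp: e1_def forces_conj)
        qed
      qed (use sn wft in auto)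
    qed
  next
    assume R: ?R
    show "{} ||- inst [] ?\<sigma> (all x e2) 0"
    proof (rule forces_allI[OF t2])
      show "env {} ?\<sigma> (fv e2 - {x})" using f2 stage Ft[OF stage] sn by (auto simp: env_def)
      fix p s assume p0: "{} \<preceq> p" and s: "over p s (snd x)"
      have p: "stage p" using s by (rule over_stage)
      have env: "env q (?\<sigma>(x := s)) {x, u}" if q: "p \<preceq> q" for q
        using le_stage[OF q] Ft[OF le_stage[OF q]] over_mono[OF s q] sn ne by (auto simp: env_def)
      have fvex: "fv (ex1 y e1) \<subseteq> {x, u}" using fv_ex1[OF t1, of y] f1 sn wft by auto
      have ext: "over q (inst [] (?\<sigma>(x := s)) (ex1 y e1) 0) Om" if q: "p \<preceq> q" for q
        using t1 sn wft fvex env[OF q] by (intro over_inst has_ty_ex1) (auto elim: env_subset)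
      have "p ||- imp (Mem s X) (inst [] (?\<sigma>(x := s)) (ex1 y e1) 0)"
      proof (rule forces_impI)
        show "over p (Mem s X) Om" using s sn Xt[OF p] by (auto intro: over_Mem)
        show "over p (inst [] (?\<sigma>(x := s)) (ex1 y e1) 0) Om" using ext le_refl[OF p] .
        fix q assume q: "p \<preceq> q" and sX: "q ||- Mem s X"
        show "q ||- inst [] (?\<sigma>(x := s)) (ex1 y e1) 0"
        proof (rule R[rule_format, OF sX ext[OF q]])
          fix r t assume r: "q \<preceq> r" and t: "r ||- Mem t Y" "r ||- Mem (Tup [s, t]) F"
            and un: "\<And>t'. r ||- Mem t' Y \<Longrightarrow> r ||- Mem (Tup [s, t']) F \<Longrightarrow> r ||- Eq t t'"
          have pr: "p \<preceq> r" using q r by (rule le_trans)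
          have t': "over r t (snd y)" using cl_Mem_over[OF t(1) Y] sn by simp
          show "r ||- inst [] (?\<sigma>(x := s)) (ex1 y e1) 0"
          proof (rule forces_ex1I[OF t1 _ t'])
            show "env r (?\<sigma>(x := s)) (fv e1 - {y})" using env[OF pr] f1 by (auto elim: env_subset)
            show "r ||- inst [] (?\<sigma>(x := s, y := t)) e1 0" using t ne Y by (auto simp: e1_def forces_conj)
            fix r' t' assume r': "r \<preceq> r'" and "over r' t' (snd y)"
              and e: "r' ||- inst [] (?\<sigma>(x := s, y := t')) e1 0"
            have t': "r' ||- Mem t' Y" "r' ||- Mem (Tup [s, t']) F" using e ne Y by (auto simp: e1_def forces_conj)
            have tt': "over r' (Eq t t') Om"
              using cl_Mem_over[OF forces_mono[OF t(1) r'] Y] cl_Mem_over[OF t'(1) Y] by (rule over_Eq)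
            \<comment> \<open>Uniqueness of \<open>t\<close> is known at \<open>r\<close> only,
              whereas here it is wanted at the later stage \<open>r'\<close>. A second use of the
              rule at \<open>r'\<close> produces a unique value \<open>w\<close>, and
              \<open>t\<close> and \<open>t'\<close> are both equal to it.\<close>
            show "r' ||- Eq t t'"
            proof (rule R[rule_format, OF forces_mono[OF sX le_trans[OF r r']] tt'])
              fix v w assume v: "r' \<preceq> v"
                and un: "\<And>t'. v ||- Mem t' Y \<Longrightarrow> v ||- Mem (Tup [s, t']) F \<Longrightarrow> v ||- Eq w t'"
              have "v ||- Eq w t" using un forces_mono[OF t(1) le_trans[OF r' v]] forces_mono[OF t(2) le_trans[OF r' v]] by blast
              moreover have "v ||- Eq w t'" using un forces_mono[OF t'(1) v] forces_mono[OF t'(2) v] by blast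
              ultimately show "v ||- Eq t t'" by (blast intro: forces_sym forces_trans)
            qed
          qed
        qed
      qed
      then show "p ||- inst [] (?\<sigma>(x := s)) e2 0" using X by (simp add: e2_def)
    qed (use sn wft in auto)
  qed
  finally have main: "{} ||- Mem F (expset A B X Y) \<longleftrightarrow>
    (\<forall>p s t. p ||- Mem (Tup [s, t]) F \<longrightarrow> p ||- Mem s X \<and> p ||- Mem t Y) \<and> ?R" .
  show ?thesis unfolding main
  proof
    assume f: "fun_rel A B F X Y"
    show "(\<forall>p s t. p ||- Mem (Tup [s, t]) F \<longrightarrow> p ||- Mem s X \<and> p ||- Mem t Y) \<and> ?R"
    proof (intro conjI)
      show ?R
      proof (intro allI impI)
        fix p s \<beta> assume s: "p ||- Mem s X" and \<beta>: "over p \<beta> Om"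
          and *: "\<forall>q t. p \<preceq> q \<longrightarrow> q ||- Mem t Y \<longrightarrow> q ||- Mem (Tup [s, t]) F \<longrightarrow>
            (\<forall>t'. q ||- Mem t' Y \<longrightarrow> q ||- Mem (Tup [s, t']) F \<longrightarrow> q ||- Eq t t') \<longrightarrow> q ||- \<beta>"
        show "p ||- \<beta>"
          using * fun_rel_cod[OF f] fun_rel_unique[OF f] by (intro fun_rel_total[OF f s \<beta>]) blast
      qed
    qed (use fun_rel_dom[OF f] fun_rel_cod[OF f] in blast)
  next
    assume a: "(\<forall>p s t. p ||- Mem (Tup [s, t]) F \<longrightarrow> p ||- Mem s X \<and> p ||- Mem t Y) \<and> ?R"
    have "p ||- Eq t t'" if t: "p ||- Mem (Tup [s, t]) F" "p ||- Mem (Tup [s, t']) F" for p s t t'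
    \<comment> \<open>The same device: both values are compared with the unique value
      \<open>w\<close> of a later stage, and the equation is thereby forced at
      \<open>p\<close>.\<close>
    proof (rule a[THEN conjunct2, rule_format])
      show "p ||- Mem s X" using a t by blast
      show "over p (Eq t t') Om" using cl_Mem_Tup2_over[OF t(1) F] cl_Mem_Tup2_over[OF t(2) F] by (blast intro: over_Eq)
      fix v w assume v: "p \<preceq> v"
        and un: "\<And>t'. v ||- Mem t' Y \<Longrightarrow> v ||- Mem (Tup [s, t']) F \<Longrightarrow> v ||- Eq w t'"
      have "v ||- Eq w t" "v ||- Eq w t'" using un a forces_mono[OF t(1) v] forces_mono[OF t(2) v] by blast+
      then show "v ||- Eq t t'" by (blast intro: forces_sym forces_trans)
    qed
    moreover have "p ||- \<beta>" if "p ||- Mem s X" "over p \<beta> Om"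
      "\<And>q t. p \<preceq> q \<Longrightarrow> q ||- Mem (Tup [s, t]) F \<Longrightarrow> q ||- \<beta>" for p s \<beta>
      using that a by blast
    ultimately show "fun_rel A B F X Y" unfolding fun_rel_def using a assms by blast
  qed
qed

lemma S_function_iff: "S_function L S A B (F, X, Y) \<longleftrightarrow> fun_rel A B F X Y"
proof (cases "cl X (Pw A) \<and> cl Y (Pw B) \<and> cl F (Pw (Prod [A, B]))")
  case True
  \<comment> \<open>Derivability from no hypotheses agrees with forcing at the empty stage only for
    formulae without free variables.\<close>
  have "fv (expset A B X Y) = {}" if "{} ||- Mem F (expset A B X Y) \<or> derives L S {} (Mem F (expset A B X Y))"
  proof -
    have ut: "has_ty L [] (Fv (0, Pw (Prod [A, B]))) (Pw (Prod [A, B]))"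
      using True by (auto dest: cl_wf)
    have P: "cl (prodset [A, B] [X, Y]) (Pw (Prod [A, B]))"
      using True by (intro cl_prodset) (auto simp: cls_list_def)
    have "formula L (conj (Mem (Fv (2, B)) Y) (Mem (Tup [Fv (1, A), Fv (2, B)]) (Fv (0, Pw (Prod [A, B])))))"
      using True by (auto dest: cl_wf cl_ty)
    from fv_ex1[OF this, of "(2, B)"] show ?thesis
      using True fv_subs[OF ut cl_ty[OF P]] cl_fv[OF P] cl_wf[of Y "Pw B"]
      by (fastforce simp: expset_def Let_def dest: cl_fv)
  qed
  then have "derives L S {} (Mem F (expset A B X Y)) \<longleftrightarrow> {} ||- Mem F (expset A B X Y)"
    using True forces_empty[of "Mem F (expset A B X Y)"] by (auto dest: cl_fv)
  then show ?thesis using True forces_expset[of X A Y B F] by (simp add: S_function_def)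
qed (auto simp: S_function_def fun_rel_def)

section \<open>Arrows of the linguistic topos\<close>

lemma fun_relI:
  assumes "cl X (Pw A)" "cl Y (Pw B)" "cl F (Pw (Prod [A, B]))"
    and "\<And>p s t. p ||- Mem (Tup [s, t]) F \<Longrightarrow> p ||- Mem s X"
    and "\<And>p s t. p ||- Mem (Tup [s, t]) F \<Longrightarrow> p ||- Mem t Y"
    and "\<And>p s \<beta>. p ||- Mem s X \<Longrightarrow> over p \<beta> Om \<Longrightarrow>
       (\<And>q t. p \<preceq> q \<Longrightarrow> q ||- Mem (Tup [s, t]) F \<Longrightarrow> q ||- \<beta>) \<Longrightarrow> p ||- \<beta>"
    and "\<And>p s t t'. p ||- Mem (Tup [s, t]) F \<Longrightarrow> p ||- Mem (Tup [s, t']) F \<Longrightarrow> p ||- Eq t t'"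
  shows "fun_rel A B F X Y"
  unfolding fun_rel_def using assms by blast

abbreviation T where "T \<equiv> ling_topos L S"

abbreviation arr where "arr F X Y \<equiv> arrow L S (F, X, Y)"

lemma arr_def: "arr F X Y = (cls L S F, cls L S X, cls L S Y)"
  by (simp add: arrow_def)

lemma Arr_T: "Arr T = {arr F X Y | A B F X Y. fun_rel A B F X Y}"
proof -
  have "Arr T = {arrow L S f | f. \<exists>A B. S_function L S A B f}" by (simp add: ling_topos_def Let_def)
  also have "\<dots> = {arr F X Y | A B F X Y. fun_rel A B F X Y}"
    unfolding S_function_iff[symmetric] by fastforce
  finally show ?thesis .
qed

lemma Dom_T [simp]: "Dom T (arr F X Y) = cls L S X" and Cod_T [simp]: "Cod T (arr F X Y) = cls L S Y"
  by (simp_all add: ling_topos_def Let_def arr_def)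

lemma Obj_T: "Obj T = {cls L S X | X A. cl X (Pw A)}"
  by (auto simp: ling_topos_def Let_def)

lemma Omg_T [simp]: "Omg T = cls L S (univ Om)"
  by (simp add: ling_topos_def Let_def)

lemma ArrI: "fun_rel A B F X Y \<Longrightarrow> arr F X Y \<in> Arr T"
  unfolding Arr_T by blast

lemma homI: "fun_rel A B F X Y \<Longrightarrow> arr F X Y \<in> hom T (cls L S X) (cls L S Y)"
  by (auto simp: hom_def intro: ArrI)

lemma homE:
  assumes "f \<in> hom T (cls L S X) (cls L S Y)" "cl X (Pw A)" "cl Y (Pw B)"
  obtains F where "f = arr F X Y" "fun_rel A B F X Y"
proof -
  obtain C D F X' Y' where f: "f = arr F X' Y'" "fun_rel C D F X' Y'"
    using assms(1) by (auto simp: hom_def Arr_T)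
  have e: "cls L S X' = cls L S X" "cls L S Y' = cls L S Y" using assms(1) f(1) by (auto simp: hom_def)
  have "C = A" "D = B"
    using cls_eqD(1)[OF e(1)[symmetric] assms(2) fun_rel_cl(1)[OF f(2)]]
      cls_eqD(1)[OF e(2)[symmetric] assms(3) fun_rel_cl(2)[OF f(2)]] by simp_all
  then have "fun_rel A B F X Y"
    using fun_rel_cong[OF f(2) assms(2,3) fun_rel_cl(3)[OF f(2)] e[symmetric] refl] by simp
  moreover have "f = arr F X Y" using f(1) e by (simp add: arr_def)
  ultimately show ?thesis using that by blast
qed

section \<open>Functions given by terms\<close>

definition graph where
  "graph x \<tau> B X = sabs [x] (Prod [snd x, B]) (Tup [Fv x, \<tau>]) (Mem (Fv x) X)"

lemma mapsto_graph: "arrow L S (mapsto x \<tau> B X Y) = arr (graph x \<tau> B X) X Y"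
  by (simp add: mapsto_def graph_def)

definition tm_in where
  "tm_in x \<tau> B \<longleftrightarrow> has_ty L [] \<tau> B \<and> fv \<tau> \<subseteq> {x}"

lemma tm_in_inst1: "tm_in x \<tau> B \<Longrightarrow> over p s (snd x) \<Longrightarrow> over p (inst1 x s \<tau>) B"
  by (auto simp: tm_in_def intro: over_inst1)

lemma graph_ty:
  assumes "tm_in x \<tau> B" "cl X (Pw (snd x))"
  shows "has_ty L [] (Tup [Fv x, \<tau>]) (Prod [snd x, B])" "formula L (Mem (Fv x) X)"
    "\<forall>y\<in>set [x]. wf_ty (gnds L) (snd y)" "fv (Tup [Fv x, \<tau>]) \<union> fv (Mem (Fv x) X) \<subseteq> set [x]"
  using assms cl_wf_Pw[OF assms(2)] cl_fv[OF assms(2)] cl_ty[OF assms(2)] by (auto simp: tm_in_def)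

lemma cl_graph: "tm_in x \<tau> B \<Longrightarrow> cl X (Pw (snd x)) \<Longrightarrow> cl (graph x \<tau> B X) (Pw (Prod [snd x, B]))"
  unfolding graph_def by (intro cl_sabs graph_ty)

text \<open>The existential in the graph disappears because its parameter is the first component of
  the pair, up to provable equality, and \<tau> respects such equalities.\<close>

lemma forces_graph:
  assumes "tm_in x \<tau> B" "cl X (Pw (snd x))"
  shows "p ||- Mem (Tup [s, t]) (graph x \<tau> B X) \<longleftrightarrow> p ||- Mem s X \<and> p ||- Eq t (inst1 x s \<tau>)"
proof
  assume m: "p ||- Mem (Tup [s, t]) (graph x \<tau> B X)"
  have stage: "over p s (snd x)" "over p t B" using cl_Mem_Tup2_over[OF m cl_graph[OF assms]] by auto
  have "p ||- conj (Mem s X) (Eq t (inst1 x s \<tau>))"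
  proof (rule forces_sabsE[OF m[unfolded graph_def] graph_ty[OF assms]])
    show "over p (conj (Mem s X) (Eq t (inst1 x s \<tau>))) Om"
      using stage tm_in_inst1[OF assms(1) stage(1)] cl_over[OF assms(2) over_stage[OF stage(1)]]
      by (auto simp: over_conj intro: over_Mem over_Eq)
    fix q ss assume q: "p \<preceq> q" and "list_all2 (\<lambda>s x. over q s (snd x)) ss [x]"
      and X: "q ||- inst [] (upd Fv [x] ss) (Mem (Fv x) X) 0"
      and e: "q ||- Eq (Tup [s, t]) (inst [] (upd Fv [x] ss) (Tup [Fv x, \<tau>]) 0)"
    then obtain s' where s': "ss = [s']" "over q s' (snd x)" by (auto simp: list_all2_Cons2)
    have e: "q ||- Eq s s'" "q ||- Eq t (inst1 x s' \<tau>)" and X: "q ||- Mem s' X"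
      using e X assms(2) unfolding s'(1) by (auto dest: forces_Eq_Tup2D)
    have "q ||- Eq (inst1 x s \<tau>) (inst1 x s' \<tau>)"
      using assms(1) e(1) over_mono[OF stage(1) q] by (auto intro!: forces_inst1_cong simp: tm_in_def)
    then show "q ||- conj (Mem s X) (Eq t (inst1 x s \<tau>))"
      unfolding forces_conj using e X by (blast intro: forces_Mem_eq forces_sym forces_trans)
  qed
  then show "p ||- Mem s X \<and> p ||- Eq t (inst1 x s \<tau>)" by (simp add: forces_conj)
next
  assume a: "p ||- Mem s X \<and> p ||- Eq t (inst1 x s \<tau>)"
  have s: "over p s (snd x)" using a assms(2) by (blast intro: cl_Mem_over)
  have t: "over p t B" using a tm_in_inst1[OF assms(1) s] by (blast intro: forces_Eq_over')
  show "p ||- Mem (Tup [s, t]) (graph x \<tau> B X)" unfolding graph_def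
    using a s t assms(2) forces_refl[OF s]
    by (intro forces_sabsI[OF graph_ty[OF assms], of p "[s]"]) (auto intro: over_Tup2 forces_Eq_Tup2I)
qed

lemma fun_rel_graph:
  assumes "tm_in x \<tau> B" "cl X (Pw (snd x))" "cl Y (Pw B)"
    and "\<And>p s. p ||- Mem s X \<Longrightarrow> p ||- Mem (inst1 x s \<tau>) Y"
  shows "fun_rel (snd x) B (graph x \<tau> B X) X Y"
  unfolding fun_rel_def forces_graph[OF assms(1,2)]
proof (intro conjI allI impI)
  fix p s \<beta> assume s: "p ||- Mem s X" and "over p \<beta> Om"
    and *: "\<forall>q t. p \<preceq> q \<longrightarrow> q ||- Mem s X \<and> q ||- Eq t (inst1 x s \<tau>) \<longrightarrow> q ||- \<beta>"
  have "over p s (snd x)" using s assms(2) by (rule cl_Mem_over)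
  then show "p ||- \<beta>"
    using * s le_refl[OF forces_stage[OF s]] forces_refl[OF tm_in_inst1[OF assms(1)]] by blast
qed (use assms cl_graph[OF assms(1,2)] in \<open>auto intro: forces_Mem_eq forces_sym forces_trans\<close>)

lemma fun_rel_graph_univ:
  assumes "tm_in x \<tau> B" "cl X (Pw (snd x))"
  shows "fun_rel (snd x) B (graph x \<tau> B X) X (univ B)"
proof (rule fun_rel_graph[OF assms])
  have wft: "wf_ty (gnds L) B" using assms(1) by (auto simp: tm_in_def dest: wf_ty_tm)
  then show "cl (univ B) (Pw B)" by (rule cl_univ)
  show "p ||- Mem (inst1 x s \<tau>) (univ B)" if "p ||- Mem s X" for p s
    using cl_Mem_over[OF that assms(2)] tm_in_inst1[OF assms(1)] by (simp add: forces_univ[OF wft])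
qed

section \<open>Composition\<close>

lemma comp_graph_ty:
  assumes "cl F (Pw (Prod [A, B]))" "cl G (Pw (Prod [B, C]))"
  shows "has_ty L [] (Tup [Fv (0, A), Fv (2, C)]) (Prod [A, C])"
    "formula L (conj (Mem (Tup [Fv (0, A), Fv (1, B)]) F) (Mem (Tup [Fv (1, B), Fv (2, C)]) G))"
    "formula L (ex (1, B) (conj (Mem (Tup [Fv (0, A), Fv (1, B)]) F) (Mem (Tup [Fv (1, B), Fv (2, C)]) G)))"
    "\<forall>y\<in>set [(0, A), (2, C)]. wf_ty (gnds L) (snd y)"
    "fv (Tup [Fv (0, A), Fv (2, C)]) \<union>
     fv (ex (1, B) (conj (Mem (Tup [Fv (0, A), Fv (1, B)]) F) (Mem (Tup [Fv (1, B), Fv (2, C)]) G)))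
     \<subseteq> set [(0, A), (2, C)]" "wf_ty (gnds L) B"
proof -
  have wft: "wf_ty (gnds L) A" "wf_ty (gnds L) B" "wf_ty (gnds L) C"
    using cl_wf[OF assms(1)] cl_wf[OF assms(2)] by auto
  then show "has_ty L [] (Tup [Fv (0, A), Fv (2, C)]) (Prod [A, C])"
    "\<forall>y\<in>set [(0, A), (2, C)]. wf_ty (gnds L) (snd y)" "wf_ty (gnds L) B" by auto
  show f: "formula L (conj (Mem (Tup [Fv (0, A), Fv (1, B)]) F) (Mem (Tup [Fv (1, B), Fv (2, C)]) G))"
    using wft has_ty.intros(8)[OF _ cl_ty[OF assms(1)]] has_ty.intros(8)[OF _ cl_ty[OF assms(2)]]
    by (simp del: has_ty_Mem)
  show "formula L (ex (1, B) (conj (Mem (Tup [Fv (0, A), Fv (1, B)]) F) (Mem (Tup [Fv (1, B), Fv (2, C)]) G)))"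
    using f wft by (intro has_ty_ex) auto
qed (use assms in \<open>auto dest: cl_fv\<close>)

lemma cl_comp_graph:
  assumes "cl F (Pw (Prod [A, B]))" "cl G (Pw (Prod [B, C]))"
  shows "cl (comp_graph A B C G F) (Pw (Prod [A, C]))"
  unfolding comp_graph_def Let_def by (intro cl_sabs comp_graph_ty[OF assms])

lemma comp_graphI:
  assumes "cl F (Pw (Prod [A, B]))" "cl G (Pw (Prod [B, C]))"
    and "p ||- Mem (Tup [s, t]) F" "p ||- Mem (Tup [t, u]) G"
  shows "p ||- Mem (Tup [s, u]) (comp_graph A B C G F)"
proof -
  have stage: "over p s A" "over p t B" "over p u C"
    using cl_Mem_Tup2_over[OF assms(3,1)] cl_Mem_Tup2_over[OF assms(4,2)] by auto
  have p: "stage p" using stage(1) by (rule over_stage)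
  show ?thesis unfolding comp_graph_def Let_def
  proof (rule forces_sabsI[OF comp_graph_ty(1,3-5)[OF assms(1,2)], of p "[s, u]"])
    show "p ||- inst [] (upd Fv [(0, A), (2, C)] [s, u]) (ex (1, B)
      (conj (Mem (Tup [Fv (0, A), Fv (1, B)]) F) (Mem (Tup [Fv (1, B), Fv (2, C)]) G))) 0"
      using stage p assms cl_fv[OF assms(1)] cl_fv[OF assms(2)]
      by (intro forces_exI[OF comp_graph_ty(2)[OF assms(1,2)], of _ _ _ t]) (auto simp: env_def forces_conj)
  qed (use stage forces_refl in \<open>auto intro!: over_Tup2 forces_refl[of p _ "Prod [A, C]"]\<close>)
qed

lemma comp_graphE:
  assumes "cl F (Pw (Prod [A, B]))" "cl G (Pw (Prod [B, C]))"
    and m: "p ||- Mem (Tup [s, u]) (comp_graph A B C G F)" and \<beta>: "over p \<beta> Om"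
    and *: "\<And>q t. p \<preceq> q \<Longrightarrow> q ||- Mem (Tup [s, t]) F \<Longrightarrow> q ||- Mem (Tup [t, u]) G \<Longrightarrow> q ||- \<beta>"
  shows "p ||- \<beta>"
proof (rule forces_sabsE[OF m[unfolded comp_graph_def Let_def] comp_graph_ty(1,3-5)[OF assms(1,2)] \<beta>])
  fix q ss assume q: "p \<preceq> q" and "list_all2 (\<lambda>s x. over q s (snd x)) ss [(0, A), (2, C)]"
    and ex: "q ||- inst [] (upd Fv [(0, A), (2, C)] ss) (ex (1, B)
      (conj (Mem (Tup [Fv (0, A), Fv (1, B)]) F) (Mem (Tup [Fv (1, B), Fv (2, C)]) G))) 0"
    and e: "q ||- Eq (Tup [s, u]) (inst [] (upd Fv [(0, A), (2, C)] ss) (Tup [Fv (0, A), Fv (2, C)]) 0)"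
  then obtain s' u' where su: "ss = [s', u']" "over q s' A" "over q u' C" by (auto simp: list_all2_Cons2)
  have e: "q ||- Eq s' s" "q ||- Eq u' u" using e unfolding su(1) by (auto dest: forces_Eq_Tup2D forces_sym)
  show "q ||- \<beta>"
  proof (rule forces_exE[OF ex comp_graph_ty(2)[OF assms(1,2)] _ _ over_mono[OF \<beta> q]])
    show "env q (upd Fv [(0, A), (2, C)] ss)
      (fv (conj (Mem (Tup [Fv (0, A), Fv (1, B)]) F) (Mem (Tup [Fv (1, B), Fv (2, C)]) G)) - {(1, B)})"
      using su forces_stage[OF ex] cl_fv[OF assms(1)] cl_fv[OF assms(2)] by (auto simp: env_def)
    fix r t assume r: "q \<preceq> r" and t: "over r t (snd (1 :: nat, B))"
      and c: "r ||- inst [] ((upd Fv [(0, A), (2, C)] ss)((1, B) := t))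
        (conj (Mem (Tup [Fv (0, A), Fv (1, B)]) F) (Mem (Tup [Fv (1, B), Fv (2, C)]) G)) 0"
    have "r ||- Mem (Tup [s', t]) F" "r ||- Mem (Tup [t, u']) G"
      using c assms(1,2) unfolding su(1) by (auto simp: forces_conj)
    then have "r ||- Mem (Tup [s, t]) F" "r ||- Mem (Tup [t, u]) G"
      using forces_mono[OF e(1) r] forces_mono[OF e(2) r] forces_refl t by (auto intro: forces_Mem_pair_eq)
    then show "r ||- \<beta>" using * le_trans[OF q r] by blast
  qed (use comp_graph_ty[OF assms(1,2)] in simp)
qed

lemma fun_rel_comp:
  assumes F: "fun_rel A B F X Y" and G: "fun_rel B C G Y Z"
  shows "fun_rel A C (comp_graph A B C G F) X Z"
proof -
  note c = fun_rel_cl(3)[OF F] fun_rel_cl(3)[OF G]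
  have d: "p ||- Mem s X \<and> p ||- Mem u Z" if m: "p ||- Mem (Tup [s, u]) (comp_graph A B C G F)" for p s u
  proof -
    have su: "over p s A" "over p u C" using cl_Mem_Tup2_over[OF m cl_comp_graph[OF c]] by auto
    have "p ||- conj (Mem s X) (Mem u Z)"
    proof (rule comp_graphE[OF c m])
      show "over p (conj (Mem s X) (Mem u Z)) Om"
        using su cl_over[OF fun_rel_cl(1)[OF F] over_stage[OF su(1)]] cl_over[OF fun_rel_cl(2)[OF G] over_stage[OF su(1)]]
        by (auto simp: over_conj intro: over_Mem)
    qed (auto simp: forces_conj intro: fun_rel_dom[OF F] fun_rel_cod[OF G])
    then show ?thesis by (simp add: forces_conj)
  qed
  have un: "p ||- Eq u v" if m: "p ||- Mem (Tup [s, u]) (comp_graph A B C G F)"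
      "p ||- Mem (Tup [s, v]) (comp_graph A B C G F)" for p s u v
  proof -
    have e: "over p (Eq u v) Om"
      using cl_Mem_Tup2_over[OF m(1) cl_comp_graph[OF c]] cl_Mem_Tup2_over[OF m(2) cl_comp_graph[OF c]]
      by (blast intro: over_Eq)
    show ?thesis
    proof (rule comp_graphE[OF c m(1) e])
      fix q t assume q: "p \<preceq> q" and t: "q ||- Mem (Tup [s, t]) F" "q ||- Mem (Tup [t, u]) G"
      show "q ||- Eq u v"
      proof (rule comp_graphE[OF c forces_mono[OF m(2) q] over_mono[OF e q]])
        fix r t' assume r: "q \<preceq> r" and t': "r ||- Mem (Tup [s, t']) F" "r ||- Mem (Tup [t', v]) G"
        have "r ||- Eq t' t" using fun_rel_unique[OF F t'(1) forces_mono[OF t(1) r]] .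
        then have "r ||- Mem (Tup [t, v]) G"
          using t'(2) forces_refl fun_rel_over[OF G t'(2)] by (blast intro: forces_Mem_pair_eq)
        then show "r ||- Eq u v" using fun_rel_unique[OF G forces_mono[OF t(2) r]] by blast
      qed
    qed
  qed
  have tot: "p ||- \<beta>" if s: "p ||- Mem s X" and \<beta>: "over p \<beta> Om"
    and *: "\<And>q t. p \<preceq> q \<Longrightarrow> q ||- Mem (Tup [s, t]) (comp_graph A B C G F) \<Longrightarrow> q ||- \<beta>" for p s \<beta>
  proof (rule fun_rel_total[OF F s \<beta>])
    fix q t assume q: "p \<preceq> q" and t: "q ||- Mem (Tup [s, t]) F"
    show "q ||- \<beta>"
    proof (rule fun_rel_total[OF G fun_rel_cod[OF F t] over_mono[OF \<beta> q]])
      fix r u assume r: "q \<preceq> r" and "r ||- Mem (Tup [t, u]) G"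
      then show "r ||- \<beta>" using forces_mono[OF t r] le_trans[OF q r] by (blast intro: * comp_graphI[OF c])
    qed
  qed
  show ?thesis
    by (rule fun_relI[OF fun_rel_cl(1)[OF F] fun_rel_cl(2)[OF G] cl_comp_graph[OF c]]) (use d un tot in blast)+
qed

text \<open>Composition in the topos uses representatives of the two graphs, and these have the same
  elements as \<open>F\<close> and \<open>G\<close> at every stage.\<close>

lemma Cmp_comp_graph:
  assumes F: "fun_rel A B F X Y" and G: "fun_rel B C G Y Z"
  shows "Cmp T (arr G Y Z) (arr F X Y) = arr (comp_graph A B C G F) X Z"
proof -
  let ?F = "rep (cls L S F)" and ?G = "rep (cls L S G)"
  note c = fun_rel_cl(3)[OF F] fun_rel_cl(3)[OF G]
  note r = rep_cls(1)[OF c(1)] rep_cls(1)[OF c(2)]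
  have "Cmp T (arr G Y Z) (arr F X Y) = arr (comp_graph A B C ?G ?F) X Z"
    using rep_cls(4)[OF fun_rel_cl(1)[OF F]] rep_cls(4)[OF fun_rel_cl(2)[OF F]] rep_cls(4)[OF fun_rel_cl(2)[OF G]]
    by (simp add: ling_topos_def Let_def arr_def)
  moreover have "cls L S (comp_graph A B C ?G ?F) = cls L S (comp_graph A B C G F)"
  proof (rule rel_cls_eqI[OF cl_comp_graph[OF r] cl_comp_graph[OF c]])
    fix p s u
    show "p ||- Mem (Tup [s, u]) (comp_graph A B C G F)" if m: "p ||- Mem (Tup [s, u]) (comp_graph A B C ?G ?F)"
    proof (rule comp_graphE[OF r m])
      show "over p (Mem (Tup [s, u]) (comp_graph A B C G F)) Om"
        using cl_Mem_Tup2_over[OF m cl_comp_graph[OF r]] cl_comp_graph[OF c] by (blast intro: over_Mem_pair)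
    qed (auto simp: rep_cls(3)[OF c(1)] rep_cls(3)[OF c(2)] intro: comp_graphI[OF c])
    show "p ||- Mem (Tup [s, u]) (comp_graph A B C ?G ?F)" if m: "p ||- Mem (Tup [s, u]) (comp_graph A B C G F)"
    proof (rule comp_graphE[OF c m])
      show "over p (Mem (Tup [s, u]) (comp_graph A B C ?G ?F)) Om"
        using cl_Mem_Tup2_over[OF m cl_comp_graph[OF c]] cl_comp_graph[OF r] by (blast intro: over_Mem_pair)
    qed (auto simp: rep_cls(3)[OF c(1)] rep_cls(3)[OF c(2)] intro!: comp_graphI[OF r])
  qed
  ultimately show ?thesis by (simp add: arr_def)
qed

text \<open>It suffices that \<open>H\<close> contains all composite pairs, both sides being
  functional; the quantifier hidden in \<open>comp_graph\<close> is dealt with here once and for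
  all.\<close>

lemma Cmp_eqI:
  assumes F: "fun_rel A B F X Y" and G: "fun_rel B C G Y Z" and H: "fun_rel A C H X Z"
    and "\<And>p s t u. p ||- Mem (Tup [s, t]) F \<Longrightarrow> p ||- Mem (Tup [t, u]) G \<Longrightarrow> p ||- Mem (Tup [s, u]) H"
  shows "Cmp T (arr G Y Z) (arr F X Y) = arr H X Z"
proof -
  note c = fun_rel_cl(3)[OF F] fun_rel_cl(3)[OF G]
  have "cls L S (comp_graph A B C G F) = cls L S H"
  proof (rule fun_rel_cls_eqI[OF fun_rel_comp[OF F G] H])
    fix p s u assume m: "p ||- Mem (Tup [s, u]) (comp_graph A B C G F)"
    show "p ||- Mem (Tup [s, u]) H"
    proof (rule comp_graphE[OF c m])
      show "over p (Mem (Tup [s, u]) H) Om"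
        using cl_Mem_Tup2_over[OF m cl_comp_graph[OF c]] fun_rel_cl(3)[OF H] by (blast intro: over_Mem_pair)
    qed (rule assms(4))
  qed
  then show ?thesis unfolding Cmp_comp_graph[OF F G] by (simp add: arr_def)
qed

lemma Cmp_eqD:
  assumes F: "fun_rel A B F X Y" and G: "fun_rel B C G Y Z" and H: "cl H (Pw D)"
    and eq: "Cmp T (arr G Y Z) (arr F X Y) = arr H X Z"
    and "p ||- Mem (Tup [s, t]) F" "p ||- Mem (Tup [t, u]) G"
  shows "p ||- Mem (Tup [s, u]) H"
proof -
  note c = fun_rel_cl(3)[OF F] fun_rel_cl(3)[OF G]
  have "cls L S (comp_graph A B C G F) = cls L S H"
    using eq unfolding Cmp_comp_graph[OF F G] by (simp add: arr_def)
  from cls_eqD(2)[OF this cl_comp_graph[OF c] H] show ?thesis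
    using comp_graphI[OF c assms(5,6)] by blast
qed

lemma arr_eq_frelD:
  assumes "arr F X Y = arr G X Y" "cl F (Pw A)" "cl G (Pw B)"
  shows "p ||- Mem a F \<longleftrightarrow> p ||- Mem a G"
proof -
  have "cls L S F = cls L S G" using assms(1) by (simp add: arr_def)
  then show ?thesis using assms(2,3) by (rule cls_eqD(2))
qed

section \<open>Products\<close>

abbreviation wft where "wft A \<equiv> wf_ty (gnds L) A"

text \<open>Pointwise equality of the values of two terms on \<open>X\<close> is enough. The terms
  may use different variables, and the domain is fixed only up to its class.\<close>

lemma graph_eqI:
  assumes "tm_in x \<tau> B" "tm_in x' \<tau>' B" "snd x' = snd x" "cl X (Pw (snd x))" "cl X' (Pw (snd x))"
    and "cls L S X' = cls L S X"
    and "\<And>p s. p ||- Mem s X \<Longrightarrow> p ||- Eq (inst1 x s \<tau>) (inst1 x' s \<tau>')"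
  shows "cls L S (graph x \<tau> B X) = cls L S (graph x' \<tau>' B X')"
proof (rule rel_cls_eqI)
  note X = cls_eqD(2)[OF assms(6,5,4)]
  show "cl (graph x \<tau> B X) (Pw (Prod [snd x, B]))" using assms by (intro cl_graph)
  show "cl (graph x' \<tau>' B X') (Pw (Prod [snd x, B]))" using cl_graph[OF assms(2), of X'] assms(3,5) by simp
  fix p s t
  have g: "p ||- Mem (Tup [s, t]) (graph x' \<tau>' B X') \<longleftrightarrow> p ||- Mem s X \<and> p ||- Eq t (inst1 x' s \<tau>')"
    using forces_graph[OF assms(2), of X' p s t] assms(3,5) X by simp
  show "p ||- Mem (Tup [s, t]) (graph x' \<tau>' B X')" if "p ||- Mem (Tup [s, t]) (graph x \<tau> B X)"
    using that assms(7) unfolding g forces_graph[OF assms(1,4)] by (blast intro: forces_trans)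
  show "p ||- Mem (Tup [s, t]) (graph x \<tau> B X)" if "p ||- Mem (Tup [s, t]) (graph x' \<tau>' B X')"
    using that assms(7) unfolding g forces_graph[OF assms(1,4)] by (blast intro: forces_trans forces_sym)
qed

lemma graph_cong:
  assumes "tm_in x \<tau> B" "cl X (Pw (snd x))" "cl X' (Pw (snd x))" "cls L S X' = cls L S X"
  shows "cls L S (graph x \<tau> B X) = cls L S (graph x \<tau> B X')"
  using assms by (intro graph_eqI) (auto intro!: forces_refl[OF tm_in_inst1] cl_Mem_over)

section \<open>Terms in one variable and their composition\<close>

lemma tm_in_Tup: "length Bs \<noteq> 1 \<Longrightarrow> list_all2 (tm_in x) \<tau>s Bs \<Longrightarrow> tm_in x (Tup \<tau>s) (Prod Bs)"
  by (fastforce simp: tm_in_def list_all2_conv_all_nth in_set_conv_nth)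

lemma tm_in_Tup2: "tm_in x \<tau> B \<Longrightarrow> tm_in x \<tau>' C \<Longrightarrow> tm_in x (Tup [\<tau>, \<tau>']) (Prod [B, C])"
  by (rule tm_in_Tup) auto

lemma tm_in_Pr: "tm_in x \<tau> (Prod As) \<Longrightarrow> i < length As \<Longrightarrow> B = As ! i \<Longrightarrow> tm_in x (Pr As i \<tau>) B"
  by (simp add: tm_in_def)

lemma tm_in_Eq: "tm_in x \<sigma> B \<Longrightarrow> tm_in x \<tau> B \<Longrightarrow> tm_in x (Eq \<sigma> \<tau>) Om"
  by (auto simp add: tm_in_def)

lemma tm_in_Mem: "tm_in x \<sigma> B \<Longrightarrow> tm_in x \<tau> (Pw B) \<Longrightarrow> tm_in x (Mem \<sigma> \<tau>) Om"
  by (auto simp add: tm_in_def)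

lemma tm_in_tt: "tm_in x tt Om"
  by (auto simp add: tm_in_def)

lemma tm_in_cl: "cl X A \<Longrightarrow> tm_in x X A"
  by (auto simp add: tm_in_def closed_of_def)

lemma tm_in_wf: "tm_in x \<tau> B \<Longrightarrow> wft B"
  by (auto simp: tm_in_def dest: wf_ty_tm)

lemma tm_in_comp: "tm_in y \<sigma> C \<Longrightarrow> tm_in x \<tau> (snd y) \<Longrightarrow> tm_in x (inst1 y \<tau> \<sigma>) C"
  using fv_inst[of "[]" "Fv(y := \<tau>)" \<sigma> 0] by (fastforce simp: tm_in_def intro!: has_ty_msub)

lemma inst1_comp:
  assumes "tm_in y \<sigma> C" "tm_in x \<tau> (snd y)"
  shows "inst1 x s (inst1 y \<tau> \<sigma>) = inst1 y (inst1 x s \<tau>) \<sigma>"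
proof -
  have "inst1 x s (inst1 y \<tau> \<sigma>) = inst [] (\<lambda>z. inst1 x s ((Fv(y := \<tau>)) z)) \<sigma> 0"
    using assms by (intro inst_inst_Nil[of \<sigma> L]) (auto simp: tm_in_def)
  also have "\<dots> = inst1 y (inst1 x s \<tau>) \<sigma>" using assms by (intro inst_cong) (auto simp: tm_in_def)
  finally show ?thesis .
qed

text \<open>For arrows given by terms, composition is substitution. The set \<open>Y\<close> may be
  smaller than a universe, as is required for the projection from a product onto
  \<open>X\<close>.\<close>

lemma Cmp_graph:
  assumes "tm_in x \<tau> (snd y)" "tm_in y \<sigma> C" "cl X (Pw (snd x))"
    and "fun_rel (snd x) (snd y) (graph x \<tau> (snd y) X) X Y" "fun_rel (snd y) C (graph y \<sigma> C Y) Y Z"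
  shows "Cmp T (arr (graph y \<sigma> C Y) Y Z) (arr (graph x \<tau> (snd y) X) X Y) = arr (graph x (inst1 y \<tau> \<sigma>) C X) X Z"
proof -
  note c = tm_in_comp[OF assms(2,1)]
  have Y: "cl Y (Pw (snd y))" using assms(5) by (rule fun_rel_cl)
  have g: "p ||- Mem (Tup [s, u]) (graph x (inst1 y \<tau> \<sigma>) C X)"
    if "p ||- Mem (Tup [s, t]) (graph x \<tau> (snd y) X)" "p ||- Mem (Tup [t, u]) (graph y \<sigma> C Y)" for p s t u
  proof -
    have stage: "p ||- Mem s X" "p ||- Eq t (inst1 x s \<tau>)" "p ||- Eq u (inst1 y t \<sigma>)"
      using that forces_graph[OF assms(1,3)] forces_graph[OF assms(2) Y] by auto
    have "over p t (snd y)" using that(1) fun_rel_over[OF assms(4)] by blast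
    then have "p ||- Eq (inst1 y t \<sigma>) (inst1 y (inst1 x s \<tau>) \<sigma>)"
      using stage(2) assms(2) by (intro forces_inst1_cong) (auto simp: tm_in_def)
    then show ?thesis unfolding forces_graph[OF c assms(3)] inst1_comp[OF assms(2,1)]
      using stage by (blast intro: forces_trans)
  qed
  have "fun_rel (snd x) C (graph x (inst1 y \<tau> \<sigma>) C X) X Z"
  proof (rule fun_rel_graph[OF c assms(3) fun_rel_cl(2)[OF assms(5)]])
    fix p s assume s: "p ||- Mem s X"
    have "over p s (snd x)" using s assms(3) by (rule cl_Mem_over)
    then have t: "over p (inst1 x s \<tau>) (snd y)" using assms(1) by (rule tm_in_inst1[rotated])
    \<comment> \<open>That \<tau> takes values in \<open>Y\<close> is recovered from the assumption
      that its graph is a functional relation into \<open>Y\<close>.\<close>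
    have "p ||- Mem (inst1 x s \<tau>) Y"
      using fun_rel_cod[OF assms(4)] s forces_refl[OF t] by (blast intro: forces_graph[OF assms(1,3), THEN iffD2])
    then have "p ||- Mem (Tup [inst1 x s \<tau>, inst1 y (inst1 x s \<tau>) \<sigma>]) (graph y \<sigma> C Y)"
      using forces_refl[OF tm_in_inst1[OF assms(2) t]] by (simp add: forces_graph[OF assms(2) Y])
    then show "p ||- Mem (inst1 x s (inst1 y \<tau> \<sigma>)) Z"
      unfolding inst1_comp[OF assms(2,1)] by (rule fun_rel_cod[OF assms(5)])
  qed
  from Cmp_eqI[OF assms(4,5) this g] show ?thesis .
qed

lemma Cmp_graph_univ:
  assumes "tm_in x \<tau> (snd y)" "tm_in y \<sigma> C" "cl X (Pw (snd x))"
  shows "Cmp T (arr (graph y \<sigma> C (univ (snd y))) (univ (snd y)) (univ C)) (arr (graph x \<tau> (snd y) X) X (univ (snd y)))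
    = arr (graph x (inst1 y \<tau> \<sigma>) C X) X (univ C)"
  using tm_in_wf[OF assms(1)]
  by (intro Cmp_graph[OF assms] fun_rel_graph_univ[OF assms(1,3)] fun_rel_graph_univ[OF assms(2)]) (auto intro: cl_univ)

section \<open>Product objects and projections\<close>

lemma cls_list_rep:
  assumes "cls_list Xs As"
  shows "map (elem_ty L) (map (cls L S) Xs) = As" "cls_list (map rep (map (cls L S) Xs)) As"
    "\<And>i p a. i < length As \<Longrightarrow> p ||- Mem a (map rep (map (cls L S) Xs) ! i) \<longleftrightarrow> p ||- Mem a (Xs ! i)"
proof -
  have len: "length Xs = length As" and X: "\<And>i. i < length As \<Longrightarrow> cl (Xs ! i) (Pw (As ! i))"
    using assms by (auto simp: cls_list_def list_all2_conv_all_nth)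
  show "map (elem_ty L) (map (cls L S) Xs) = As" using len rep_cls(4)[OF X] by (intro nth_equalityI) auto
  show "cls_list (map rep (map (cls L S) Xs)) As"
    using len rep_cls(1)[OF X] by (auto simp: cls_list_def list_all2_conv_all_nth)
  show "p ||- Mem a (map rep (map (cls L S) Xs) ! i) \<longleftrightarrow> p ||- Mem a (Xs ! i)" if "i < length As" for i p a
    using len rep_cls(3)[OF X[OF that]] that by simp
qed

lemma prodset_cls_eq:
  assumes "cls_list Xs As" "cls_list Ys As" "length As \<noteq> 1"
    and "\<And>i p a. i < length As \<Longrightarrow> p ||- Mem a (Xs ! i) \<longleftrightarrow> p ||- Mem a (Ys ! i)"
  shows "cls L S (prodset As Xs) = cls L S (prodset As Ys)"
  using assms by (intro cls_eqI[of _ "Prod As"] cl_prodset) (auto simp: forces_prodset)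

lemma cls_list_length: "cls_list Xs As \<Longrightarrow> length Xs = length As"
  by (auto simp: cls_list_def dest: list_all2_lengthD)

lemma Prd_T:
  assumes "cls_list Xs As" "length As \<noteq> 1"
  shows "Prd T (map (cls L S) Xs) = cls L S (prodset As Xs)"
proof -
  have "Prd T (map (cls L S) Xs) = cls L S (prodset As (map rep (map (cls L S) Xs)))"
    using assms(2) cls_list_length[OF assms(1)] cls_list_rep(1)[OF assms(1)]
    by (simp add: ling_topos_def Let_def)
  also have "\<dots> = cls L S (prodset As Xs)"
    using assms cls_list_rep(2,3)[OF assms(1)] by (intro prodset_cls_eq) auto
  finally show ?thesis .
qed

lemma prod_graph:
  assumes "cls_list Xs As" "length As \<noteq> 1" "i < length As" "snd z = Prod As"
  shows "tm_in z (Pr As i (Fv z)) (As ! i)"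
    "fun_rel (Prod As) (As ! i) (graph z (Pr As i (Fv z)) (As ! i) (prodset As Xs)) (prodset As Xs) (Xs ! i)"
proof -
  have wfs: "wft (Prod As)" using assms(2) cls_list_wf[OF assms(1)] by (auto simp: in_set_conv_nth)
  then show t: "tm_in z (Pr As i (Fv z)) (As ! i)" using assms(3,4) by (intro tm_in_Pr) (auto simp: tm_in_def)
  have "cl (Xs ! i) (Pw (As ! i))" using assms by (auto simp: cls_list_def list_all2_conv_all_nth)
  then show "fun_rel (Prod As) (As ! i) (graph z (Pr As i (Fv z)) (As ! i) (prodset As Xs)) (prodset As Xs) (Xs ! i)"
    using fun_rel_graph[OF t, of "prodset As Xs" "Xs ! i"] cl_prodset[OF assms(1,2)] assms(3,4)
    by (auto simp: forces_prodset[OF assms(1,2)])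
qed

text \<open>The topos defines projections by a condition on all components; rewriting them as graphs
  of the terms \<open>Pr As i\<close> makes composition with them a substitution.\<close>

lemma Pj_T:
  assumes "cls_list Xs As" "length As \<noteq> 1" "i < length As" "snd z = Prod As"
  shows "Pj T (map (cls L S) Xs) i = arr (graph z (Pr As i (Fv z)) (As ! i) (prodset As Xs)) (prodset As Xs) (Xs ! i)"
proof -
  let ?Xs = "map rep (map (cls L S) Xs)"
  note r = cls_list_rep[OF assms(1)]
  note t = prod_graph[OF assms]
  have "Pj T (map (cls L S) Xs) i = (cls L S (proj_graph As ?Xs i), Prd T (map (cls L S) Xs), cls L S (Xs ! i))"
    using assms(2,3) cls_list_length[OF assms(1)] r(1)
    by (simp add: ling_topos_def Let_def)
  also have "cls L S (proj_graph As ?Xs i) = cls L S (graph z (Pr As i (Fv z)) (As ! i) (prodset As Xs))"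
  proof (rule rel_cls_eqI[OF cl_proj_graph[OF r(2) assms(2,3)] fun_rel_cl(3)[OF t(2)]])
    have c: "cl (prodset As Xs) (Pw (snd z))" using cl_prodset[OF assms(1,2)] assms(4) by simp
    fix p s u
    have e: "p ||- Mem s (prodset As ?Xs) \<longleftrightarrow> p ||- Mem s (prodset As Xs)"
      unfolding forces_prodset[OF r(2) assms(2)] forces_prodset[OF assms(1,2)] using r(3) by blast
    show "p ||- Mem (Tup [s, u]) (proj_graph As ?Xs i) \<Longrightarrow>
      p ||- Mem (Tup [s, u]) (graph z (Pr As i (Fv z)) (As ! i) (prodset As Xs))"
      "p ||- Mem (Tup [s, u]) (graph z (Pr As i (Fv z)) (As ! i) (prodset As Xs)) \<Longrightarrow>
      p ||- Mem (Tup [s, u]) (proj_graph As ?Xs i)"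
      unfolding forces_graph[OF t(1) c] forces_proj_graph[OF r(2) assms(2,3)] using e by simp_all
  qed
  finally show ?thesis using Prd_T[OF assms(1,2)] by (simp add: arr_def)
qed

lemma wf_nth: "wft (Prod As) \<Longrightarrow> i < length As \<Longrightarrow> wft (As ! i)"
  by simp

lemma cls_list_univ: "wft (Prod As) \<Longrightarrow> cls_list (map univ As) As"
  by (auto simp: cls_list_def list_all2_conv_all_nth intro!: cl_univ)

text \<open>The sets agree in their elements but are different terms, so the equation holds between
  classes.\<close>

lemma prodset_univ:
  assumes "wft (Prod As)" shows "cls L S (prodset As (map univ As)) = cls L S (univ (Prod As))"
proof (rule cls_eqI)
  have l: "length As \<noteq> 1" using assms by simp
  note c = cls_list_univ[OF assms]
  show "cl (prodset As (map univ As)) (Pw (Prod As))" using c l by (rule cl_prodset)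
  show "cl (univ (Prod As)) (Pw (Prod As))" using assms by (rule cl_univ)
  fix p a assume a: "over p a (Prod As)"
  show "p ||- Mem a (univ (Prod As))" using a forces_univ[OF assms] by simp
  show "p ||- Mem a (prodset As (map univ As))"
    using a wf_nth[OF assms] unfolding forces_prodset[OF c l] by (auto simp: forces_univ intro: over_Pr)
qed

lemma Prd_univ: "wft (Prod As) \<Longrightarrow> Prd T (map (\<lambda>A. cls L S (univ A)) As) = cls L S (univ (Prod As))"
  using Prd_T[OF cls_list_univ] prodset_univ[of As] by (simp add: o_def)

lemma Pj_univ:
  assumes "wft (Prod As)" "i < length As" "snd z = Prod As"
  shows "Pj T (map (\<lambda>A. cls L S (univ A)) As) i
    = arr (graph z (Pr As i (Fv z)) (As ! i) (univ (Prod As))) (univ (Prod As)) (univ (As ! i))"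
    "tm_in z (Pr As i (Fv z)) (As ! i)"
    "fun_rel (Prod As) (As ! i) (graph z (Pr As i (Fv z)) (As ! i) (univ (Prod As))) (univ (Prod As)) (univ (As ! i))"
proof -
  have l: "length As \<noteq> 1" using assms(1) by simp
  note c = cls_list_univ[OF assms(1)]
  note g = prod_graph[OF c l assms(2,3)]
  show t: "tm_in z (Pr As i (Fv z)) (As ! i)" by (rule g(1))
  show "Pj T (map (\<lambda>A. cls L S (univ A)) As) i
    = arr (graph z (Pr As i (Fv z)) (As ! i) (univ (Prod As))) (univ (Prod As)) (univ (As ! i))"
    using Pj_T[OF c l assms(2,3)] graph_cong[OF t, of "univ (Prod As)" "prodset As (map univ As)"]
      prodset_univ[OF assms(1)] cl_univ[OF assms(1)] cl_prodset[OF c l] assms(2,3)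
    by (simp add: arr_def o_def)
  show "fun_rel (Prod As) (As ! i) (graph z (Pr As i (Fv z)) (As ! i) (univ (Prod As))) (univ (Prod As)) (univ (As ! i))"
    using fun_rel_graph_univ[OF t, of "univ (Prod As)"] cl_univ[OF assms(1)] assms(3) by simp
qed

text \<open>For existence, \<open>H\<close> has the components \<open>G i\<close>. For uniqueness,
  any other solution \<open>K\<close> is included in \<open>H\<close>, because elements of a product
  type with equal projections are equal.\<close>

lemma tuple_eqI:
  assumes X: "cl X (Pw A)" and l: "length Bs \<noteq> 1" "length fs = length Bs"
    and fs: "\<And>i. i < length Bs \<Longrightarrow> fs ! i = arr (G i) X (univ (Bs ! i))"
      "\<And>i. i < length Bs \<Longrightarrow> fun_rel A (Bs ! i) (G i) X (univ (Bs ! i))"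
    and H: "fun_rel A (Prod Bs) H X (univ (Prod Bs))"
    and HG: "\<And>i p s t. i < length Bs \<Longrightarrow> p ||- Mem (Tup [s, t]) H \<Longrightarrow> p ||- Mem (Tup [s, Pr Bs i t]) (G i)"
  shows "tuple T (cls L S X) fs = arr H X (univ (Prod Bs))"
proof -
  let ?z = "(0, Prod Bs)"
  have wB: "wft (Prod Bs)" using cl_wf[OF fun_rel_cl(3)[OF H]] by auto
  have cod: "map (Cod T) fs = map (\<lambda>B. cls L S (univ B)) Bs"
    using l(2) fs(1) by (intro nth_equalityI) auto
  have c: "cl (univ (Prod Bs)) (Pw (snd ?z))" using cl_univ[OF wB] by simp
  have g: "p ||- Mem (Tup [s, t]) (graph ?z (Pr Bs i (Fv ?z)) (Bs ! i) (univ (Prod Bs))) \<longleftrightarrow>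
      over p s (Prod Bs) \<and> p ||- Eq t (Pr Bs i s)" if "i < length Bs" for p s t i
    using forces_graph[OF Pj_univ(2)[OF wB that] c, of p s t] by (simp add: forces_univ[OF wB])
  show ?thesis unfolding tuple_def cod Let_def
  proof (rule the_equality)
    show "arr H X (univ (Prod Bs)) \<in> hom T (cls L S X) (Prd T (map (\<lambda>B. cls L S (univ B)) Bs)) \<and>
      (\<forall>i<length fs. Cmp T (Pj T (map (\<lambda>B. cls L S (univ B)) Bs) i) (arr H X (univ (Prod Bs))) = fs ! i)"
    proof (intro conjI allI impI)
      show "arr H X (univ (Prod Bs)) \<in> hom T (cls L S X) (Prd T (map (\<lambda>B. cls L S (univ B)) Bs))"
        unfolding Prd_univ[OF wB] using H by (rule homI)
      fix i assume "i < length fs"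
      then have i: "i < length Bs" using l by simp
      note P = Pj_univ[OF wB i, of ?z, simplified]
      show "Cmp T (Pj T (map (\<lambda>B. cls L S (univ B)) Bs) i) (arr H X (univ (Prod Bs))) = fs ! i"
        unfolding P(1) fs(1)[OF i]
      proof (rule Cmp_eqI[OF H P(3) fs(2)[OF i]])
        fix p s t u assume t: "p ||- Mem (Tup [s, t]) H"
          and "p ||- Mem (Tup [t, u]) (graph ?z (Pr Bs i (Fv ?z)) (Bs ! i) (univ (Prod Bs)))"
        then have "p ||- Eq u (Pr Bs i t)" using g[OF i] by simp
        then show "p ||- Mem (Tup [s, u]) (G i)"
          using forces_Mem_pair_eq[OF HG[OF i t]] forces_refl fun_rel_over[OF H t] by (blast intro: forces_sym)
      qed
    qed
  next
    fix h assume h: "h \<in> hom T (cls L S X) (Prd T (map (\<lambda>B. cls L S (univ B)) Bs)) \<and>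
      (\<forall>i<length fs. Cmp T (Pj T (map (\<lambda>B. cls L S (univ B)) Bs) i) h = fs ! i)"
    have c': "cl (univ (Prod Bs)) (Pw (Prod Bs))" using c by simp
    obtain K where K: "h = arr K X (univ (Prod Bs))" "fun_rel A (Prod Bs) K X (univ (Prod Bs))"
      using h[THEN conjunct1, unfolded Prd_univ[OF wB]] X c' by (rule homE)
    have KG: "p ||- Mem (Tup [s, Pr Bs i t]) (G i)" if i: "i < length Bs" and t: "p ||- Mem (Tup [s, t]) K" for i p s t
    proof -
      note P = Pj_univ[OF wB i, of ?z, simplified]
      have "Cmp T (Pj T (map (\<lambda>B. cls L S (univ B)) Bs) i) h = fs ! i" using h i l by simp
      then have e: "Cmp T (arr (graph ?z (Pr Bs i (Fv ?z)) (Bs ! i) (univ (Prod Bs))) (univ (Prod Bs)) (univ (Bs ! i)))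
          (arr K X (univ (Prod Bs))) = arr (G i) X (univ (Bs ! i))"
        unfolding P(1) fs(1)[OF i] K(1) .
      have "over p t (Prod Bs)" using fun_rel_over[OF K(2) t] by simp
      then have "p ||- Mem (Tup [t, Pr Bs i t]) (graph ?z (Pr Bs i (Fv ?z)) (Bs ! i) (univ (Prod Bs)))"
        unfolding g[OF i] using i by (auto intro!: forces_refl over_Pr)
      with t show ?thesis by (rule Cmp_eqD[OF K(2) P(3) fun_rel_cl(3)[OF fs(2)[OF i]] e])
    qed
    have "cls L S K = cls L S H"
    proof (rule fun_rel_cls_eqI[OF K(2) H])
      fix p s t assume t: "p ||- Mem (Tup [s, t]) K"
      show "p ||- Mem (Tup [s, t]) H"
      proof (rule fun_rel_total[OF H fun_rel_dom[OF K(2) t]])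
        show "over p (Mem (Tup [s, t]) H) Om"
          using fun_rel_over[OF K(2) t] fun_rel_cl(3)[OF H] by (blast intro: over_Mem_pair)
        fix q t' assume q: "p \<preceq> q" and t': "q ||- Mem (Tup [s, t']) H"
        note tq = forces_mono[OF t q]
        have "q ||- Eq t' t"
        proof (rule forces_Eq_ProdI)
          show "over q t' (Prod Bs)" "over q t (Prod Bs)" using fun_rel_over[OF H t'] fun_rel_over[OF K(2) tq] by auto
          fix i assume i: "i < length Bs"
          show "q ||- Eq (Pr Bs i t') (Pr Bs i t)"
            using fun_rel_unique[OF fs(2)[OF i] HG[OF i t'] KG[OF i tq]] .
        qed
        then show "q ||- Mem (Tup [s, t]) H"
          using forces_Mem_pair_eq[OF t'] forces_refl fun_rel_over[OF H t'] by blast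
      qed
    qed
    then show "h = arr H X (univ (Prod Bs))" using K(1) by (simp add: arr_def)
  qed
qed

lemma tuple_graph:
  assumes X: "cl X (Pw (snd x))" and l: "length Bs \<noteq> 1" and \<tau>s: "list_all2 (tm_in x) \<tau>s Bs"
  shows "tuple T (cls L S X) (map2 (\<lambda>\<tau> B. arr (graph x \<tau> B X) X (univ B)) \<tau>s Bs)
    = arr (graph x (Tup \<tau>s) (Prod Bs) X) X (univ (Prod Bs))"
proof (rule tuple_eqI[OF X l, where G = "\<lambda>i. graph x (\<tau>s ! i) (Bs ! i) X"])
  note len = list_all2_lengthD[OF \<tau>s]
  have t: "tm_in x (\<tau>s ! i) (Bs ! i)" if "i < length Bs" for i
    using \<tau>s that by (simp add: list_all2_conv_all_nth)
  note tt = tm_in_Tup[OF l \<tau>s]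
  show "length (map2 (\<lambda>\<tau> B. arr (graph x \<tau> B X) X (univ B)) \<tau>s Bs) = length Bs" using len by simp
  show "fun_rel (snd x) (Prod Bs) (graph x (Tup \<tau>s) (Prod Bs) X) X (univ (Prod Bs))" using tt X by (rule fun_rel_graph_univ)
  fix i assume i: "i < length Bs"
  show "map2 (\<lambda>\<tau> B. arr (graph x \<tau> B X) X (univ B)) \<tau>s Bs ! i = arr (graph x (\<tau>s ! i) (Bs ! i) X) X (univ (Bs ! i))"
    using len i by simp
  show "fun_rel (snd x) (Bs ! i) (graph x (\<tau>s ! i) (Bs ! i) X) X (univ (Bs ! i))" using t[OF i] X by (rule fun_rel_graph_univ)
  fix p s u assume "p ||- Mem (Tup [s, u]) (graph x (Tup \<tau>s) (Prod Bs) X)"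
  then have s: "p ||- Mem s X" and u: "p ||- Eq u (inst1 x s (Tup \<tau>s))" by (simp_all only: forces_graph[OF tt X])
  have s': "over p s (snd x)" using s X by (rule cl_Mem_over)
  have tu: "over p (inst1 x s (Tup \<tau>s)) (Prod Bs)" using tt s' by (rule tm_in_inst1)
  have "list_all2 (over p) (map (inst1 x s) \<tau>s) Bs"
    using \<tau>s tm_in_inst1[OF _ s'] by (auto simp: list_all2_map1 elim: list_all2_mono)
  then have "p ||- Eq (Pr Bs i (inst1 x s (Tup \<tau>s))) (inst1 x s (\<tau>s ! i))"
    using forces_Pr_Tup[of p "map (inst1 x s) \<tau>s" Bs i] l i len by simp
  moreover have "p ||- Eq (Pr Bs i u) (Pr Bs i (inst1 x s (Tup \<tau>s)))"
    using u forces_Eq_over'[OF u tu] i by (rule forces_Pr_cong)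
  ultimately show "p ||- Mem (Tup [s, Pr Bs i u]) (graph x (\<tau>s ! i) (Bs ! i) X)"
    unfolding forces_graph[OF t[OF i] X] using s by (blast intro: forces_trans)
qed

lemma tuple_pair:
  assumes F: "fun_rel A B F X (univ B)" and G: "fun_rel A C G X (univ C)"
    and H: "fun_rel A (Prod [B, C]) H X (univ (Prod [B, C]))"
    and "\<And>p s t. p ||- Mem (Tup [s, t]) H \<Longrightarrow> p ||- Mem (Tup [s, Pr [B, C] 0 t]) F"
    and "\<And>p s t. p ||- Mem (Tup [s, t]) H \<Longrightarrow> p ||- Mem (Tup [s, Pr [B, C] (Suc 0) t]) G"
  shows "tuple T (cls L S X) [arr F X (univ B), arr G X (univ C)] = arr H X (univ (Prod [B, C]))"
  by (rule tuple_eqI[OF fun_rel_cl(1)[OF F], where G = "\<lambda>i. if i = 0 then F else G"])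
    (use assms in \<open>auto simp: less_Suc_eq\<close>)

text \<open>The arrow \<open>f\<close> is given by a relation and not by a term, so pairing terms
  does not cover it; the pairing is built as a relation by comprehension.\<close>

lemma ex_pair:
  assumes F: "fun_rel A B F X (univ B)" and G: "fun_rel A C G X (univ C)"
  obtains H where "fun_rel A (Prod [B, C]) H X (univ (Prod [B, C]))"
    "\<And>p s t. p ||- Mem (Tup [s, t]) H \<longleftrightarrow> over p t (Prod [B, C]) \<and> p ||- Mem (Tup [s, Pr [B, C] 0 t]) F \<and>
       p ||- Mem (Tup [s, Pr [B, C] (Suc 0) t]) G"
proof -
  note cF = fun_rel_cl(3)[OF F] and cG = fun_rel_cl(3)[OF G] and X = fun_rel_cl(1)[OF F]
  have w: "wft A" "wft B" "wft C" using cl_wf[OF cF] cl_wf[OF cG] by auto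
  define z :: "'g var" where "z = (0, Prod [A, Prod [B, C]])"
  \<comment> \<open>The variable \<open>z\<close> runs over the elements of the graph;
    \<open>s0\<close> and \<open>t0\<close> are its argument and its value, the latter a pair in
    turn.\<close>
  define s0 :: "('g, 'f) tm" where "s0 = Pr [A, Prod [B, C]] 0 (Fv z)"
  define t0 :: "('g, 'f) tm" where "t0 = Pr [A, Prod [B, C]] (Suc 0) (Fv z)"
  define \<alpha> where "\<alpha> = conj (Mem (Tup [s0, Pr [B, C] 0 t0]) F) (Mem (Tup [s0, Pr [B, C] (Suc 0) t0]) G)"
  define H where "H = compr z \<alpha>"
  have sz: "snd z = Prod [A, Prod [B, C]]" by (simp add: z_def)
  have ty: "has_ty L [] s0 A" "has_ty L [] t0 (Prod [B, C])"
    using w by (auto simp: s0_def t0_def sz)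
  have m: "has_ty L [] (Tup [s0, Pr [B, C] 0 t0]) (Prod [A, B])"
      "has_ty L [] (Tup [s0, Pr [B, C] (Suc 0) t0]) (Prod [A, C])"
    using ty by auto
  have \<alpha>: "formula L \<alpha>" unfolding \<alpha>_def
    using has_ty.intros(8)[OF m(1) cl_ty[OF cF]] has_ty.intros(8)[OF m(2) cl_ty[OF cG]]
    by (simp del: has_ty_Mem)
  have fv\<alpha>: "fv \<alpha> = {z}" using cl_fv[OF cF] cl_fv[OF cG] by (auto simp: \<alpha>_def s0_def t0_def)
  have cH: "cl H (Pw (Prod [A, Prod [B, C]]))"
    unfolding H_def closed_of_def using has_ty_compr[OF \<alpha>, of z] w fv\<alpha> sz by simp
  have H: "p ||- Mem (Tup [s, t]) H \<longleftrightarrow> over p t (Prod [B, C]) \<and> p ||- Mem (Tup [s, Pr [B, C] 0 t]) F \<and>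
       p ||- Mem (Tup [s, Pr [B, C] (Suc 0) t]) G" (is "?l \<longleftrightarrow> ?r") for p s t
  proof (cases "over p s A \<and> over p t (Prod [B, C])")
    case True
    then have stage: "over p s A" "over p t (Prod [B, C])" by auto
    have p: "stage p" using stage(1) by (rule over_stage)
    let ?stage = "Tup [s, t]"
    have stt: "over p ?stage (snd z)" using over_Tup2[OF stage] by (simp add: sz)
    note e = forces_Pr_Tup2[OF stage]
    have e0: "p ||- Eq (Pr [B, C] 0 (Pr [A, Prod [B, C]] (Suc 0) ?stage)) (Pr [B, C] 0 t)"
        "p ||- Eq (Pr [B, C] (Suc 0) (Pr [A, Prod [B, C]] (Suc 0) ?stage)) (Pr [B, C] (Suc 0) t)"
      using forces_Eq_over'[OF e(2) stage(2)] by (auto intro!: forces_Pr_cong[OF e(2)])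
    have "p ||- Mem ?stage (inst [] Fv (compr z \<alpha>) 0) \<longleftrightarrow> p ||- inst1 z ?stage \<alpha>"
      using fv\<alpha> p by (intro forces_Mem_compr[OF \<alpha> _ stt]) (auto simp: env_def)
    also have "\<dots> \<longleftrightarrow> ?r"
      using stage forces_Mem_pair_eq[OF _ e(1) e0(1), of F] forces_Mem_pair_eq[OF _ e(1)[THEN forces_sym] e0(1)[THEN forces_sym], of F]
        forces_Mem_pair_eq[OF _ e(1) e0(2), of G] forces_Mem_pair_eq[OF _ e(1)[THEN forces_sym] e0(2)[THEN forces_sym], of G]
      by (auto simp: \<alpha>_def forces_conj s0_def t0_def inst_cl[OF cF] inst_cl[OF cG])
    finally show ?thesis by (simp add: H_def inst_Fv)
  next
    case False
    then show ?thesis using cl_Mem_Tup2_over[OF _ cH] cl_Mem_Tup2_over[OF _ cF] by blast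
  qed
  have wBC: "wft (Prod [B, C])" using w by simp
  have "fun_rel A (Prod [B, C]) H X (univ (Prod [B, C]))"
  proof (rule fun_relI[OF X cl_univ[OF wBC] cH])
    show "p ||- Mem s X" if "p ||- Mem (Tup [s, t]) H" for p s t
      using that H by (blast intro: fun_rel_dom[OF F])
    show "p ||- Mem t (univ (Prod [B, C]))" if "p ||- Mem (Tup [s, t]) H" for p s t
      using that H by (simp add: forces_univ[OF wBC])
    show "p ||- Eq t t'" if "p ||- Mem (Tup [s, t]) H" "p ||- Mem (Tup [s, t']) H" for p s t t'
    proof (rule forces_Eq_ProdI)
      show "over p t (Prod [B, C])" "over p t' (Prod [B, C])" using that H by blast+
      show "p ||- Eq (Pr [B, C] i t) (Pr [B, C] i t')" if "i < length [B, C]" for i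
        using that \<open>p ||- Mem (Tup [s, t]) H\<close> \<open>p ||- Mem (Tup [s, t']) H\<close> H
        by (auto simp: less_Suc_eq intro: fun_rel_unique[OF F] fun_rel_unique[OF G])
    qed
    show "p ||- \<beta>" if s: "p ||- Mem s X" and \<beta>: "over p \<beta> Om"
      and *: "\<And>q t. p \<preceq> q \<Longrightarrow> q ||- Mem (Tup [s, t]) H \<Longrightarrow> q ||- \<beta>" for p s \<beta>
    proof (rule fun_rel_total[OF F s \<beta>])
      fix q t assume q: "p \<preceq> q" and t: "q ||- Mem (Tup [s, t]) F"
      show "q ||- \<beta>"
      proof (rule fun_rel_total[OF G forces_mono[OF s q] over_mono[OF \<beta> q]])
        fix r u assume r: "q \<preceq> r" and u: "r ||- Mem (Tup [s, u]) G"
        note t = forces_mono[OF t r]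
        have tu: "over r s A" "over r t B" "over r u C" using fun_rel_over[OF F t] fun_rel_over[OF G u] by auto
        \<comment> \<open>Totality: two successive extensions of the stage provide a value of
          \<open>F\<close> and then one of \<open>G\<close>; at the last stage their pair is a value
          of \<open>H\<close>.\<close>
        have "r ||- Mem (Tup [s, Tup [t, u]]) H"
          unfolding H using over_Tup2[OF tu(2,3)] forces_Mem_pair_eq[OF t forces_refl[OF tu(1)]]
            forces_Mem_pair_eq[OF u forces_refl[OF tu(1)]] forces_Pr_Tup2[OF tu(2,3)] by (blast intro: forces_sym)
        then show "r ||- \<beta>" using * le_trans[OF q r] by blast
      qed
    qed
  qed
  then show ?thesis using H that by blast
qed

section \<open>Truth values and power objects\<close>

lemma Idn_T:
  assumes "cl X (Pw A)"
  shows "Idn T (cls L S X) = arr (graph (0, A) (Fv (0, A)) A X) X X"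
proof -
  note r = rep_cls[OF assms]
  have "wft A" using assms by (rule cl_wf_Pw)
  then have "tm_in (0, A) (Fv (0, A)) A" by (simp add: tm_in_def)
  from graph_cong[OF this, of X "rep (cls L S X)"] assms r
  show ?thesis by (simp add: ling_topos_def Let_def mapsto_graph arr_def)
qed

lemma fun_rel_Idn:
  assumes "cl X (Pw A)"
  shows "fun_rel A A (graph (0, A) (Fv (0, A)) A X) X X"
  using fun_rel_graph[of "(0, A)" "Fv (0, A)" A X X] assms cl_wf_Pw[OF assms] by (simp add: tm_in_def)

lemma Pwr_univ:
  assumes "wft A" shows "Pwr T (cls L S (univ A)) = cls L S (univ (Pw A))"
proof -
  note c = cl_univ[OF assms]
  note r = rep_cls[OF c]
  have "Pwr T (cls L S (univ A)) = cls L S (powset A (rep (cls L S (univ A))))"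
    using r(4) by (simp add: ling_topos_def Let_def)
  also have "\<dots> = cls L S (univ (Pw A))"
  proof (rule cls_eqI[OF cl_powset[OF r(1)]])
    show "cl (univ (Pw A)) (Pw (Pw A))" using assms by (intro cl_univ) simp
    fix p a assume a: "over p a (Pw A)"
    then show "p ||- Mem a (univ (Pw A))" using assms by (simp add: forces_univ)
    show "p ||- Mem a (powset A (rep (cls L S (univ A))))"
      unfolding forces_powset[OF r(1)] r(3) forces_univ[OF assms] using a
      by (blast intro: forces_Mem_over over_ty over_mono)
  qed
  finally show ?thesis .
qed

lemma forces_Mem_Pr_cong:
  assumes "p ||- Eq r (Tup [s, u])" "over p s A" "over p u B"
  shows "p ||- Eq (Pr [A, B] 0 r) s" "p ||- Eq (Pr [A, B] (Suc 0) r) u"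
proof -
  have r: "over p r (Prod [A, B])" using assms by (blast intro: forces_Eq_over' over_Tup2)
  show "p ||- Eq (Pr [A, B] 0 r) s" "p ||- Eq (Pr [A, B] (Suc 0) r) u"
    using forces_Pr_cong[OF assms(1) r] forces_Pr_Tup2[OF assms(2,3)] by (auto intro: forces_trans)
qed

lemma forces_Eq_Mem_cong:
  assumes "p ||- Eq s s'" "p ||- Eq u u'" "over p s A" "over p u (Pw A)"
  shows "p ||- Eq (Mem s u) (Mem s' u')"
proof (rule forces_Eq_OmI)
  show "over p (Mem s u) Om" "over p (Mem s' u') Om"
    using assms forces_Eq_over by (blast intro: over_Mem)+
qed (use forces_mono[OF assms(1)] forces_mono[OF assms(2)] in \<open>blast intro: forces_Mem_cong forces_sym\<close>)+

lemma eps_graph_ty: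
  assumes "cl X (Pw A)"
  shows "has_ty L [] (Tup [Tup [Fv (0, A), Fv (1, Pw A)], Mem (Fv (0, A)) (Fv (1, Pw A))]) (Prod [Prod [A, Pw A], Om])"
    "formula L (conj (Mem (Fv (0, A)) X) (Mem (Fv (1, Pw A)) (powset A X)))"
    "\<forall>y\<in>set [(0, A), (1, Pw A)]. wft (snd y)"
    "fv (Tup [Tup [Fv (0, A), Fv (1, Pw A)], Mem (Fv (0, A)) (Fv (1, Pw A))]) \<union>
     fv (conj (Mem (Fv (0, A)) X) (Mem (Fv (1, Pw A)) (powset A X))) \<subseteq> set [(0, A), (1, Pw A)]"
  using assms cl_wf_Pw[OF assms] cl_ty[OF assms] cl_ty[OF cl_powset[OF assms]] cl_fv[OF assms]
    cl_fv[OF cl_powset[OF assms]] by auto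

text \<open>Over a universe both membership conditions in \<open>eps_graph\<close> hold for all
  elements of the right types, so the evaluation is the graph of a term in a single variable
  \<open>z\<close> of product type, the relation between the two projections of
  \<open>z\<close>.\<close>

lemma Eps_univ:
  assumes "wft A"
  defines "z \<equiv> (0, Prod [A, Pw A])"
  defines "\<epsilon> \<equiv> Mem (Pr [A, Pw A] 0 (Fv z)) (Pr [A, Pw A] (Suc 0) (Fv z))"
  shows "Eps T (cls L S (univ A)) = arr (graph z \<epsilon> Om (univ (Prod [A, Pw A]))) (univ (Prod [A, Pw A])) (univ Om)"
    "tm_in z \<epsilon> Om"
proof -
  have wP: "wft (Prod [A, Pw A])" using assms(1) by simp
  note c = cl_univ[OF assms(1)]
  note r = rep_cls[OF c]
  let ?X = "rep (cls L S (univ A))"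
  note ty = eps_graph_ty[OF r(1)]
  show \<epsilon>: "tm_in z \<epsilon> Om" using wP by (auto simp: \<epsilon>_def z_def tm_in_def)
  have cU: "cl (univ (Prod [A, Pw A])) (Pw (snd z))" using cl_univ[OF wP] by (simp add: z_def)
  have cE: "cl (eps_graph A ?X) (Pw (Prod [Prod [A, Pw A], Om]))"
    unfolding eps_graph_def Let_def by (intro cl_sabs ty)
  have g: "p ||- Mem (Tup [t, \<omega>]) (graph z \<epsilon> Om (univ (Prod [A, Pw A]))) \<longleftrightarrow> over p t (Prod [A, Pw A]) \<and>
      p ||- Eq \<omega> (Mem (Pr [A, Pw A] 0 t) (Pr [A, Pw A] (Suc 0) t))" for p t \<omega>
    unfolding forces_graph[OF \<epsilon> cU] forces_univ[OF wP] by (simp add: \<epsilon>_def)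
  have "cls L S (eps_graph A ?X) = cls L S (graph z \<epsilon> Om (univ (Prod [A, Pw A])))"
  proof (rule rel_cls_eqI[OF cE])
    show "cl (graph z \<epsilon> Om (univ (Prod [A, Pw A]))) (Pw (Prod [Prod [A, Pw A], Om]))"
      using cl_graph[OF \<epsilon> cU] by (simp add: z_def)
    fix p t \<omega>
    show "p ||- Mem (Tup [t, \<omega>]) (graph z \<epsilon> Om (univ (Prod [A, Pw A])))"
      if m: "p ||- Mem (Tup [t, \<omega>]) (eps_graph A ?X)"
    proof -
      have t: "over p t (Prod [A, Pw A])" "over p \<omega> Om" using cl_Mem_Tup2_over[OF m cE] by auto
      have "p ||- Eq \<omega> (Mem (Pr [A, Pw A] 0 t) (Pr [A, Pw A] (Suc 0) t))"
      proof (rule forces_sabsE[OF m[unfolded eps_graph_def Let_def] ty])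
        show "over p (Eq \<omega> (Mem (Pr [A, Pw A] 0 t) (Pr [A, Pw A] (Suc 0) t))) Om"
          using t by (auto intro!: over_Eq over_Mem[of _ _ A] over_Pr)
        fix q ss assume q: "p \<preceq> q" and "list_all2 (\<lambda>s x. over q s (snd x)) ss [(0, A), (1, Pw A)]"
          and e: "q ||- Eq (Tup [t, \<omega>]) (inst [] (upd Fv [(0, A), (1, Pw A)] ss)
            (Tup [Tup [Fv (0, A), Fv (1, Pw A)], Mem (Fv (0, A)) (Fv (1, Pw A))]) 0)"
        then obtain s u where su: "ss = [s, u]" "over q s A" "over q u (Pw A)" by (auto simp: list_all2_Cons2)
        have e: "q ||- Eq t (Tup [s, u])" "q ||- Eq \<omega> (Mem s u)"
          using e unfolding su(1) by (auto dest: forces_Eq_Tup2D)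
        note pr = forces_Mem_Pr_cong[OF e(1) su(2,3)]
        have "q ||- Eq (Mem s u) (Mem (Pr [A, Pw A] 0 t) (Pr [A, Pw A] (Suc 0) t))"
          using forces_Eq_Mem_cong[OF pr[THEN forces_sym] su(2,3)] .
        with e(2) show "q ||- Eq \<omega> (Mem (Pr [A, Pw A] 0 t) (Pr [A, Pw A] (Suc 0) t))" by (rule forces_trans)
      qed
      then show ?thesis unfolding g using t(1) by simp
    qed
    show "p ||- Mem (Tup [t, \<omega>]) (eps_graph A ?X)"
      if m: "p ||- Mem (Tup [t, \<omega>]) (graph z \<epsilon> Om (univ (Prod [A, Pw A])))"
    proof -
      have t: "over p t (Prod [A, Pw A])"
        and e: "p ||- Eq \<omega> (Mem (Pr [A, Pw A] 0 t) (Pr [A, Pw A] (Suc 0) t))" using m by (auto simp: g)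
      have pt: "over p (Pr [A, Pw A] 0 t) A" "over p (Pr [A, Pw A] (Suc 0) t) (Pw A)"
        using t by (auto intro: over_Pr)
      have \<omega>: "over p \<omega> Om" using e over_Mem[OF pt] by (rule forces_Eq_over')
      have P: "p ||- Mem (Pr [A, Pw A] (Suc 0) t) (powset A ?X)"
        unfolding forces_powset[OF r(1)] r(3) forces_univ[OF assms(1)] using pt(2)
        by (blast intro: forces_Mem_over over_ty over_mono)
      have X: "p ||- Mem (Pr [A, Pw A] 0 t) ?X" unfolding r(3) forces_univ[OF assms(1)] using pt by simp
      show ?thesis unfolding eps_graph_def Let_def
        using t e \<omega> pt P X inst_cl[OF r(1)] inst_cl[OF cl_powset[OF r(1)]]
        by (intro forces_sabsI[OF ty, of p "[Pr [A, Pw A] 0 t, Pr [A, Pw A] (Suc 0) t]"])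
          (auto simp: forces_conj intro: forces_Eq_Tup2I forces_eta2 over_Tup2)
    qed
  qed
  moreover have "Prd T [cls L S (univ A), Pwr T (cls L S (univ A))] = cls L S (univ (Prod [A, Pw A]))"
    using Prd_univ[OF wP] Pwr_univ[OF assms(1)] by simp
  moreover have "Eps T (cls L S (univ A)) =
      (cls L S (eps_graph A ?X), Prd T [cls L S (univ A), Pwr T (cls L S (univ A))], cls L S (univ Om))"
    using r(4) by (simp add: ling_topos_def Let_def)
  ultimately show "Eps T (cls L S (univ A)) = arr (graph z \<epsilon> Om (univ (Prod [A, Pw A]))) (univ (Prod [A, Pw A])) (univ Om)"
    by (simp add: arr_def)
qed

section \<open>The arrow true and the top of the order\<close>

lemma wf_One: "wft One"
  by simp

text \<open>The arrow into the terminal object is the graph of the empty tuple, and composing it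
  with true substitutes into the closed term \<open>tt\<close>.\<close>

lemma true_on_T:
  assumes "cl X (Pw (snd x))"
  shows "true_on T (cls L S X) = arr (graph x tt Om X) X (univ Om)"
proof -
  have l: "cls_list [] []" by (simp add: cls_list_def)
  have cP: "cl (prodset [] []) (Pw One)" using cl_prodset[OF l] by simp
  have eP: "cls L S (prodset [] []) = cls L S (univ One)" using prodset_univ[OF wf_One] by simp
  have "Tru T = arr (graph (0, One) tt Om (prodset [] [])) (prodset [] []) (univ Om)"
    by (simp add: ling_topos_def Let_def mapsto_graph)
  also have "\<dots> = arr (graph (0, One) tt Om (univ One)) (univ One) (univ Om)"
    using graph_cong[OF tm_in_tt, of "univ One" "(0, One)" "prodset [] []"] cP cl_univ[OF wf_One] eP
    by (simp add: arr_def)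
  finally have tru: "Tru T = arr (graph (0, One) tt Om (univ One)) (univ One) (univ Om)" .
  have tup: "tuple T (cls L S X) [] = arr (graph x (Tup []) One X) X (univ One)"
    using tuple_graph[OF assms, of "[]" "[]"] by simp
  have t: "tm_in x (Tup []) (snd (0 :: nat, One))" by (simp add: tm_in_def)
  show ?thesis unfolding true_on_def tru tup
    using Cmp_graph_univ[OF t tm_in_tt assms] by simp
qed

lemma fun_rel_true: "cl X (Pw (snd x)) \<Longrightarrow> fun_rel (snd x) Om (graph x tt Om X) X (univ Om)"
  using fun_rel_graph_univ[OF tm_in_tt] .

lemma forces_true: "cl X (Pw (snd x)) \<Longrightarrow> p ||- Mem (Tup [s, t]) (graph x tt Om X) \<longleftrightarrow> p ||- Mem s X \<and> p ||- t"
  unfolding forces_graph[OF tm_in_tt] by (simp add: forces_Eq_tt)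

lemma Cmp_true_on:
  assumes "fun_rel A B M Y X"
  shows "Cmp T (true_on T (cls L S X)) (arr M Y X) = true_on T (cls L S Y)"
proof -
  let ?x = "(0, B)" and ?y = "(0, A)"
  have c: "cl X (Pw (snd ?x))" "cl Y (Pw (snd ?y))" using fun_rel_cl(1,2)[OF assms] by simp_all
  show ?thesis unfolding true_on_T[OF c(1)] true_on_T[OF c(2)]
  proof (rule Cmp_eqI[OF assms])
    show "fun_rel B Om (graph ?x tt Om X) X (univ Om)" "fun_rel A Om (graph ?y tt Om Y) Y (univ Om)"
      using fun_rel_true[OF c(1)] fun_rel_true[OF c(2)] by simp_all
  qed (auto simp: forces_true[OF c(1)] forces_true[OF c(2)] intro: fun_rel_dom[OF assms])
qed

text \<open>Composites with \<open>true_on\<close> are true, so the universal property of a kernel \<open>n\<close> of \<open>true_on\<close> yields the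
  factorization of every \<open>m\<close> through \<open>n\<close>.\<close>

lemma leq_true_on:
  assumes "u \<in> hom T (cls L S X) (cls L S (univ Om))" "cl X (Pw A)"
  shows "leq T u (true_on T (cls L S X))"
  unfolding leq_def
proof (intro allI impI)
  fix m n assume k: "kernel T m u \<and> kernel T n (true_on T (cls L S X))"
  have tr: "true_on T (cls L S X) \<in> hom T (cls L S X) (cls L S (univ Om))"
    using true_on_T[of X "(0, A)"] fun_rel_true[of X "(0, A)"] assms(2) by (auto intro: homI)
  have cod: "Cod T m = cls L S X" "Cod T n = cls L S X" and m: "m \<in> Arr T"
    using k assms(1) tr by (auto simp: kernel_def hom_def)
  obtain M C D Y Z where M: "m = arr M Y Z" "fun_rel C D M Y Z" using m by (auto simp: Arr_T)
  have "m \<in> hom T (cls L S Y) (cls L S X)" using M(1) m cod by (simp add: hom_def)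
  then obtain M' where M': "m = arr M' Y X" "fun_rel C A M' Y X"
    by (rule homE[OF _ fun_rel_cl(1)[OF M(2)] assms(2)])
  have "Cmp T (true_on T (cls L S X)) m = true_on T (Dom T m)"
    using Cmp_true_on[OF M'(2)] M'(1) by simp
  then show "\<exists>k\<in>hom T (Dom T m) (Dom T n). Cmp T n k = m"
    using k m cod unfolding kernel_def by metis
qed

text \<open>The meet of no arrows is the top element. This is the left-hand side of the validity
  condition for a sequent without hypotheses.\<close>

lemma is_meet_empty:
  assumes "cl X (Pw A)"
  shows "is_meet T (cls L S X) {} (true_on T (cls L S X))"
proof -
  have "true_on T (cls L S X) \<in> hom T (cls L S X) (cls L S (univ Om))"
    using true_on_T[of X "(0, A)"] fun_rel_true[of X "(0, A)"] assms by (auto intro: homI)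
  then show ?thesis unfolding is_meet_def Omg_T using leq_true_on[OF _ assms] by blast
qed

text \<open>Arrows into a power object are given by terms: \<open>\<eta>\<close> is \<open>{a : \<exists>u. \<langle>x,u\<rangle> \<in> H \<and> a \<in> u}\<close>.\<close>

lemma ex_power_term:
  assumes H: "fun_rel (snd x) (Pw B) H X (univ (Pw B))"
  obtains \<eta> where "tm_in x \<eta> (Pw B)" "cls L S H = cls L S (graph x \<eta> (Pw B) X)"
proof -
  note cH = fun_rel_cl(3)[OF H] and X = fun_rel_cl(1)[OF H]
  have w: "wft (snd x)" "wft B" using cl_wf[OF cH] by auto
  obtain a where a: "snd a = B" "a \<notin> {x}" by (rule fresh_varE[of "{x}" B]) auto
  obtain u where u: "snd u = Pw B" "u \<notin> {x, a}" by (rule fresh_varE[of "{x, a}" "Pw B"]) auto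
  have ne: "a \<noteq> x" "u \<noteq> x" "u \<noteq> a" "x \<noteq> a" "x \<noteq> u" "a \<noteq> u" using a u by auto
  define \<beta> where "\<beta> = conj (Mem (Tup [Fv x, Fv u]) H) (Mem (Fv a) (Fv u))"
  define \<eta> where "\<eta> = compr a (ex u \<beta>)"
  have m: "has_ty L [] (Tup [Fv x, Fv u]) (Prod [snd x, Pw B])" using w u by simp
  have \<beta>: "formula L \<beta>" unfolding \<beta>_def
    using has_ty.intros(8)[OF m cl_ty[OF cH]] w a u by simp
  have fv\<beta>: "fv \<beta> = {x, u, a}" using cl_fv[OF cH] by (auto simp: \<beta>_def)
  have ex: "formula L (ex u \<beta>)" using \<beta> w u by (intro has_ty_ex) auto
  have \<eta>: "tm_in x \<eta> (Pw B)"
    unfolding \<eta>_def tm_in_def using has_ty_compr[OF ex, of a] w a fv\<beta> by auto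
  \<comment> \<open>Given a value \<open>t\<close> of \<open>H\<close> at \<open>s\<close>, the
    existential over \<open>u\<close> can only be met by elements equal to \<open>t\<close>, so the
    set \<eta> at \<open>s\<close> has the elements of \<open>t\<close>.\<close>
  have eqv: "q ||- Mem b (inst1 x s \<eta>) \<longleftrightarrow> q ||- Mem b t"
    if t: "q ||- Mem (Tup [s, t]) H" and b: "over q b B" for q b s t
  proof -
    have stage: "over q s (snd x)" "over q t (Pw B)" using fun_rel_over[OF H t] by auto
    have q: "stage q" using b by (rule over_stage)
    have e: "env q (Fv(x := s, a := b)) (fv \<beta> - {u})"
      using q stage b fv\<beta> a ne by (auto simp: env_def)
    have "q ||- Mem b (inst1 x s \<eta>) \<longleftrightarrow> q ||- inst [] (Fv(x := s, a := b)) (ex u \<beta>) 0"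
      unfolding \<eta>_def using q stage b fv\<beta> a by (intro forces_Mem_compr[OF ex]) (auto simp: env_def)
    also have "\<dots> \<longleftrightarrow> q ||- Mem b t"
    proof
      assume *: "q ||- inst [] (Fv(x := s, a := b)) (ex u \<beta>) 0"
      show "q ||- Mem b t"
      proof (rule forces_exE[OF * \<beta> _ e])
        show "over q (Mem b t) Om" using b stage by (auto intro: over_Mem)
        fix r t' assume r: "q \<preceq> r" and "r ||- inst [] (Fv(x := s, a := b, u := t')) \<beta> 0"
        then have t': "r ||- Mem (Tup [s, t']) H" "r ||- Mem b t'"
          using ne cH by (auto simp: \<beta>_def forces_conj)
        then show "r ||- Mem b t" using fun_rel_unique[OF H t'(1) forces_mono[OF t r]] by (blast intro: forces_Eq_PwD)
      qed (use w u in simp)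
    next
      assume "q ||- Mem b t"
      then show "q ||- inst [] (Fv(x := s, a := b)) (ex u \<beta>) 0"
        using stage(2) u t ne cH by (intro forces_exI[OF \<beta> e, of t]) (auto simp: \<beta>_def forces_conj)
    qed
    finally show ?thesis .
  qed
  have "cls L S H = cls L S (graph x \<eta> (Pw B) X)"
  proof (rule fun_rel_cls_eqI[OF H fun_rel_graph_univ[OF \<eta> X]])
    fix p s t assume t: "p ||- Mem (Tup [s, t]) H"
    have stage: "over p s (snd x)" "over p t (Pw B)" using fun_rel_over[OF H t] by auto
    have "p ||- Eq t (inst1 x s \<eta>)"
      using stage tm_in_inst1[OF \<eta> stage(1)] eqv[OF forces_mono[OF t]] by (intro forces_Eq_PwI) auto
    then show "p ||- Mem (Tup [s, t]) (graph x \<eta> (Pw B) X)"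
      unfolding forces_graph[OF \<eta> X] using fun_rel_dom[OF H t] by simp
  qed
  then show ?thesis using \<eta> that by blast
qed

text \<open>The hypothesis \<open>rel\<close> says that \<phi> at a pair of \<open>a\<close> and
  \<open>s\<close> expresses membership of \<open>a\<close> in \<eta> at \<open>s\<close>, which is
  what a transpose must satisfy. For uniqueness, every candidate is first turned into a term by
  \<open>ex_power_term\<close>; sets with the same elements are then equal.\<close>

lemma transpose_T:
  fixes x z :: "'g var"
  assumes X: "cl X (Pw (snd x))" and A: "wft A" and \<eta>: "tm_in x \<eta> (Pw A)"
    and z: "snd z = Prod [A, snd x]" and \<phi>: "tm_in z \<phi> Om"
    and rel: "\<And>p a s. over p a A \<Longrightarrow> p ||- Mem s X \<Longrightarrow> p ||- Mem a (inst1 x s \<eta>) \<longleftrightarrow> p ||- inst1 z (Tup [a, s]) \<phi>"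
  defines "X1 \<equiv> prodset [A, snd x] [univ A, X]"
  shows "transpose T (cls L S (univ A)) (cls L S X) (arr (graph z \<phi> Om X1) X1 (univ Om))
    = arr (graph x \<eta> (Pw A) X) X (univ (Pw A))"
proof -
  have cl1: "cls_list [univ A, X] [A, snd x]" using X cl_univ[OF A] by (simp add: cls_list_def)
  have wx: "wft (snd x)" using X by (rule cl_wf_Pw)
  have X1: "cl X1 (Pw (snd z))" using cl_prodset[OF cl1] z by (simp add: X1_def)
  define z0 z1 where "z0 = (Pr [A, snd x] 0 (Fv z) :: ('g, 'f) tm)"
    and "z1 = (Pr [A, snd x] (Suc 0) (Fv z) :: ('g, 'f) tm)"
  have t0: "tm_in z z0 A" and t1: "tm_in z z1 (snd x)"
    and f0: "fun_rel (Prod [A, snd x]) A (graph z z0 A X1) X1 (univ A)"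
    and f1: "fun_rel (Prod [A, snd x]) (snd x) (graph z z1 (snd x) X1) X1 X"
    using prod_graph[OF cl1, of 0 z] prod_graph[OF cl1, of 1 z] z by (simp_all add: X1_def z0_def z1_def)
  have P: "Prd T [cls L S (univ A), cls L S X] = cls L S X1"
    "Pj T [cls L S (univ A), cls L S X] 0 = arr (graph z z0 A X1) X1 (univ A)"
    "Pj T [cls L S (univ A), cls L S X] 1 = arr (graph z z1 (snd x) X1) X1 X"
    using Prd_T[OF cl1] Pj_T[OF cl1, of 0 z] Pj_T[OF cl1, of 1 z] z by (simp_all add: X1_def z0_def z1_def)
  define w where "w = (0 :: nat, Prod [A, Pw A])"
  define \<epsilon> :: "('g, 'f) tm" where "\<epsilon> = Mem (Pr [A, Pw A] 0 (Fv w)) (Pr [A, Pw A] (Suc 0) (Fv w))"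
  note Eps = Eps_univ[OF A, folded w_def, folded \<epsilon>_def]
  \<comment> \<open>\<open>M h\<close> is the term for the composite of the evaluation with
    \<open>h\<close>: at a pair of \<open>a\<close> and \<open>s\<close> it asserts that
    \<open>a\<close> is an element of \<open>h\<close> at \<open>s\<close>, up to reduction of
    projections.\<close>
  define M where "M h = inst1 w (Tup [z0, inst1 x z1 h]) \<epsilon>" for h
  have M: "tm_in z (M h) Om" if h: "tm_in x h (Pw A)" for h
    unfolding M_def using tm_in_Tup2[OF t0 tm_in_comp[OF h t1]] by (intro tm_in_comp[OF Eps(2)]) (simp add: w_def)
  have Mval: "p ||- inst1 z (Tup [a, s]) (M h) \<longleftrightarrow> p ||- Mem a (inst1 x s h)"
    if h: "tm_in x h (Pw A)" and a: "over p a A" and s: "over p s (snd x)" for h p a s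
  proof -
    let ?r = "Tup [a, s]"
    have r: "over p ?r (snd z)" using over_Tup2[OF a s] z by simp
    have e0: "p ||- Eq (inst1 z ?r z0) a" and e1: "p ||- Eq (inst1 z ?r z1) s"
      using forces_Pr_Tup2[OF a s] by (simp_all add: z0_def z1_def)
    have e2: "p ||- Eq (inst1 x (inst1 z ?r z1) h) (inst1 x s h)"
      using h e1 tm_in_inst1[OF t1 r] by (intro forces_inst1_cong) (auto simp: tm_in_def)
    have t: "over p (inst1 z ?r z0) A" "over p (inst1 x (inst1 z ?r z1) h) (Pw A)"
      using tm_in_inst1[OF t0 r] tm_in_inst1[OF h tm_in_inst1[OF t1 r]] .
    have sbM: "inst1 z ?r (M h) = Mem (Pr [A, Pw A] 0 (Tup [inst1 z ?r z0, inst1 x (inst1 z ?r z1) h]))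
        (Pr [A, Pw A] (Suc 0) (Tup [inst1 z ?r z0, inst1 x (inst1 z ?r z1) h]))"
      using inst1_comp[OF h t1] by (simp add: M_def \<epsilon>_def)
    have "p ||- Eq (Pr [A, Pw A] 0 (Tup [inst1 z ?r z0, inst1 x (inst1 z ?r z1) h])) a"
        "p ||- Eq (Pr [A, Pw A] (Suc 0) (Tup [inst1 z ?r z0, inst1 x (inst1 z ?r z1) h])) (inst1 x s h)"
      using forces_Pr_Tup2[OF t] e0 e2 by (blast intro: forces_trans)+
    then show ?thesis unfolding sbM by (blast intro: forces_Mem_cong forces_sym)
  qed
  have comp: "Cmp T (Eps T (cls L S (univ A))) (tuple T (cls L S X1) [arr (graph z z0 A X1) X1 (univ A),
      Cmp T (arr (graph x h (Pw A) X) X (univ (Pw A))) (arr (graph z z1 (snd x) X1) X1 X)]) =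
      arr (graph z (M h) Om X1) X1 (univ Om)"
    if h: "tm_in x h (Pw A)" for h
  proof -
    have "Cmp T (arr (graph x h (Pw A) X) X (univ (Pw A))) (arr (graph z z1 (snd x) X1) X1 X)
      = arr (graph z (inst1 x z1 h) (Pw A) X1) X1 (univ (Pw A))"
      using f1 z by (intro Cmp_graph[OF t1 h X1 _ fun_rel_graph_univ[OF h X]]) simp
    moreover have "tuple T (cls L S X1) [arr (graph z z0 A X1) X1 (univ A), arr (graph z (inst1 x z1 h) (Pw A) X1) X1 (univ (Pw A))]
      = arr (graph z (Tup [z0, inst1 x z1 h]) (Prod [A, Pw A]) X1) X1 (univ (Prod [A, Pw A]))"
      using tuple_graph[OF X1, of "[A, Pw A]" "[z0, inst1 x z1 h]"] t0 tm_in_comp[OF h t1] by simp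
    moreover have "Cmp T (Eps T (cls L S (univ A))) (arr (graph z (Tup [z0, inst1 x z1 h]) (Prod [A, Pw A]) X1) X1 (univ (Prod [A, Pw A])))
      = arr (graph z (M h) Om X1) X1 (univ Om)"
      using Cmp_graph_univ[of z "Tup [z0, inst1 x z1 h]" w, OF _ Eps(2) X1] tm_in_Tup2[OF t0 tm_in_comp[OF h t1]]
      by (simp add: Eps(1) M_def w_def)
    ultimately show ?thesis by simp
  qed
  have cU: "cl (univ (Pw A)) (Pw (Pw A))" using A by (intro cl_univ) simp
  have X1_pair: "p ||- Mem (Tup [a, s]) X1" if "over p a A" "p ||- Mem s X" for p a s
  proof -
    have s: "over p s (snd x)" using that(2) X by (rule cl_Mem_over)
    note e = forces_Pr_Tup2[OF that(1) s, THEN forces_sym]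
    have "p ||- Mem (Pr [A, snd x] 0 (Tup [a, s])) (univ A)"
      using that(1) by (intro forces_Mem_eq[OF e(1)]) (simp add: forces_univ[OF A])
    then show ?thesis
      using over_Tup2[OF that(1) s] forces_Mem_eq[OF e(2) that(2)]
      by (auto simp: X1_def forces_prodset[OF cl1] less_Suc_eq)
  qed
  show ?thesis unfolding transpose_def Let_def P Pwr_univ[OF A]
  proof (rule the_equality)
    \<comment> \<open>Each element of the product is equal to the pair of its projections, and at
      pairs \<open>rel\<close> applies.\<close>
    have "cls L S (graph z (M \<eta>) Om X1) = cls L S (graph z \<phi> Om X1)"
    proof (rule graph_eqI[OF M[OF \<eta>] \<phi> refl X1 X1 refl])
      fix p r assume r: "p ||- Mem r X1"
      have rt: "over p r (Prod [A, snd x])" and rX: "p ||- Mem (Pr [A, snd x] (Suc 0) r) X"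
        using r by (auto simp: X1_def forces_prodset[OF cl1] less_Suc_eq)
      let ?a = "Pr [A, snd x] 0 r" and ?s = "Pr [A, snd x] (Suc 0) r"
      have as: "over p ?a A" "over p ?s (snd x)" using rt by (auto intro: over_Pr)
      have e: "p ||- Eq (Tup [?a, ?s]) r" using forces_eta2[OF rt] by (rule forces_sym)
      have ast: "over p (Tup [?a, ?s]) (snd z)" using over_Tup2[OF as] z by simp
      have "p ||- Eq (inst1 z (Tup [?a, ?s]) (M \<eta>)) (inst1 z r (M \<eta>))" "p ||- Eq (inst1 z (Tup [?a, ?s]) \<phi>) (inst1 z r \<phi>)"
        using M[OF \<eta>] \<phi> e ast by (auto intro!: forces_inst1_cong simp: tm_in_def)
      moreover have "p ||- Eq (inst1 z (Tup [?a, ?s]) (M \<eta>)) (inst1 z (Tup [?a, ?s]) \<phi>)"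
      proof (rule forces_Eq_OmI[OF tm_in_inst1[OF M[OF \<eta>] ast] tm_in_inst1[OF \<phi> ast]])
        fix q assume q: "p \<preceq> q"
        note 1 = Mval[OF \<eta> over_mono[OF as(1) q] over_mono[OF as(2) q]]
        note 2 = rel[OF over_mono[OF as(1) q] forces_mono[OF rX q]]
        show "q ||- inst1 z (Tup [?a, ?s]) (M \<eta>) \<Longrightarrow> q ||- inst1 z (Tup [?a, ?s]) \<phi>"
          "q ||- inst1 z (Tup [?a, ?s]) \<phi> \<Longrightarrow> q ||- inst1 z (Tup [?a, ?s]) (M \<eta>)" using 1 2 by simp_all
      qed
      ultimately show "p ||- Eq (inst1 z r (M \<eta>)) (inst1 z r \<phi>)" by (blast intro: forces_trans forces_sym)
    qed
    then show "arr (graph x \<eta> (Pw A) X) X (univ (Pw A)) \<in> hom T (cls L S X) (cls L S (univ (Pw A))) \<and>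
      Cmp T (Eps T (cls L S (univ A))) (tuple T (cls L S X1) [arr (graph z z0 A X1) X1 (univ A),
        Cmp T (arr (graph x \<eta> (Pw A) X) X (univ (Pw A))) (arr (graph z z1 (snd x) X1) X1 X)])
      = arr (graph z \<phi> Om X1) X1 (univ Om)"
      using comp[OF \<eta>] homI[OF fun_rel_graph_univ[OF \<eta> X]] by (simp add: arr_def)
  next
    fix h assume h: "h \<in> hom T (cls L S X) (cls L S (univ (Pw A))) \<and>
      Cmp T (Eps T (cls L S (univ A))) (tuple T (cls L S X1) [arr (graph z z0 A X1) X1 (univ A),
        Cmp T h (arr (graph z z1 (snd x) X1) X1 X)])
      = arr (graph z \<phi> Om X1) X1 (univ Om)"
    then obtain H where H: "h = arr H X (univ (Pw A))" "fun_rel (snd x) (Pw A) H X (univ (Pw A))"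
      using X cU by (auto elim: homE)
    obtain k where k: "tm_in x k (Pw A)" "cls L S H = cls L S (graph x k (Pw A) X)"
      using H(2) by (rule ex_power_term)
    have hk: "h = arr (graph x k (Pw A) X) X (univ (Pw A))" using H(1) k(2) by (simp add: arr_def)
    have e: "arr (graph z (M k) Om X1) X1 (univ Om) = arr (graph z \<phi> Om X1) X1 (univ Om)"
      using h unfolding hk comp[OF k(1)] by simp
    note e = arr_eq_frelD[OF e cl_graph[OF M[OF k(1)] X1] cl_graph[OF \<phi> X1]]
    have "cls L S (graph x k (Pw A) X) = cls L S (graph x \<eta> (Pw A) X)"
    proof (rule graph_eqI[OF k(1) \<eta> refl X X refl])
      fix p s assume s: "p ||- Mem s X"
      have s': "over p s (snd x)" using s X by (rule cl_Mem_over)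
      show "p ||- Eq (inst1 x s k) (inst1 x s \<eta>)"
      proof (rule forces_Eq_PwI[OF tm_in_inst1[OF k(1) s'] tm_in_inst1[OF \<eta> s']])
        fix q a assume q: "p \<preceq> q" and a: "over q a A"
        note sq = forces_mono[OF s q] and sq' = over_mono[OF s' q]
        let ?r = "Tup [a, s]"
        have rt: "over q ?r (snd z)" using over_Tup2[OF a sq'] z by simp
        \<comment> \<open>The equation of arrows is evaluated at the pair of \<open>a\<close> and
          \<open>s\<close>: the value of \<open>M k\<close> there is also the value of
          \<phi>.\<close>
        have "q ||- Mem (Tup [?r, inst1 z ?r (M k)]) (graph z (M k) Om X1)"
          unfolding forces_graph[OF M[OF k(1)] X1] using X1_pair[OF a sq] forces_refl[OF tm_in_inst1[OF M[OF k(1)] rt]] by simp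
        then have "q ||- Eq (inst1 z ?r (M k)) (inst1 z ?r \<phi>)"
          unfolding e forces_graph[OF \<phi> X1] by simp
        then have "q ||- inst1 z ?r (M k) \<longleftrightarrow> q ||- inst1 z ?r \<phi>" by (blast intro: forces_Eq_OmD forces_sym)
        then show "q ||- Mem a (inst1 x s k) \<Longrightarrow> q ||- Mem a (inst1 x s \<eta>)"
          "q ||- Mem a (inst1 x s \<eta>) \<Longrightarrow> q ||- Mem a (inst1 x s k)"
          using Mval[OF k(1) a sq'] rel[OF a sq] by simp_all
      qed
    qed
    then show "h = arr (graph x \<eta> (Pw A) X) X (univ (Pw A))" using hk by (simp add: arr_def)
  qed
qed

section \<open>The characteristic arrow of the diagonal\<close>

text \<open>Two things have to be shown: the relation \<delta> between the two projections
  classifies the diagonal, and every arrow classifying the diagonal has the same graph as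
  \<delta>.\<close>

lemma eq_arr_univ:
  assumes A: "wft A"
  defines "z \<equiv> (0, Prod [A, A])"
  defines "\<delta> \<equiv> Eq (Pr [A, A] 0 (Fv z)) (Pr [A, A] (Suc 0) (Fv z))"
  shows "eq_arr T (cls L S (univ A)) = arr (graph z \<delta> Om (univ (Prod [A, A]))) (univ (Prod [A, A])) (univ Om)"
    "tm_in z \<delta> Om"
proof -
  let ?U = "univ A" and ?UU = "univ (Prod [A, A])" and ?y = "(0, A)"
  have wP: "wft (Prod [A, A])" using A by simp
  have U: "cl ?U (Pw A)" and UU: "cl ?UU (Pw (Prod [A, A]))" and UO: "cl (univ Om) (Pw Om)"
    using A wP by (auto intro: cl_univ)
  have U': "cl ?U (Pw (snd ?y))" and UU': "cl ?UU (Pw (snd z))" using U UU by (simp_all add: z_def)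
  show \<delta>: "tm_in z \<delta> Om" using wP by (auto simp: \<delta>_def z_def tm_in_def)
  let ?E = "graph z \<delta> Om ?UU"
  have fE: "fun_rel (Prod [A, A]) Om ?E ?UU (univ Om)" using fun_rel_graph_univ[OF \<delta> UU'] by (simp add: z_def)
  have gE: "p ||- Mem (Tup [t, \<omega>]) ?E \<longleftrightarrow> over p t (Prod [A, A]) \<and>
      p ||- Eq \<omega> (Eq (Pr [A, A] 0 t) (Pr [A, A] (Suc 0) t))" for p t \<omega>
    unfolding forces_graph[OF \<delta> UU'] forces_univ[OF wP] by (simp add: \<delta>_def)
  define d where "d = (Tup [Fv ?y, Fv ?y] :: ('g, 'f) tm)"
  have d: "tm_in ?y d (Prod [A, A])" unfolding d_def using A by (intro tm_in_Tup2) (auto simp: tm_in_def)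
  let ?D = "graph ?y d (Prod [A, A]) ?U"
  have fD: "fun_rel A (Prod [A, A]) ?D ?U ?UU" using fun_rel_graph_univ[OF d U'] by simp
  have gD: "p ||- Mem (Tup [a, t]) ?D \<longleftrightarrow> over p a A \<and> p ||- Eq t (Tup [a, a])" for p a t
    unfolding forces_graph[OF d U'] forces_univ[OF A] by (simp add: d_def)
  have diag: "tuple T (cls L S ?U) [Idn T (cls L S ?U), Idn T (cls L S ?U)] = arr ?D ?U ?UU"
    using tuple_graph[OF U', of "[A, A]" "[Fv ?y, Fv ?y]"] A Idn_T[OF U] by (simp add: d_def tm_in_def)
  \<comment> \<open>The first projection, a left inverse of the diagonal; it produces the
    factorizations.\<close>
  define K :: "('g, 'f) tm" where "K = graph z (Pr [A, A] 0 (Fv z)) A ?UU"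
  have K: "tm_in z (Pr [A, A] 0 (Fv z)) A" "fun_rel (Prod [A, A]) A K ?UU ?U"
    using Pj_univ(2,3)[OF wP, of 0 z] by (simp_all add: z_def K_def)
  have gK: "p ||- Mem (Tup [t, a]) K \<longleftrightarrow> over p t (Prod [A, A]) \<and> p ||- Eq a (Pr [A, A] 0 t)" for p t a
    unfolding K_def forces_graph[OF K(1) UU'] forces_univ[OF wP] by simp
  have trU: "true_on T (cls L S ?U) = arr (graph ?y tt Om ?U) ?U (univ Om)" using true_on_T[OF U'] .
  have tr_fr: "fun_rel B Om (graph (0, B) tt Om Y) Y (univ Om)" if "cl Y (Pw B)" for Y B
    using fun_rel_true[of Y "(0, B)"] that by simp
  have tr_g: "p ||- Mem (Tup [s, t]) (graph (0, B) tt Om Y) \<longleftrightarrow> p ||- Mem s Y \<and> p ||- t" if "cl Y (Pw B)" for Y B p s t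
    using forces_true[of Y "(0, B)"] that by simp
  have diag_eq: "p ||- Eq (Pr [A, A] 0 t) a \<and> p ||- Eq (Pr [A, A] (Suc 0) t) a"
    if "over p a A" "p ||- Eq t (Tup [a, a])" for p t a
    using forces_Mem_Pr_cong[OF that(2,1,1)] by simp
  have pair_eq: "p ||- Eq t (Tup [a, a])"
    if t: "over p t (Prod [A, A])" and "p ||- Eq a (Pr [A, A] 0 t)" "p ||- Eq (Pr [A, A] 0 t) (Pr [A, A] (Suc 0) t)" for p t a
    using forces_eta2[OF t] that(2,3) by (blast intro: forces_trans forces_sym forces_Eq_Tup2I)
  have ker: "kernel T (arr ?D ?U ?UU) (arr ?E ?UU (univ Om))"
    unfolding kernel_def Dom_T Cod_T Omg_T
  proof (intro conjI ballI impI)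
    show "arr ?D ?U ?UU \<in> Arr T" using fD by (rule ArrI)
    show "arr ?E ?UU (univ Om) \<in> hom T (cls L S ?UU) (cls L S (univ Om))" using fE by (rule homI)
    show "Cmp T (arr ?E ?UU (univ Om)) (arr ?D ?U ?UU) = true_on T (cls L S ?U)" unfolding trU
    proof (rule Cmp_eqI[OF fD fE tr_fr[OF U]])
      fix p s t \<omega> assume "p ||- Mem (Tup [s, t]) ?D" "p ||- Mem (Tup [t, \<omega>]) ?E"
      then have stage: "over p s A" "p ||- Eq t (Tup [s, s])" "p ||- Eq \<omega> (Eq (Pr [A, A] 0 t) (Pr [A, A] (Suc 0) t))"
        by (auto simp: gD gE)
      then have "p ||- \<omega>" using diag_eq[OF stage(1,2)] by (blast intro: forces_Eq_OmD forces_sym forces_trans)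
      then show "p ||- Mem (Tup [s, \<omega>]) (graph ?y tt Om ?U)" unfolding tr_g[OF U] forces_univ[OF A] using stage by simp
    qed
  next
    fix g assume g: "g \<in> Arr T"
      and gc: "Cod T g = cls L S ?UU \<and> Cmp T (arr ?E ?UU (univ Om)) g = true_on T (Dom T g)"
    obtain G0 C B0 Y Z where G0: "g = arr G0 Y Z" "fun_rel C B0 G0 Y Z" using g by (auto simp: Arr_T)
    note Y = fun_rel_cl(1)[OF G0(2)]
    have "g \<in> hom T (cls L S Y) (cls L S ?UU)" using G0(1) g gc by (simp add: hom_def)
    then obtain G where G: "g = arr G Y ?UU" "fun_rel C (Prod [A, A]) G Y ?UU" by (rule homE[OF _ Y UU])
    have "Cmp T (arr ?E ?UU (univ Om)) (arr G Y ?UU) = arr (graph (0, C) tt Om Y) Y (univ Om)"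
      using gc true_on_T[of Y "(0, C)"] Y G(1) by simp
    note D = Cmp_eqD[OF G(2) fE fun_rel_cl(3)[OF tr_fr[OF Y]] this]
    \<comment> \<open>The composite of \<open>G\<close> with \<delta> is true, and its value at
      \<open>s\<close> is the equation of the two components of \<open>t\<close>.\<close>
    have Gd: "p ||- Eq (Pr [A, A] 0 t) (Pr [A, A] (Suc 0) t)" if "p ||- Mem (Tup [s, t]) G" for p s t
    proof -
      have t: "over p t (Prod [A, A])" using fun_rel_over[OF G(2) that] by simp
      let ?e = "Eq (Pr [A, A] 0 t) (Pr [A, A] (Suc 0) t)"
      have "over p ?e Om" using t by (auto intro!: over_Eq[of _ _ A] over_Pr)
      then have "p ||- Mem (Tup [t, ?e]) ?E" unfolding gE using t forces_refl by blast
      from D[OF that this] show ?thesis unfolding tr_g[OF Y] by simp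
    qed
    let ?K = "comp_graph C (Prod [A, A]) A K G"
    note fK = fun_rel_comp[OF G(2) K(2)]
    have GK: "p ||- Mem (Tup [s, a]) ?K" if "p ||- Mem (Tup [s, t]) G" "p ||- Eq a (Pr [A, A] 0 t)" for p s t a
      using fun_rel_over[OF G(2) that(1)] that(2)
      by (intro comp_graphI[OF fun_rel_cl(3)[OF G(2)] fun_rel_cl(3)[OF K(2)] that(1)]) (simp add: gK)
    show "\<exists>!k. k \<in> hom T (Dom T g) (cls L S ?U) \<and> Cmp T (arr ?D ?U ?UU) k = g"
    \<comment> \<open>The factorization is \<open>G\<close> followed by the first
      projection.\<close>
    proof (rule ex1I[of _ "arr ?K Y ?U"])
      have "Cmp T (arr ?D ?U ?UU) (arr ?K Y ?U) = arr G Y ?UU"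
      proof (rule Cmp_eqI[OF fK fD G(2)])
        fix p s a v assume a: "p ||- Mem (Tup [s, a]) ?K" and "p ||- Mem (Tup [a, v]) ?D"
        then have v: "p ||- Eq v (Tup [a, a])" by (simp add: gD)
        have vt: "over p v (Prod [A, A])" using fun_rel_over[OF fK a] v by (blast intro: forces_Eq_over' over_Tup2)
        have Gt: "over p (Mem (Tup [s, v]) G) Om"
          using over_Mem_pair[OF fun_rel_cl(3)[OF G(2)]] fun_rel_over[OF fK a] vt by blast
        show "p ||- Mem (Tup [s, v]) G"
        proof (rule fun_rel_total[OF G(2) fun_rel_dom[OF fK a] Gt])
          fix q t assume q: "p \<preceq> q" and t: "q ||- Mem (Tup [s, t]) G"
          note tt = fun_rel_over[OF G(2) t]
          have "q ||- Mem (Tup [s, Pr [A, A] 0 t]) ?K"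
            using t tt by (auto intro!: GK forces_refl over_Pr)
          then have "q ||- Eq a (Pr [A, A] 0 t)" using fun_rel_unique[OF fK forces_mono[OF a q]] by blast
          then have "q ||- Eq t (Tup [a, a])" using tt Gd[OF t] by (blast intro: pair_eq)
          then have "q ||- Eq t v" using forces_mono[OF v q] by (blast intro: forces_trans forces_sym)
          then show "q ||- Mem (Tup [s, v]) G" using t tt by (blast intro: forces_Mem_pair_eq forces_refl)
        qed
      qed
      then show "arr ?K Y ?U \<in> hom T (Dom T g) (cls L S ?U) \<and> Cmp T (arr ?D ?U ?UU) (arr ?K Y ?U) = g"
        using homI[OF fK] G(1) by simp
    next
      fix k assume k: "k \<in> hom T (Dom T g) (cls L S ?U) \<and> Cmp T (arr ?D ?U ?UU) k = g"
      then have "k \<in> hom T (cls L S Y) (cls L S ?U)" using G(1) by simp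
      then obtain K' where K': "k = arr K' Y ?U" "fun_rel C A K' Y ?U" by (rule homE[OF _ Y U])
      have "Cmp T (arr ?D ?U ?UU) (arr K' Y ?U) = arr G Y ?UU" using k K'(1) G(1) by simp
      note D' = Cmp_eqD[OF K'(2) fD fun_rel_cl(3)[OF G(2)] this]
      have "cls L S K' = cls L S ?K"
      proof (rule fun_rel_cls_eqI[OF K'(2) fK])
        fix p s a assume a: "p ||- Mem (Tup [s, a]) K'"
        have at: "over p a A" using fun_rel_over[OF K'(2) a] by simp
        have "p ||- Mem (Tup [a, Tup [a, a]]) ?D" unfolding gD using at by (auto intro: forces_refl over_Tup2)
        from D'[OF a this] show "p ||- Mem (Tup [s, a]) ?K"
          using forces_Pr_Tup2(1)[OF at at] by (rule GK[OF _ forces_sym])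
      qed
      then show "k = arr ?K Y ?U" using K'(1) by (simp add: arr_def)
    qed
  qed
  have uniq: "u = arr ?E ?UU (univ Om)" if ku: "kernel T (arr ?D ?U ?UU) u" for u
  proof -
    have "u \<in> hom T (cls L S ?UU) (cls L S (univ Om))" using ku by (simp add: kernel_def)
    then obtain V where V: "u = arr V ?UU (univ Om)" "fun_rel (Prod [A, A]) Om V ?UU (univ Om)"
      by (rule homE[OF _ UU UO])
    note cV = fun_rel_cl(3)[OF V(2)]
    have "Cmp T (arr V ?UU (univ Om)) (arr ?D ?U ?UU) = arr (graph ?y tt Om ?U) ?U (univ Om)"
      using ku V(1) trU by (simp add: kernel_def)
    note DV = Cmp_eqD[OF fD V(2) fun_rel_cl(3)[OF tr_fr[OF U]] this]
    \<comment> \<open>The subset on which the given arrow \<open>V\<close> is true. The inclusion of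
      \<open>G0\<close> composed with \<open>V\<close> is true, so the kernel property makes it
      factor through the diagonal.\<close>
    define G0 where "G0 = compr z (Mem (Tup [Fv z, tt]) V)"
    have m: "has_ty L [] (Tup [Fv z, tt]) (Prod [Prod [A, A], Om])" using wP by (simp add: z_def)
    have f: "formula L (Mem (Tup [Fv z, tt]) V)" using has_ty.intros(8)[OF m cl_ty[OF cV]] .
    have G0: "cl G0 (Pw (Prod [A, A]))"
      using has_ty_compr[OF f, of z] wP cl_fv[OF cV] by (auto simp: G0_def closed_of_def z_def)
    have gG0: "p ||- Mem t G0 \<longleftrightarrow> p ||- Mem (Tup [t, tt]) V" if t: "over p t (Prod [A, A])" for p t
      using forces_Mem_compr[OF f, where p = p and \<sigma> = Fv and x = z and a = t] t over_stage[OF t] cl_fv[OF cV] cV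
      by (simp add: G0_def z_def env_def inst_Fv)
    define I where "I = graph z (Fv z) (Prod [A, A]) G0"
    have G0': "cl G0 (Pw (snd z))" using G0 by (simp add: z_def)
    have Iz: "tm_in z (Fv z) (Prod [A, A])" using wP by (simp add: tm_in_def z_def)
    have fI: "fun_rel (Prod [A, A]) (Prod [A, A]) I G0 ?UU" using fun_rel_graph_univ[OF Iz G0'] by (simp add: I_def z_def)
    have gI: "p ||- Mem (Tup [s, t]) I \<longleftrightarrow> p ||- Mem s G0 \<and> p ||- Eq t s" for p s t
      unfolding I_def forces_graph[OF Iz G0'] by simp
    have "Cmp T (arr V ?UU (univ Om)) (arr I G0 ?UU) = true_on T (cls L S G0)"
      unfolding true_on_T[OF G0']
    proof (rule Cmp_eqI[OF fI V(2)])
      show "fun_rel (Prod [A, A]) Om (graph z tt Om G0) G0 (univ Om)" using fun_rel_true[OF G0'] by (simp add: z_def)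
      fix p s t \<omega> assume stage: "p ||- Mem (Tup [s, t]) I" and t\<omega>: "p ||- Mem (Tup [t, \<omega>]) V"
      have s: "over p s (Prod [A, A])" "p ||- Mem s G0" "p ||- Eq t s" using stage fun_rel_over[OF fI stage] by (auto simp: gI)
      have "p ||- Mem (Tup [s, \<omega>]) V"
        using forces_Mem_pair_eq[OF t\<omega> s(3)] fun_rel_over[OF V(2) t\<omega>] by (blast intro: forces_refl)
      then have "p ||- Eq \<omega> tt" using s(2) unfolding gG0[OF s(1)] by (rule fun_rel_unique[OF V(2)])
      then show "p ||- Mem (Tup [s, \<omega>]) (graph z tt Om G0)"
        unfolding forces_graph[OF tm_in_tt G0'] using s by simp
    qed
    then obtain k where k: "k \<in> hom T (cls L S G0) (cls L S ?U)" "Cmp T (arr ?D ?U ?UU) k = arr I G0 ?UU"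
    proof -
      have "\<exists>!k. k \<in> hom T (cls L S G0) (cls L S ?U) \<and> Cmp T (arr ?D ?U ?UU) k = arr I G0 ?UU"
        using ku ArrI[OF fI] \<open>Cmp T (arr V ?UU (univ Om)) (arr I G0 ?UU) = true_on T (cls L S G0)\<close>
        unfolding kernel_def V(1) Dom_T Cod_T by (elim conjE ballE[of _ _ "arr I G0 ?UU"]) simp_all
      then show ?thesis using that by blast
    qed
    obtain K' where K': "k = arr K' G0 ?U" "fun_rel (Prod [A, A]) A K' G0 ?U" using k(1) by (rule homE[OF _ G0 U])
    note DK = Cmp_eqD[OF K'(2) fD fun_rel_cl(3)[OF fI] k(2)[unfolded K'(1)]]
    have "cls L S V = cls L S ?E"
    proof (rule fun_rel_cls_eqI[OF V(2) fE])
      fix p t \<omega> assume t\<omega>: "p ||- Mem (Tup [t, \<omega>]) V"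
      have tt: "over p t (Prod [A, A])" "over p \<omega> Om" using fun_rel_over[OF V(2) t\<omega>] by auto
      let ?e = "Eq (Pr [A, A] 0 t) (Pr [A, A] (Suc 0) t)"
      have e: "over p ?e Om" using tt by (auto intro!: over_Eq[of _ _ A] over_Pr)
      \<comment> \<open>The value \<omega> of \<open>V\<close> at \<open>t\<close> is equivalent to
        the equation of the components of \<open>t\<close>. If \<omega> holds, \<open>t\<close> lies
        in \<open>G0\<close> and is therefore diagonal; if \<open>t\<close> is diagonal, \<omega>
        holds because \<open>V\<close> is true on the diagonal.\<close>
      have "p ||- Eq \<omega> ?e"
      proof (rule forces_Eq_OmI[OF tt(2) e])
        fix q assume q: "p \<preceq> q" and \<omega>: "q ||- \<omega>"
        note tq = over_mono[OF tt(1) q]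
        have "q ||- Mem (Tup [t, tt]) V"
          using forces_Mem_pair_eq[OF forces_mono[OF t\<omega> q] forces_refl[OF tq]] \<omega> by (simp add: forces_Eq_tt)
        then have "q ||- Mem t G0" by (simp add: gG0[OF tq])
        then show "q ||- ?e"
        proof (rule fun_rel_total[OF K'(2) _ over_mono[OF e q]])
          fix r a assume r: "q \<preceq> r" and a: "r ||- Mem (Tup [t, a]) K'"
          have at: "over r a A" using fun_rel_over[OF K'(2) a] by simp
          have "r ||- Mem (Tup [a, Tup [a, a]]) ?D" unfolding gD using at by (auto intro: forces_refl over_Tup2)
          then have "r ||- Eq (Tup [a, a]) t" using DK[OF a] by (simp add: gI)
          then show "r ||- ?e" using diag_eq[OF at forces_sym] by (blast intro: forces_trans forces_sym)
        qed
      next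
        fix q assume q: "p \<preceq> q" and eq: "q ||- ?e"
        note tq = over_mono[OF tt(1) q]
        have at: "over q (Pr [A, A] 0 t) A" using tq by (auto intro: over_Pr)
        have "q ||- Eq t (Tup [Pr [A, A] 0 t, Pr [A, A] 0 t])" using tq forces_refl[OF at] eq by (rule pair_eq)
        then have "q ||- Mem (Tup [Pr [A, A] 0 t, t]) ?D" unfolding gD using at by simp
        from DV[OF this forces_mono[OF t\<omega> q]] show "q ||- \<omega>" unfolding tr_g[OF U] by simp
      qed
      then show "p ||- Mem (Tup [t, \<omega>]) ?E" unfolding gE using tt by simp
    qed
    then show ?thesis using V(1) by (simp add: arr_def)
  qed
  show "eq_arr T (cls L S ?U) = arr ?E ?UU (univ Om)"
    unfolding eq_arr_def diag using ker uniq by (rule the_equality)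
qed

end

section \<open>The natural interpretation\<close>

lemma fv_eta: "fv (eta L S t) = (\<lambda>x. (fst x, eta_ty L S (snd x))) ` fv t"
  by (induction t) (auto simp: image_Un)

context lst begin

section \<open>Types and function symbols of the internal language\<close>

abbreviation IL where "IL \<equiv> internal_lang T"

lemma gnds_IL: "gnds IL = Obj T - {Prd T [], Omg T}"
  by (simp add: internal_lang_def Let_def)

lemma fns_IL: "(g, A, B) \<in> fns IL \<longleftrightarrow> g \<in> Arr T \<and> wf_ty (gnds IL) A \<and> wf_ty (gnds IL) B \<and>
    ty_obj T (\<lambda>Z. Z) A = Dom T g \<and> ty_obj T (\<lambda>Z. Z) B = Cod T g"
  by (simp add: internal_lang_def Let_def)

lemma fdom_IL: "fdom IL (g, A, B) = A" and fcod_IL: "fcod IL (g, A, B) = B"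
  by (simp_all add: internal_lang_def Let_def)

lemma ty_obj_ty_sym: "ty_obj T (\<lambda>Z. Z) (ty_sym T Z) = Z"
  by (simp add: ty_sym_def)

lemma wf_ty_sym: "Z \<in> Obj T \<Longrightarrow> wf_ty (gnds IL) (ty_sym T Z)"
  by (simp add: ty_sym_def gnds_IL)

lemma cls_Obj: "cl X (Pw A) \<Longrightarrow> cls L S X \<in> Obj T"
  by (auto simp: Obj_T)

text \<open>By induction on types, since products and powers of universes are again universes, as
  classes. The ground case also covers a universe that is the terminal object or the truth value
  object: \<open>ty_sym\<close> denotes the right object in each case.\<close>

lemma ty_obj_eta: "wft A \<Longrightarrow> ty_obj T (\<lambda>Z. Z) (eta_ty L S A) = cls L S (univ A)"
proof (induction A)
  case (Gr g)
  then show ?case by (simp add: ty_obj_ty_sym)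
next
  case (Prod As)
  then have e: "map (\<lambda>A. ty_obj T (\<lambda>Z. Z) (eta_ty L S A)) As = map (\<lambda>A. cls L S (univ A)) As" by simp
  show ?case by (simp only: eta_ty.simps ty_obj.simps map_map o_def e Prd_univ[OF Prod.prems])
qed (simp_all add: Pwr_univ)

lemma wf_eta: "wft A \<Longrightarrow> wf_ty (gnds IL) (eta_ty L S A)"
proof (induction A)
  case (Gr g)
  then show ?case using cls_Obj[OF cl_univ[OF Gr]] by (simp add: wf_ty_sym)
qed auto

lemma eta_fn_IL:
  assumes "h \<in> fns L"
  shows "eta_fn L S h \<in> fns IL" "fdom IL (eta_fn L S h) = eta_ty L S (fdom L h)"
    "fcod IL (eta_fn L S h) = eta_ty L S (fcod L h)"
proof -
  let ?x = "(0, fdom L h)"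
  have w: "wft (fdom L h)" "wft (fcod L h)" using local_language assms by (auto simp: local_language_def)
  have "tm_in ?x (Fn h (Fv ?x)) (fcod L h)" using assms w by (simp add: tm_in_def)
  from fun_rel_graph_univ[OF this, of "univ (fdom L h)"] cl_univ[OF w(1)]
  have "fun_rel (fdom L h) (fcod L h) (graph ?x (Fn h (Fv ?x)) (fcod L h) (univ (fdom L h))) (univ (fdom L h)) (univ (fcod L h))"
    by simp
  then show "eta_fn L S h \<in> fns IL"
    using w by (simp add: eta_fn_def Let_def mapsto_graph fns_IL ArrI wf_eta ty_obj_eta)
qed (simp_all add: eta_fn_def Let_def fdom_IL fcod_IL)

lemma has_ty_eta:
  "has_ty L Bs t A \<Longrightarrow> has_ty IL (map (eta_ty L S) Bs) (eta L S t) (eta_ty L S A)"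
proof (induction rule: has_ty.induct)
  case (1 x Bs)
  then show ?case by (simp add: wf_eta)
next
  case (3 h Bs t)
  then show ?case by (simp add: eta_fn_IL)
next
  case (4 ts Bs As)
  then show ?case by (auto simp: list_all2_conv_all_nth)
next
  case (6 A Bs t)
  then show ?case by (simp add: wf_eta)
qed auto

section \<open>Interpretation of translated terms\<close>

lemma tm_in_inst:
  assumes "has_ty L Bs t B" "fv t = {}" "list_all2 (tm_in x) \<tau>s Bs"
  shows "tm_in x (inst \<tau>s Fv t 0) B"
proof -
  have "list_all2 (has_ty L []) \<tau>s Bs" using assms(3) by (auto simp: tm_in_def elim: list_all2_mono)
  then have "has_ty L [] (inst \<tau>s Fv t 0) B" using assms by (intro has_ty_inst[OF assms(1), of "[]" Bs]) auto
  moreover have "fv \<tau> \<subseteq> {x}" if "\<tau> \<in> set \<tau>s" for \<tau>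
    using assms(3) that by (auto simp: tm_in_def list_all2_conv_all_nth in_set_conv_nth)
  moreover have "fv (inst \<tau>s Fv t 0) \<subseteq> (\<Union>\<tau>\<in>set \<tau>s. fv \<tau>)" using fv_inst[of \<tau>s Fv t 0] assms(2) by simp
  ultimately show ?thesis unfolding tm_in_def by blast
qed

lemma inst1_inst:
  assumes "fv t = {}" "list_all2 (tm_in x) \<tau>s Bs"
  shows "inst1 y s (inst \<tau>s Fv t 0) = inst (map (inst1 y s) \<tau>s) Fv t 0"
proof -
  have "\<exists>A. has_ty L [] \<tau> A" if "\<tau> \<in> set \<tau>s" for \<tau>
    using assms(2) that by (auto simp: tm_in_def list_all2_conv_all_nth in_set_conv_nth)
  from inst_inst[of \<tau>s L t Fv "[]" "Fv(y := s)" 0, OF this] assms(1)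
  have "inst1 y s (inst \<tau>s Fv t 0) = inst (map (inst1 y s) \<tau>s) (\<lambda>z. inst1 y s (Fv z)) t 0" by simp
  also have "\<dots> = inst (map (inst1 y s) \<tau>s) Fv t 0" using assms(1) by (intro inst_cong) simp
  finally show ?thesis .
qed

lemma forces_Eq_Eq_cong:
  assumes "p ||- Eq s s'" "p ||- Eq u u'" "over p s A" "over p u A"
  shows "p ||- Eq (Eq s u) (Eq s' u')"
proof (rule forces_Eq_OmI)
  show "over p (Eq s u) Om" "over p (Eq s' u') Om"
    using assms forces_Eq_over by (blast intro: over_Eq)+
qed (use forces_mono[OF assms(1)] forces_mono[OF assms(2)] in \<open>blast intro: forces_Eq_cong forces_sym\<close>)+

text \<open>The terms \<tau>s in the variable \<open>x\<close> stand for the dangling indices, and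
  the arrows passed to \<open>interp\<close> are their graphs over \<open>X\<close>. As
  \<open>t\<close> has no free variables, \<rho> is arbitrary. Variable, domain and list are
  generalized because a comprehension passes to the product of a universe with
  \<open>X\<close>.\<close>

lemma interp_eta:
  assumes "has_ty L Bs t B" and "fv t = {}" and "list_all2 (tm_in x) \<tau>s Bs" and "cl X (Pw (snd x))"
  shows "interp T (\<lambda>Z. Z) (\<lambda>(g, A, B). g) (eta L S t) (cls L S X)
      (map2 (\<lambda>\<tau> B. arr (graph x \<tau> B X) X (univ B)) \<tau>s Bs) \<rho>
    = arr (graph x (inst \<tau>s Fv t 0) B X) X (univ B)"
  using assms
proof (induction arbitrary: x X \<tau>s \<rho> rule: has_ty.induct)
  case (1 y Bs)
  then show ?case by simp
next
  case (2 i Bs)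
  then show ?case by (auto dest: list_all2_lengthD)
next
  case (3 h Bs t)
  let ?y = "(0, fdom L h)"
  have w: "wft (fdom L h)" using local_language 3(1) by (auto simp: local_language_def)
  have \<sigma>: "tm_in ?y (Fn h (Fv ?y)) (fcod L h)" using 3(1) w by (simp add: tm_in_def)
  have \<tau>: "tm_in x (inst \<tau>s Fv t 0) (fdom L h)" using 3 by (intro tm_in_inst) auto
  show ?case using 3 Cmp_graph_univ[OF _ \<sigma> 3(6), of "inst \<tau>s Fv t 0"] \<tau>
    by (simp add: eta_fn_def Let_def mapsto_graph)
next
  case (4 ts Bs As)
  have ty: "list_all2 (has_ty L Bs) ts As" using 4(2) by (auto elim: list_all2_mono)
  have fv: "fv t = {}" if "t \<in> set ts" for t using 4(3) that by simp
  have len: "length ts = length As" using ty by (rule list_all2_lengthD)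
  have \<tau>s: "list_all2 (tm_in x) (map (\<lambda>t. inst \<tau>s Fv t 0) ts) As"
    using ty fv 4(4) by (auto simp: list_all2_conv_all_nth intro!: tm_in_inst)
  have IH: "interp T (\<lambda>Z. Z) (\<lambda>(g, A, B). g) (eta L S (ts ! i)) (cls L S X)
      (map2 (\<lambda>\<tau> B. arr (graph x \<tau> B X) X (univ B)) \<tau>s Bs) \<rho>
    = arr (graph x (inst \<tau>s Fv (ts ! i) 0) (As ! i) X) X (univ (As ! i))" if "i < length ts" for i
    using list_all2_nthD[OF 4(2) that] fv[OF nth_mem[OF that]] 4(4,5) by blast
  have "map (\<lambda>t. interp T (\<lambda>Z. Z) (\<lambda>(g, A, B). g) (eta L S t) (cls L S X)
      (map2 (\<lambda>\<tau> B. arr (graph x \<tau> B X) X (univ B)) \<tau>s Bs) \<rho>) ts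
    = map2 (\<lambda>\<tau> B. arr (graph x \<tau> B X) X (univ B)) (map (\<lambda>t. inst \<tau>s Fv t 0) ts) As"
    using len IH by (intro nth_equalityI) auto
  moreover have l: "length As \<noteq> 1" using 4(1) len by simp
  ultimately show ?case
    using tuple_graph[OF 4(5) l \<tau>s] by (simp only: eta.simps interp.simps map_map o_def inst.simps)
next
  case (5 Bs t As i)
  let ?y = "(0, Prod As)"
  have \<tau>: "tm_in x (inst \<tau>s Fv t 0) (Prod As)" using 5 by (intro tm_in_inst) auto
  have w: "wft (Prod As)" using \<tau> by (rule tm_in_wf)
  have o: "map (\<lambda>A. ty_obj T (\<lambda>Z. Z) (eta_ty L S A)) As = map (\<lambda>A. cls L S (univ A)) As"
    using w by (simp add: ty_obj_eta)
  note P = Pj_univ[OF w 5(2), of ?y]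
  show ?case using 5 Cmp_graph_univ[of x "inst \<tau>s Fv t 0" ?y "Pr As i (Fv ?y)" "As ! i" X] \<tau> P
    by (simp add: o_def o)
next
  case (6 A Bs t)
  let ?C = "snd x"
  let ?z = "(0, Prod [A, ?C])"
  let ?X1 = "prodset [A, ?C] [univ A, X]"
  define z0 z1 where "z0 = (Pr [A, ?C] 0 (Fv ?z) :: ('g, 'f) tm)"
    and "z1 = (Pr [A, ?C] (Suc 0) (Fv ?z) :: ('g, 'f) tm)"
  \<comment> \<open>Over the enlarged domain the new index is read by the first projection, and the
    old parameters are composed with the second.\<close>
  let ?\<tau>s = "z0 # map (inst1 x z1) \<tau>s"
  have A: "wft A" using 6(1) .
  have cl1: "cls_list [univ A, X] [A, ?C]" using 6(6) cl_univ[OF A] by (simp add: cls_list_def)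
  have X1: "cl ?X1 (Pw (snd ?z))" using cl_prodset[OF cl1] by simp
  have t0: "tm_in ?z z0 A" and t1: "tm_in ?z z1 ?C"
    and f1: "fun_rel (Prod [A, ?C]) ?C (graph ?z z1 ?C ?X1) ?X1 X"
    using prod_graph[OF cl1, of 0 ?z] prod_graph[OF cl1, of 1 ?z] by (simp_all add: z0_def z1_def)
  have P: "Prd T [cls L S (univ A), cls L S X] = cls L S ?X1"
    "Pj T [cls L S (univ A), cls L S X] 0 = arr (graph ?z z0 A ?X1) ?X1 (univ A)"
    "Pj T [cls L S (univ A), cls L S X] 1 = arr (graph ?z z1 ?C ?X1) ?X1 X"
    using Prd_T[OF cl1] Pj_T[OF cl1, of 0 ?z] Pj_T[OF cl1, of 1 ?z] by (simp_all add: z0_def z1_def)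
  have len: "length \<tau>s = length Bs" using 6(5) by (rule list_all2_lengthD)
  have \<tau>: "tm_in x (\<tau>s ! i) (Bs ! i)" if "i < length Bs" for i using 6(5) that by (simp add: list_all2_conv_all_nth)
  have \<tau>s: "list_all2 (tm_in ?z) ?\<tau>s (A # Bs)"
    using t0 6(5) tm_in_comp[OF _ t1] by (auto simp: list_all2_map1 elim: list_all2_mono)
  have fvt: "fv t = {}" using 6(4) by simp
  have bs: "map (\<lambda>b. Cmp T b (arr (graph ?z z1 ?C ?X1) ?X1 X)) (map2 (\<lambda>\<tau> B. arr (graph x \<tau> B X) X (univ B)) \<tau>s Bs)
    = map2 (\<lambda>\<tau> B. arr (graph ?z \<tau> B ?X1) ?X1 (univ B)) (map (inst1 x z1) \<tau>s) Bs"
  proof (rule nth_equalityI)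
    fix i assume "i < length (map (\<lambda>b. Cmp T b (arr (graph ?z z1 ?C ?X1) ?X1 X)) (map2 (\<lambda>\<tau> B. arr (graph x \<tau> B X) X (univ B)) \<tau>s Bs))"
    then have i: "i < length Bs" by simp
    have "Cmp T (arr (graph x (\<tau>s ! i) (Bs ! i) X) X (univ (Bs ! i))) (arr (graph ?z z1 ?C ?X1) ?X1 X)
      = arr (graph ?z (inst1 x z1 (\<tau>s ! i)) (Bs ! i) ?X1) ?X1 (univ (Bs ! i))"
      using f1 by (intro Cmp_graph[OF t1 \<tau>[OF i] X1 _ fun_rel_graph_univ[OF \<tau>[OF i] 6(6)]]) simp
    then show "map (\<lambda>b. Cmp T b (arr (graph ?z z1 ?C ?X1) ?X1 X)) (map2 (\<lambda>\<tau> B. arr (graph x \<tau> B X) X (univ B)) \<tau>s Bs) ! i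
      = map2 (\<lambda>\<tau> B. arr (graph ?z \<tau> B ?X1) ?X1 (univ B)) (map (inst1 x z1) \<tau>s) Bs ! i"
      using i len by simp
  qed simp
  have IH: "interp T (\<lambda>Z. Z) (\<lambda>(g, A, B). g) (eta L S t) (cls L S ?X1)
      (arr (graph ?z z0 A ?X1) ?X1 (univ A) # map2 (\<lambda>\<tau> B. arr (graph ?z \<tau> B ?X1) ?X1 (univ B)) (map (inst1 x z1) \<tau>s) Bs) \<rho>'
    = arr (graph ?z (inst ?\<tau>s Fv t 0) Om ?X1) ?X1 (univ Om)" for \<rho>'
    using "6.IH"[OF fvt \<tau>s X1, of \<rho>'] by (simp only: zip_Cons_Cons list.map prod.case)
  have \<phi>: "tm_in ?z (inst ?\<tau>s Fv t 0) Om" using 6(2) fvt \<tau>s by (rule tm_in_inst)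
  have ty: "has_ty L Bs (Cm A t) (Pw A)" using 6(1,2) by simp
  have \<eta>: "tm_in x (inst \<tau>s Fv (Cm A t) 0) (Pw A)" using ty 6(4,5) by (rule tm_in_inst)
  have "transpose T (cls L S (univ A)) (cls L S X) (arr (graph ?z (inst ?\<tau>s Fv t 0) Om ?X1) ?X1 (univ Om))
    = arr (graph x (inst \<tau>s Fv (Cm A t) 0) (Pw A) X) X (univ (Pw A))"
  proof (rule transpose_T[OF 6(6) A \<eta> _ \<phi>])
    fix p a s assume a: "over p a A" and "p ||- Mem s X"
    then have s: "over p s ?C" using 6(6) by (blast intro: cl_Mem_over)
    let ?r = "Tup [a, s]"
    let ?\<omega>s = "map (inst1 x s) \<tau>s"
    have r: "over p ?r (snd ?z)" using over_Tup2[OF a s] by simp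
    have \<omega>s: "list_all2 (over p) ?\<omega>s Bs"
      using 6(5) tm_in_inst1[OF _ s] by (auto simp: list_all2_map1 elim: list_all2_mono)
    have e0: "p ||- Eq a (inst1 ?z ?r z0)" and e1: "p ||- Eq s (inst1 ?z ?r z1)"
      using forces_Pr_Tup2[OF a s, THEN forces_sym] by (simp_all add: z0_def z1_def)
    have "inst1 x s (inst \<tau>s Fv (Cm A t) 0) = inst ?\<omega>s Fv (Cm A t) 0"
      using 6(4,5) by (intro inst1_inst) auto
    moreover have "p ||- Mem a (inst ?\<omega>s Fv (Cm A t) 0) \<longleftrightarrow> p ||- inst (a # ?\<omega>s) Fv t 0"
    proof -
      have "over p (inst ?\<omega>s Fv (Cm A t) 0) (Pw A)"
        using ty \<omega>s 6(4) over_stage[OF a] by (intro over_inst_list[OF ty \<omega>s]) (simp add: env_def)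
      moreover have "\<exists>B. has_ty L [] \<tau> B" if "\<tau> \<in> set ?\<omega>s" for \<tau>
        using list_all2_memD[OF \<omega>s that] by (auto simp: over_def)
      then have "inst [a] Fv (inst ?\<omega>s Fv t (Suc 0)) 0 = inst (a # ?\<omega>s) Fv t 0" using fvt by (intro inst_open) auto
      ultimately show ?thesis using forces_Mem_Cm_iff[OF a, of "inst ?\<omega>s Fv t (Suc 0)"] by simp
    qed
    moreover have "inst1 ?z ?r (inst ?\<tau>s Fv t 0) = inst (map (inst1 ?z ?r) ?\<tau>s) Fv t 0"
      using fvt \<tau>s by (rule inst1_inst)
    \<comment> \<open>At the pair of \<open>a\<close> and \<open>s\<close> the parameters agree with
      \<open>a\<close> and with the old parameters at \<open>s\<close> only up to provable equality,
      because projections of pairs have to be reduced; congruence carries this over to the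
      body.\<close>
    moreover have "p ||- Eq (inst (a # ?\<omega>s) Fv t 0) (inst (map (inst1 ?z ?r) ?\<tau>s) Fv t 0)"
    proof (rule forces_inst_cong[OF 6(2)])
      show "list_all2 (over p) (a # ?\<omega>s) (A # Bs)" using a \<omega>s by simp
      show "list_all2 (over p) (map (inst1 ?z ?r) ?\<tau>s) (A # Bs)"
        unfolding list_all2_map1 using \<tau>s tm_in_inst1[OF _ r] by (rule list_all2_mono)
      show "\<forall>i<length (A # Bs). p ||- Eq ((a # ?\<omega>s) ! i) (map (inst1 ?z ?r) ?\<tau>s ! i)"
      proof (intro allI impI)
        fix i assume i: "i < length (A # Bs)"
        show "p ||- Eq ((a # ?\<omega>s) ! i) (map (inst1 ?z ?r) ?\<tau>s ! i)"
        proof (cases i)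
          case 0
          then show ?thesis using e0 by simp
        next
          case (Suc j)
          then have j: "j < length Bs" using i by simp
          have "p ||- Eq (inst1 x s (\<tau>s ! j)) (inst1 x (inst1 ?z ?r z1) (\<tau>s ! j))"
            using \<tau>[OF j] e1 s by (intro forces_inst1_cong) (auto simp: tm_in_def)
          then show ?thesis using Suc j len inst1_comp[OF \<tau>[OF j] t1] by simp
        qed
      qed
    qed (use fvt over_stage[OF a] in \<open>auto simp: env_def\<close>)
    ultimately show "p ||- Mem a (inst1 x s (inst \<tau>s Fv (Cm A t) 0)) \<longleftrightarrow> p ||- inst1 ?z ?r (inst ?\<tau>s Fv t 0)"
      by (metis forces_Eq_OmD forces_sym)
  qed simp
  then show ?case
    unfolding eta.simps interp.simps Let_def ty_obj_eta[OF A] P bs IH .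
next
  case (7 Bs s A t)
  define z where "z = (0 :: nat, Prod [A, A])"
  define \<delta> where "\<delta> = (Eq (Pr [A, A] 0 (Fv z)) (Pr [A, A] (Suc 0) (Fv z)) :: ('g, 'f) tm)"
  let ?s = "inst \<tau>s Fv s 0" and ?t = "inst \<tau>s Fv t 0"
  have \<tau>: "tm_in x ?s A" "tm_in x ?t A" using 7 by (auto intro!: tm_in_inst)
  note E = eq_arr_univ[OF tm_in_wf[OF \<tau>(1)], folded z_def, folded \<delta>_def]
  have fv: "fv s = {}" "fv t = {}" using 7(5) by auto
  note IH = "7.IH"(1)[OF fv(1) 7(6,7), of \<rho>] "7.IH"(2)[OF fv(2) 7(6,7), of \<rho>]
  have tup: "tm_in x (Tup [?s, ?t]) (snd z)" using tm_in_Tup2[OF \<tau>] by (simp add: z_def)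
  have "interp T (\<lambda>Z. Z) (\<lambda>(g, A, B). g) (eta L S (Eq s t)) (cls L S X)
      (map2 (\<lambda>\<tau> B. arr (graph x \<tau> B X) X (univ B)) \<tau>s Bs) \<rho>
    = Cmp T (eq_arr T (cls L S (univ A))) (tuple T (cls L S X) [arr (graph x ?s A X) X (univ A), arr (graph x ?t A X) X (univ A)])"
    using IH by (simp only: eta.simps interp.simps Let_def Cod_T)
  also have "\<dots> = arr (graph x (inst1 z (Tup [?s, ?t]) \<delta>) Om X) X (univ Om)"
    using tuple_graph[OF 7(7), of "[A, A]" "[?s, ?t]"] \<tau> Cmp_graph_univ[OF tup E(2) 7(7)] by (simp add: E(1) z_def)
  \<comment> \<open>The composite compares the projections of a pair; these reduce to
    \<open>?s\<close> and \<open>?t\<close> provably and not syntactically, so the classes of the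
    graphs are compared.\<close>
  also have "cls L S (graph x (inst1 z (Tup [?s, ?t]) \<delta>) Om X) = cls L S (graph x (Eq ?s ?t) Om X)"
  proof (rule graph_eqI[OF tm_in_comp[OF E(2) tup] tm_in_Eq[OF \<tau>] refl 7(7,7) refl])
    fix p r assume "p ||- Mem r X"
    then have r: "over p r (snd x)" using 7(7) by (blast intro: cl_Mem_over)
    note v = tm_in_inst1[OF \<tau>(1) r] tm_in_inst1[OF \<tau>(2) r]
    show "p ||- Eq (inst1 x r (inst1 z (Tup [?s, ?t]) \<delta>)) (inst1 x r (Eq ?s ?t))"
      using forces_Eq_Eq_cong[OF forces_Pr_Tup2[OF v], of A] over_Tup2[OF v]
      by (simp add: \<delta>_def over_Pr)
  qed
  then have "arr (graph x (inst1 z (Tup [?s, ?t]) \<delta>) Om X) X (univ Om) = arr (graph x (Eq ?s ?t) Om X) X (univ Om)"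
    by (simp add: arr_def)
  finally show ?case by (simp only: inst.simps)
next
  case (8 Bs s A t)
  define z where "z = (0 :: nat, Prod [A, Pw A])"
  define \<delta> where "\<delta> = (Mem (Pr [A, Pw A] 0 (Fv z)) (Pr [A, Pw A] (Suc 0) (Fv z)) :: ('g, 'f) tm)"
  let ?s = "inst \<tau>s Fv s 0" and ?t = "inst \<tau>s Fv t 0"
  have \<tau>: "tm_in x ?s A" "tm_in x ?t (Pw A)" using 8 by (auto intro!: tm_in_inst)
  note E = Eps_univ[OF tm_in_wf[OF \<tau>(1)], folded z_def, folded \<delta>_def]
  have fv: "fv s = {}" "fv t = {}" using 8(5) by auto
  note IH = "8.IH"(1)[OF fv(1) 8(6,7), of \<rho>] "8.IH"(2)[OF fv(2) 8(6,7), of \<rho>]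
  have tup: "tm_in x (Tup [?s, ?t]) (snd z)" using tm_in_Tup2[OF \<tau>] by (simp add: z_def)
  have "interp T (\<lambda>Z. Z) (\<lambda>(g, A, B). g) (eta L S (Mem s t)) (cls L S X)
      (map2 (\<lambda>\<tau> B. arr (graph x \<tau> B X) X (univ B)) \<tau>s Bs) \<rho>
    = Cmp T (Eps T (cls L S (univ A))) (tuple T (cls L S X) [arr (graph x ?s A X) X (univ A), arr (graph x ?t (Pw A) X) X (univ (Pw A))])"
    using IH by (simp only: eta.simps interp.simps Let_def Cod_T)
  also have "\<dots> = arr (graph x (inst1 z (Tup [?s, ?t]) \<delta>) Om X) X (univ Om)"
    using tuple_graph[OF 8(7), of "[A, Pw A]" "[?s, ?t]"] \<tau> Cmp_graph_univ[OF tup E(2) 8(7)] by (simp add: E(1) z_def)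
  also have "cls L S (graph x (inst1 z (Tup [?s, ?t]) \<delta>) Om X) = cls L S (graph x (Mem ?s ?t) Om X)"
  proof (rule graph_eqI[OF tm_in_comp[OF E(2) tup] tm_in_Mem[OF \<tau>] refl 8(7,7) refl])
    fix p r assume "p ||- Mem r X"
    then have r: "over p r (snd x)" using 8(7) by (blast intro: cl_Mem_over)
    note v = tm_in_inst1[OF \<tau>(1) r] tm_in_inst1[OF \<tau>(2) r]
    show "p ||- Eq (inst1 x r (inst1 z (Tup [?s, ?t]) \<delta>)) (inst1 x r (Mem ?s ?t))"
      using forces_Eq_Mem_cong[OF forces_Pr_Tup2[OF v], of A] over_Tup2[OF v]
      by (simp add: \<delta>_def over_Pr)
  qed
  then have "arr (graph x (inst1 z (Tup [?s, ?t]) \<delta>) Om X) X (univ Om) = arr (graph x (Mem ?s ?t) Om X) X (univ Om)"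
    by (simp add: arr_def)
  finally show ?case by (simp only: inst.simps)
qed

text \<open>Following \<open>f\<close> by the inclusion of \<open>Y\<close> into its universe does
  not change the graph, so \<open>F\<close> itself represents the composite. Pairings are computed
  for components with values in universes.\<close>

lemma fun_rel_into_univ: "fun_rel A B F X Y \<Longrightarrow> fun_rel A B F X (univ B)"
proof -
  assume F: "fun_rel A B F X Y"
  have w: "wft B" using fun_rel_cl(2)[OF F] by (rule cl_wf_Pw)
  show ?thesis
    using fun_rel_cl[OF F] cl_univ[OF w] fun_rel_dom[OF F] fun_rel_over[OF F] fun_rel_unique[OF F]
    by (intro fun_relI) (auto simp: forces_univ[OF w] intro: fun_rel_total[OF F])
qed

lemma Th_graph:
  fixes n :: nat
  assumes F: "fun_rel A B F X Y"
  defines "u \<equiv> Fv (n, ty_sym T (cls L S X))"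
  defines "\<phi> \<equiv> Mem (Tup [Fn (incl_sym L S A X) u, Fn (incl_sym L S B Y) (Fn (fn_sym L S (F, X, Y)) u)]) (eta L S F)"
  shows "({}, \<phi>) \<in> Th T"
proof -
  note X = fun_rel_cl(1)[OF F] and Y = fun_rel_cl(2)[OF F] and cF = fun_rel_cl(3)[OF F]
  have w: "wft A" "wft B" using X Y by (auto dest: cl_wf_Pw)
  define iA where "iA = graph (0, A) (Fv (0, A)) A X"
  define iB where "iB = graph (0, B) (Fv (0, B)) B Y"
  have tA: "tm_in (0, A) (Fv (0, A)) A" and tB: "tm_in (0, B) (Fv (0, B)) B" using w by (simp_all add: tm_in_def)
  have fA: "fun_rel A A iA X (univ A)" and fB: "fun_rel B B iB Y (univ B)"
    using fun_rel_graph_univ[OF tA, of X] fun_rel_graph_univ[OF tB, of Y] X Y by (simp_all add: iA_def iB_def)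
  have gA: "p ||- Mem (Tup [s, t]) iA \<longleftrightarrow> p ||- Mem s X \<and> p ||- Eq t s" for p s t
    unfolding iA_def using forces_graph[OF tA, of X] X by simp
  have gB: "p ||- Mem (Tup [s, t]) iB \<longleftrightarrow> p ||- Mem s Y \<and> p ||- Eq t s" for p s t
    unfolding iB_def using forces_graph[OF tB, of Y] Y by simp
  have sA: "incl_sym L S A X = (arr iA X (univ A), ty_sym T (cls L S X), eta_ty L S A)"
    and sB: "incl_sym L S B Y = (arr iB Y (univ B), ty_sym T (cls L S Y), eta_ty L S B)"
    and sF: "fn_sym L S (F, X, Y) = (arr F X Y, ty_sym T (cls L S X), ty_sym T (cls L S Y))"
    by (simp_all add: incl_sym_def fn_sym_def Let_def mapsto_graph iA_def iB_def)
  have mem: "incl_sym L S A X \<in> fns IL" "incl_sym L S B Y \<in> fns IL" "fn_sym L S (F, X, Y) \<in> fns IL"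
    unfolding sA sB sF fns_IL
    using ArrI[OF fA] ArrI[OF fB] ArrI[OF F] w cls_Obj[OF X] cls_Obj[OF Y]
    by (simp_all add: wf_ty_sym wf_eta ty_obj_ty_sym ty_obj_eta)
  have etaF: "has_ty IL [] (eta L S F) (Pw (Prod [eta_ty L S A, eta_ty L S B]))"
    using has_ty_eta[OF cl_ty[OF cF]] by simp
  have fvF: "fv (eta L S F) = {}" using cl_fv[OF cF] by (simp add: fv_eta)
  have fv\<phi>: "fv \<phi> = {(n, ty_sym T (cls L S X))}" by (simp add: \<phi>_def u_def fvF)
  have tup: "has_ty IL [] (Tup [Fn (incl_sym L S A X) u, Fn (incl_sym L S B Y) (Fn (fn_sym L S (F, X, Y)) u)])
      (Prod [eta_ty L S A, eta_ty L S B])"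
    using mem wf_ty_sym[OF cls_Obj[OF X]] by (simp add: sA sB sF fdom_IL fcod_IL u_def)
  have seq: "sequent IL ({}, \<phi>)"
    unfolding sequent_def \<phi>_def using has_ty.intros(8)[OF tup etaF] by (simp del: has_ty_Mem)
  \<comment> \<open>\<open>H\<close> pairs the inclusion of \<open>X\<close> with \<open>F\<close>:
    it is the arrow of the term on the left of the membership sign.\<close>
  obtain H where H: "fun_rel A (Prod [A, B]) H X (univ (Prod [A, B]))"
    and gH: "\<And>p s t. p ||- Mem (Tup [s, t]) H \<longleftrightarrow> over p t (Prod [A, B]) \<and>
      p ||- Mem (Tup [s, Pr [A, B] 0 t]) iA \<and> p ||- Mem (Tup [s, Pr [A, B] (Suc 0) t]) F"
    by (rule ex_pair[OF fA fun_rel_into_univ[OF F]]) blast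
  define x where "x = (0 :: nat, A)"
  have X': "cl X (Pw (snd x))" using X by (simp add: x_def)
  have tF: "tm_in x F (Pw (Prod [A, B]))" using cF by (rule tm_in_cl)
  \<comment> \<open>The constant arrow with value \<open>F\<close>, which interprets the translated
    graph over \<open>X\<close>.\<close>
  define c where "c = graph x F (Pw (Prod [A, B])) X"
  have fc: "fun_rel A (Pw (Prod [A, B])) c X (univ (Pw (Prod [A, B])))"
    using fun_rel_graph_univ[OF tF X'] by (simp add: x_def c_def)
  have gc: "p ||- Mem (Tup [s, t]) c \<longleftrightarrow> p ||- Mem s X \<and> p ||- Eq t F" for p s t
    unfolding c_def forces_graph[OF tF X'] inst_cl[OF cF] ..
  let ?P = "Prod [A, B]"
  have wP: "wft ?P" using w by simp
  \<comment> \<open>\<open>K\<close> pairs \<open>H\<close> with the constant \<open>c\<close>; the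
    formula is interpreted by \<open>K\<close> followed by evaluation.\<close>
  obtain K where K: "fun_rel A (Prod [?P, Pw ?P]) K X (univ (Prod [?P, Pw ?P]))"
    and gK: "\<And>p s t. p ||- Mem (Tup [s, t]) K \<longleftrightarrow> over p t (Prod [?P, Pw ?P]) \<and>
      p ||- Mem (Tup [s, Pr [?P, Pw ?P] 0 t]) H \<and> p ||- Mem (Tup [s, Pr [?P, Pw ?P] (Suc 0) t]) c"
    by (rule ex_pair[OF H fc]) blast
  define z where "z = (0 :: nat, Prod [?P, Pw ?P])"
  define \<epsilon> where "\<epsilon> = (Mem (Pr [?P, Pw ?P] 0 (Fv z)) (Pr [?P, Pw ?P] (Suc 0) (Fv z)) :: ('g, 'f) tm)"
  note E = Eps_univ[OF wP, folded z_def, folded \<epsilon>_def]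
  have UP: "cl (univ (Prod [?P, Pw ?P])) (Pw (snd z))" using cl_univ[of "Prod [?P, Pw ?P]"] wP by (simp add: z_def)
  have fE: "fun_rel (Prod [?P, Pw ?P]) Om (graph z \<epsilon> Om (univ (Prod [?P, Pw ?P]))) (univ (Prod [?P, Pw ?P])) (univ Om)"
    using fun_rel_graph_univ[OF E(2) UP] by (simp add: z_def)
  have gE: "p ||- Mem (Tup [t, \<omega>]) (graph z \<epsilon> Om (univ (Prod [?P, Pw ?P]))) \<Longrightarrow>
      p ||- Eq \<omega> (Mem (Pr [?P, Pw ?P] 0 t) (Pr [?P, Pw ?P] (Suc 0) t))" for p t \<omega>
    unfolding forces_graph[OF E(2) UP] by (simp add: \<epsilon>_def)
  \<comment> \<open>The only free variable is the one of \<open>u\<close>. The product of the single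
    object \<open>X\<close> is \<open>X\<close> itself, with the identity as projection, so the
    variable is interpreted by the identity.\<close>
  have val: "interp T (\<lambda>Z. Z) (\<lambda>(g, A, B). g) \<phi> (cls L S X) [] (\<lambda>_. Idn T (cls L S X)) = true_on T (cls L S X)"
  proof -
    let ?id = "graph (0, A) (Fv (0, A)) A X"
    have id: "Idn T (cls L S X) = arr ?id X X" "fun_rel A A ?id X X" using X by (simp_all add: Idn_T fun_rel_Idn)
    have gid: "p ||- Mem (Tup [s, t]) ?id \<longleftrightarrow> p ||- Mem s X \<and> p ||- Eq t s" for p s t
      using gA unfolding iA_def .
    have c1: "Cmp T (arr iA X (univ A)) (arr ?id X X) = arr iA X (univ A)"
      by (rule Cmp_eqI[OF id(2) fA fA]) (auto simp: gA gid intro: forces_trans)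
    have c2: "Cmp T (arr F X Y) (arr ?id X X) = arr F X Y"
    proof (rule Cmp_eqI[OF id(2) F F])
      fix p s t v assume "p ||- Mem (Tup [s, t]) ?id" and v: "p ||- Mem (Tup [t, v]) F"
      then have "p ||- Eq t s" by (simp add: gid)
      then show "p ||- Mem (Tup [s, v]) F" using fun_rel_over[OF F v] forces_refl v by (blast intro: forces_Mem_pair_eq)
    qed
    have c3: "Cmp T (arr iB Y (univ B)) (arr F X Y) = arr F X (univ B)"
    proof (rule Cmp_eqI[OF F fB fun_rel_into_univ[OF F]])
      fix p s t v assume t: "p ||- Mem (Tup [s, t]) F" and "p ||- Mem (Tup [t, v]) iB"
      then have "p ||- Eq t v" by (auto simp: gB intro: forces_sym)
      then show "p ||- Mem (Tup [s, v]) F" using fun_rel_over[OF F t] forces_refl t by (blast intro: forces_Mem_pair_eq)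
    qed
    have t1: "tuple T (cls L S X) [arr iA X (univ A), arr F X (univ B)] = arr H X (univ ?P)"
      by (rule tuple_pair[OF fA fun_rel_into_univ[OF F] H]) (simp_all add: gH)
    have t2: "tuple T (cls L S X) [arr H X (univ ?P), arr c X (univ (Pw ?P))] = arr K X (univ (Prod [?P, Pw ?P]))"
      by (rule tuple_pair[OF H fc K]) (simp_all add: gK)
    have iF: "interp T (\<lambda>Z. Z) (\<lambda>(g, A, B). g) (eta L S F) (cls L S X) [] \<rho> = arr c X (univ (Pw ?P))" for \<rho>
      using interp_eta[OF cl_ty[OF cF] cl_fv[OF cF] _ X', of "[]" \<rho>] inst_cl[OF cF] by (simp add: c_def)
    have "Cmp T (Eps T (cls L S (univ ?P))) (arr K X (univ (Prod [?P, Pw ?P]))) = true_on T (cls L S X)"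
      unfolding E(1) true_on_T[OF X']
    proof (rule Cmp_eqI[OF K fE])
      show "fun_rel A Om (graph x tt Om X) X (univ Om)" using fun_rel_true[OF X'] by (simp add: x_def)
      fix p s t \<omega> assume t: "p ||- Mem (Tup [s, t]) K"
        and "p ||- Mem (Tup [t, \<omega>]) (graph z \<epsilon> Om (univ (Prod [?P, Pw ?P])))"
      then have \<omega>: "p ||- Eq \<omega> (Mem (Pr [?P, Pw ?P] 0 t) (Pr [?P, Pw ?P] (Suc 0) t))" by (blast intro: gE)
      let ?v = "Pr [?P, Pw ?P] 0 t"
      have v: "over p ?v ?P" "p ||- Mem (Tup [s, Pr [A, B] 0 ?v]) iA" "p ||- Mem (Tup [s, Pr [A, B] (Suc 0) ?v]) F"
        and sX: "p ||- Mem s X" and e: "p ||- Eq (Pr [?P, Pw ?P] (Suc 0) t) F" using t by (auto simp: gK gH gc)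
      have "p ||- Eq s (Pr [A, B] 0 ?v)" using v(2) by (auto simp: gA intro: forces_sym)
      moreover have "p ||- Eq (Pr [A, B] (Suc 0) ?v) (Pr [A, B] (Suc 0) ?v)"
        using v(1) by (auto intro!: forces_refl[of p _ B] over_Pr)
      ultimately have "p ||- Mem (Tup [Pr [A, B] 0 ?v, Pr [A, B] (Suc 0) ?v]) F"
        \<comment> \<open>The components of \<open>?v\<close> are \<open>s\<close> and a value of
          \<open>F\<close> at \<open>s\<close>, so \<open>?v\<close> is an element of
          \<open>F\<close>; hence the truth value \<omega> of this membership holds.\<close>
        using v(3) by (blast intro: forces_Mem_pair_eq)
      then have "p ||- Mem ?v F" using forces_eta2[OF v(1)] by (blast intro: forces_Mem_eq forces_sym)
      then have "p ||- Mem ?v (Pr [?P, Pw ?P] (Suc 0) t)" using e by (blast intro: forces_Eq_PwD forces_sym)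
      then have "p ||- \<omega>" using \<omega> by (blast intro: forces_Eq_OmD forces_sym)
      then show "p ||- Mem (Tup [s, \<omega>]) (graph x tt Om X)" unfolding forces_true[OF X'] using sX by simp
    qed
    then show ?thesis by (simp add: \<phi>_def u_def sA sB sF Let_def id(1) c1 c2 c3 t1 iF t2)
  qed
  have "valid T (\<lambda>Z. Z) (\<lambda>(g, A, B). g) ({}, \<phi>)"
    unfolding valid_def prod.case
  proof (intro allI impI)
    fix xs assume xs: "distinct xs \<and> set xs = \<Union> (fv ` {}) \<union> fv \<phi>"
    then have "length xs = 1" using distinct_card[of xs] by (simp add: fv\<phi>)
    then obtain y where "xs = [y]" by (auto simp: length_Suc_conv)
    then have xs': "xs = [(n, ty_sym T (cls L S X))]" using xs by (simp add: fv\<phi>)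
    \<comment> \<open>For lists of length one the linguistic topos takes the object itself as
      product, so the context of the sequent is exactly \<open>X\<close>.\<close>
    have P1: "Prd T [Q] = Q" "Pj T [Q] i = Idn T Q" for Q i by (simp_all add: ling_topos_def Let_def)
    have tr: "true_on T (cls L S X) \<in> hom T (cls L S X) (cls L S (univ Om))"
      using is_meet_empty[OF X] by (simp add: is_meet_def)
    show "let As = map (ty_obj T (\<lambda>Z. Z) \<circ> snd) xs; W = Prd T As;
          \<rho> = (\<lambda>x. Pj T As (THE i. i < length xs \<and> xs ! i = x));
          val = (\<lambda>\<phi>. interp T (\<lambda>Z. Z) (\<lambda>(g, A, B). g) \<phi> W [] \<rho>)
      in \<exists>w. is_meet T W (val ` {}) w \<and> leq T w (val \<phi>)"
      using is_meet_empty[OF X] leq_true_on[OF tr X] val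
      by (simp add: xs' Let_def ty_obj_ty_sym P1 del: split_paired_Ex) blast
  qed
  then show ?thesis using seq by (simp add: Th_def)
qed

end

theorem theorem3p1:
  fixes L :: "('g, 'f) lang" and S :: "('g, 'f) sequent set"
    and A B :: "'g ty" and F X Y :: "('g, 'f) tm" and n :: nat
  assumes "local_language L"
    and "local_set_theory L S"
    and "S_function L S A B (F, X, Y)"
  defines "\<T> \<equiv> ling_topos L S"
  defines "u \<equiv> Fv (n, ty_sym \<T> (cls L S X))"
  shows "derives (internal_lang \<T>) (Th \<T>) {}
    (Mem (Tup [Fn (incl_sym L S A X) u, Fn (incl_sym L S B Y) (Fn (fn_sym L S (F, X, Y)) u)])
         (eta L S F))"
proof -
  interpret lst L S using assms(1,2) by unfold_locales
  have "fun_rel A B F X Y" using assms(3) by (simp add: S_function_iff)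
  then show ?thesis unfolding \<T>_def u_def by (intro derives.hypothesis Th_graph)
qed

end
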